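(* Let $\mathcal{H}=(C,F,D,G)$ be a hybrid system on $\mathbb{R}^n$ satisfying the Basic Assumptions, and let $\Gamma_1\subset\Gamma_2\subset\mathbb{R}^n$ with $\Gamma_1$ compact and $\Gamma_2$ closed. If (i) $\Gamma_1$ is asymptotically stable relative to $\Gamma_2$, and (ii) $\Gamma_2$ is locally stable near $\Gamma_1$, then $\Gamma_1$ is stable for $\mathcal{H}$.
   Context: Notation: $|x|_\Gamma=\inf_{y\in\Gamma}|x-y|$ and, for $c>0$, $B_c(\Gamma)=\{x\in\mathbb{R}^n:|x|_\Gamma<c\}$. Hybrid system: a 4-tuple $\mathcal{H}=(C,F,D,G)$ satisfying the Basic Assumptions: (A1) $C,D$ are closed subsets of $\mathbb{R}^n$; (A2) $F:\mathbb{R}^n\rightrightarrows\mathbb{R}^n$ is a set-valued map that is outer semicontinuous, locally bounded on $C$, with $F(x)$ nonempty and convex for each $x\in C$; (A3) $G:\mathbb{R}^n\rightrightarrows\mathbb{R}^n$ is outer semicontinuous, locally bounded on $D$, with $G(x)$ nonempty for each $x\in D$. Solutions: a hybrid time domain is a subset of $\mathbb{R}_{\ge0}\times\mathbb{N}$ that is a union of infinitely many sets $[t_j,t_{j+1}]\times\{j\}$, $j\in\mathbb{N}$, or of finitely many such sets with the last one of the form $[t_j,t_{j+1}]\times\{j\}$, $[t_j,t_{j+1})\times\{j\}$ or $[t_j,\infty)\times\{j\}$, where $0=t_0\le t_1\le\cdots$. A hybrid arc is a function $x:\mathrm{dom}(x)\to\mathbb{R}^n$ on a hybrid time domain such that for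 each $j$ the map $t\mapsto x(t,j)$ is locally absolutely continuous on $I_j=\{t:(t,j)\in\mathrm{dom}(x)\}$. A solution of $\mathcal{H}$ is a hybrid arc such that: for each $j$ for which $I_j$ has nonempty interior, $\dot x(t,j)\in F(x(t,j))$ for almost all $t\in I_j$ and $x(t,j)\in C$ for all $t\in[\min I_j,\sup I_j)$; and whenever $(t,j),(t,j+1)\in\mathrm{dom}(x)$, $x(t,j)\in D$ and $x(t,j+1)\in G(x(t,j))$. (From a point outside $C\cup D$ the only solution is the trivial one with domain $\{(0,0)\}$.) All solutions considered are maximal (cannot be extended). A solution is complete if its domain is unbounded, and bounded if its range is bounded. $\mathcal{S}_{\mathcal{H}}(x_0)$ is the set of maximal solutions with $x(0,0)=x_0$, $\mathcal{S}_{\mathcal{H}}(U)=\bigcup_{x_0\in U}\mathcal{S}_{\mathcal{H}}(x_0)$, and $\mathrm{rge}(\mathcal{S}_{\mathcal{H}}(U))$ is the union of the ranges of the solutions in $\mathcal{S}_{\mathcal{H}}(U)$. Write $(s,k)\preceq(t,j)$ if $s\le t$ and $k\le j$. Stability notions for a compact set $\Gamma$: $\Gamma$ is stable for $\mathcal{H}$ if for every $\varepsilon>0$ there is $\delta>0$ with $\mathrm{rge}(\mathcal{S}_{\mathcal{H}}(B_\delta(\Gamma)))\subset B_\varepsilon(\Gamma)$. The basin of attraction of $\Gamma$ is the set of points $p\in\mathbb{R}^n$ such that each $x\in\mathcal{S}_{\mathcal{H}}(p)$ is bounded and, if $x$ is complete, $|x(t,j)|_\Gamma\to0$ as $t+j\to\infty$,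 $(t,j)\in\mathrm{dom}(x)$. $\Gamma$ is attractive if its basin of attraction contains $\Gamma$ in its interior; asymptotically stable if stable and attractive. Relative properties: for a closed set $\Gamma_2$, the restriction of $\mathcal{H}$ to $\Gamma_2$ is $\mathcal{H}|_{\Gamma_2}=(C\cap\Gamma_2,F,D\cap\Gamma_2,G)$. $\Gamma_1\subset\Gamma_2$ has a property relative to $\Gamma_2$ if it has that property for $\mathcal{H}|_{\Gamma_2}$. Local stability near a set: for $\Gamma_1\subset\Gamma_2$ with $\Gamma_1$ compact, $\Gamma_2$ is locally stable near $\Gamma_1$ for $\mathcal{H}$ if there exists $r>0$ such that for every $\varepsilon>0$ there exists $\delta>0$ such that, for each $x\in\mathcal{S}_{\mathcal{H}}(B_\delta(\Gamma_1))$ and each $(t,j)\in\mathrm{dom}(x)$: if $x(s,k)\in B_r(\Gamma_1)$ for all $(s,k)\in\mathrm{dom}(x)$ with $(s,k)\preceq(t,j)$, then $x(t,j)\in B_\varepsilon(\Gamma_2)$. *)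

theory Defs
  imports "HOL-Analysis.Analysis"
begin

definition absolutely_continuous_on :: "real set \<Rightarrow> (real \<Rightarrow> 'a::real_normed_vector) \<Rightarrow> bool" where
  "absolutely_continuous_on S f \<longleftrightarrow>
     (\<forall>e>0. \<exists>d>0. \<forall>(n::nat) u v.
        (\<forall>i<n. u i \<le> v i \<and> {u i..v i} \<subseteq> S) \<and>
        disjoint_family_on (\<lambda>i. {u i<..<v i}) {..<n} \<and>
        (\<Sum>i<n. v i - u i) < d \<longrightarrow>
        (\<Sum>i<n. norm (f (v i) - f (u i))) < e)"

definition locally_absolutely_continuous_on :: "real set \<Rightarrow> (real \<Rightarrow> 'a::real_normed_vector) \<Rightarrow> bool" where
  "locally_absolutely_continuous_on I f \<longleftrightarrow>
     (\<forall>a b. {a..b} \<subseteq> I \<longrightarrow> absolutely_continuous_on {a..b} f)"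

definition outer_semicontinuous :: "('a::topological_space \<Rightarrow> 'b::topological_space set) \<Rightarrow> bool" where
  "outer_semicontinuous F \<longleftrightarrow>
     (\<forall>X Y x y. X \<longlonglongrightarrow> x \<and> Y \<longlonglongrightarrow> y \<and> (\<forall>n. Y n \<in> F (X n)) \<longrightarrow> y \<in> F x)"

definition locally_bounded_on :: "'a::topological_space set \<Rightarrow> ('a \<Rightarrow> 'b::metric_space set) \<Rightarrow> bool" where
  "locally_bounded_on S F \<longleftrightarrow>
     (\<forall>x\<in>S. \<exists>U. open U \<and> x \<in> U \<and> bounded (\<Union>y\<in>U. F y))"

record 'a hybrid_system =
  flow_set :: "'a set"
  flow_map :: "'a \<Rightarrow> 'a set"
  jump_set :: "'a set"
  jump_map :: "'a \<Rightarrow> 'a set"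

definition basic_assumptions :: "'a::euclidean_space hybrid_system \<Rightarrow> bool" where
  "basic_assumptions H \<longleftrightarrow>
     closed (flow_set H) \<and> closed (jump_set H) \<and>
     outer_semicontinuous (flow_map H) \<and> locally_bounded_on (flow_set H) (flow_map H) \<and>
     (\<forall>x\<in>flow_set H. flow_map H x \<noteq> {} \<and> convex (flow_map H x)) \<and>
     outer_semicontinuous (jump_map H) \<and> locally_bounded_on (jump_set H) (jump_map H) \<and>
     (\<forall>x\<in>jump_set H. jump_map H x \<noteq> {})"

definition restrict_system :: "'a hybrid_system \<Rightarrow> 'a set \<Rightarrow> 'a hybrid_system" where
  "restrict_system H \<Gamma> =
     \<lparr>flow_set = flow_set H \<inter> \<Gamma>, flow_map = flow_map H,
      jump_set = jump_set H \<inter> \<Gamma>, jump_map = jump_map H\<rparr>"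

(* The half-open last piece is required to be nonempty: otherwise it contributes nothing, or,
   when it is also the first piece, yields the empty set, which does not contain (0,0).
   In the finite case only t 0, ..., t (Suc J) matter. *)
definition hybrid_time_domain :: "(real \<times> nat) set \<Rightarrow> bool" where
  "hybrid_time_domain E \<longleftrightarrow>
     (\<exists>t::nat \<Rightarrow> real. t 0 = 0 \<and> mono t \<and>
        (E = (\<Union>j. {t j..t (Suc j)} \<times> {j}) \<or>
         (\<exists>J L. E = (\<Union>j<J. {t j..t (Suc j)} \<times> {j}) \<union> L \<times> {J} \<and>
            (L = {t J..t (Suc J)} \<or>
             (t J < t (Suc J) \<and> L = {t J..<t (Suc J)}) \<or>
             L = {t J..}))))"

definition time_slice :: "(real \<times> nat) set \<Rightarrow> nat \<Rightarrow> real set" where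
  "time_slice E j = {t. (t, j) \<in> E}"

(* An arc is given by its domain E together with a total function x, of which only the
   values on E are meaningful. *)
definition hybrid_arc :: "(real \<times> nat) set \<Rightarrow> (real \<times> nat \<Rightarrow> 'a::euclidean_space) \<Rightarrow> bool" where
  "hybrid_arc E x \<longleftrightarrow>
     hybrid_time_domain E \<and>
     (\<forall>j. locally_absolutely_continuous_on (time_slice E j) (\<lambda>t. x (t, j)))"

(* For an interval I with a minimum, [min I, sup I) is the set of t in I that are not the
   maximum of I; this also covers sup I = infinity. *)
definition solution ::
    "'a::euclidean_space hybrid_system \<Rightarrow> (real \<times> nat) set \<Rightarrow> (real \<times> nat \<Rightarrow> 'a) \<Rightarrow> bool" where
  "solution H E x \<longleftrightarrow>
     hybrid_arc E x \<and>
     (\<forall>j. interior (time_slice E j) \<noteq> {} \<longrightarrow>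
        (AE t in lebesgue. t \<in> time_slice E j \<longrightarrow>
           (\<exists>v\<in>flow_map H (x (t, j)).
              ((\<lambda>s. x (s, j)) has_vector_derivative v) (at t within time_slice E j))) \<and>
        (\<forall>t\<in>time_slice E j. (\<exists>s\<in>time_slice E j. t < s) \<longrightarrow> x (t, j) \<in> flow_set H)) \<and>
     (\<forall>t j. (t, j) \<in> E \<and> (t, Suc j) \<in> E \<longrightarrow>
        x (t, j) \<in> jump_set H \<and> x (t, Suc j) \<in> jump_map H (x (t, j)))"

definition maximal_solution ::
    "'a::euclidean_space hybrid_system \<Rightarrow> (real \<times> nat) set \<Rightarrow> (real \<times> nat \<Rightarrow> 'a) \<Rightarrow> bool" where
  "maximal_solution H E x \<longleftrightarrow>
     solution H E x \<and>
     \<not> (\<exists>E' x'. solution H E' x' \<and> E \<subset> E' \<and> (\<forall>p\<in>E. x' p = x p))"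

definition complete_domain :: "(real \<times> nat) set \<Rightarrow> bool" where
  "complete_domain E \<longleftrightarrow> \<not> bounded ((\<lambda>(t, j). (t, real j)) ` E)"

definition solutions_from ::
    "'a::euclidean_space hybrid_system \<Rightarrow> 'a set \<Rightarrow> ((real \<times> nat) set \<times> (real \<times> nat \<Rightarrow> 'a)) set" where
  "solutions_from H U = {(E, x). maximal_solution H E x \<and> x (0, 0) \<in> U}"

definition range_of_solutions :: "'a::euclidean_space hybrid_system \<Rightarrow> 'a set \<Rightarrow> 'a set" where
  "range_of_solutions H U = (\<Union>(E, x)\<in>solutions_from H U. x ` E)"

(* The library sets infdist x {} = 0, so set_ball c {} = UNIV for c > 0 rather than {};
   the empty set is stable with either convention. *)
definition set_ball :: "real \<Rightarrow> 'a::metric_space set \<Rightarrow> 'a set" where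
  "set_ball c \<Gamma> = {x. infdist x \<Gamma> < c}"

definition stable_set :: "'a::euclidean_space hybrid_system \<Rightarrow> 'a set \<Rightarrow> bool" where
  "stable_set H \<Gamma> \<longleftrightarrow>
     (\<forall>e>0. \<exists>d>0. range_of_solutions H (set_ball d \<Gamma>) \<subseteq> set_ball e \<Gamma>)"

definition basin_of_attraction :: "'a::euclidean_space hybrid_system \<Rightarrow> 'a set \<Rightarrow> 'a set" where
  "basin_of_attraction H \<Gamma> =
     {p. \<forall>(E, x)\<in>solutions_from H {p}.
           bounded (x ` E) \<and>
           (complete_domain E \<longrightarrow>
             ((\<lambda>q. infdist (x q) \<Gamma>) \<longlongrightarrow> 0)
               (inf (filtercomap (\<lambda>(t, j). t + real j) at_top) (principal E)))}"

definition attractive :: "'a::euclidean_space hybrid_system \<Rightarrow> 'a set \<Rightarrow> bool" where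
  "attractive H \<Gamma> \<longleftrightarrow> \<Gamma> \<subseteq> interior (basin_of_attraction H \<Gamma>)"

definition asymptotically_stable :: "'a::euclidean_space hybrid_system \<Rightarrow> 'a set \<Rightarrow> bool" where
  "asymptotically_stable H \<Gamma> \<longleftrightarrow> stable_set H \<Gamma> \<and> attractive H \<Gamma>"

definition asymptotically_stable_relative_to ::
    "'a::euclidean_space hybrid_system \<Rightarrow> 'a set \<Rightarrow> 'a set \<Rightarrow> bool" where
  "asymptotically_stable_relative_to H \<Gamma>1 \<Gamma>2 \<longleftrightarrow>
     asymptotically_stable (restrict_system H \<Gamma>2) \<Gamma>1"

definition locally_stable_near :: "'a::euclidean_space hybrid_system \<Rightarrow> 'a set \<Rightarrow> 'a set \<Rightarrow> bool" where
  "locally_stable_near H \<Gamma>2 \<Gamma>1 \<longleftrightarrow>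
     (\<exists>r>0. \<forall>e>0. \<exists>d>0. \<forall>(E, x)\<in>solutions_from H (set_ball d \<Gamma>1). \<forall>(t, j)\<in>E.
        (\<forall>(s, k)\<in>E. s \<le> t \<and> k \<le> j \<longrightarrow> x (s, k) \<in> set_ball r \<Gamma>1) \<longrightarrow>
        x (t, j) \<in> set_ball e \<Gamma>2)"

end

theory Submission
  imports Defs "HOL-Complex_Analysis.Great_Picard"
begin

text \<open>Suppose that the first set is not stable. Then, for a small radius, there are solutions starting
  near it that leave its ball of that radius, and by local stability of the second set they stay
  arbitrarily close to the second set until they leave. Cut each solution at its last visit to a still
  smaller ball and decompose the remaining part into steps, each a flow of duration at most 1 followed
  by at most one jump. By local boundedness the end points of the steps converge along a subsequence;
  by outer semicontinuity, convexity and the almost everywhere differentiability of Lipschitz curves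
  the limit steps are steps of the restricted system. If the number of steps stays bounded along a
  subsequence, the limit is a solution of the restricted system that leaves the ball, contradicting
  relative stability; otherwise it is a complete solution that never returns to the smaller ball,
  contradicting relative attractivity.\<close>

section \<open>Lipschitz curves are differentiable almost everywhere\<close>

text \<open>The cut at the last visit is forced: as the starting points approach \<Gamma>1, uncut
  solutions may linger near it ever longer, and their limit could stay in \<Gamma>1 forever,
  contradicting nothing. After the cut the limit starts within \<delta> of \<Gamma>1 but has
  distance at least \<delta> after every later step, which attractivity rules out. Since \<delta> is
  below both the stability radius for \<epsilon> and the radius of a neighbourhood inside the basin,
  the same chain serves both contradictions. Steps replace convergence of hybrid arcs with varying
  domains: only end points are extracted diagonally, and the flow inside each limit step is found
  afterwards, one step at a time. All steps but the last advance hybrid time by at least 1, so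
  infinitely many limit steps cannot accumulate at a finite hybrid time. Two obstacles remain. A
  limit of flows is only known to be Lipschitz, whereas a solution needs a derivative in the flow
  map almost everywhere. And stability and attractivity speak of maximal solutions, so the limits
  must first be extended by Zorn's lemma.\<close>

text \<open>The steep slopes need only occur for some arbitrarily small increments to the right of each
  point of the closed set, because the supremum of the good endpoints is pushed to the right by a
  single increment.\<close>

lemma increment_ge_measure_steep:
  fixes f :: "real \<Rightarrow> real"
  assumes "mono f" and cont: "continuous_on UNIV f" and "closed K" and "q \<ge> 0" and "a \<le> b"
    and steep: "\<And>t e. t \<in> K \<Longrightarrow> e > 0 \<Longrightarrow> \<exists>h>0. h < e \<and> q * h \<le> f (t + h) - f t"
  shows "q * measure lebesgue (K \<inter> {a..b}) \<le> f b - f a"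
proof -
  define m where "m t = measure lebesgue (K \<inter> {a..t})" for t
  have lm: "K \<inter> {u..v} \<in> lmeasurable" for u v
    using \<open>closed K\<close> closed_Int_compact[of K "{u..v}"] by (auto intro: lmeasurable_compact)
  have m_incr: "m v \<le> m u + measure lebesgue (K \<inter> {u..v})" if "a \<le> u" "u \<le> v" for u v
  proof -
    have "m v \<le> measure lebesgue (K \<inter> {a..u} \<union> K \<inter> {u..v})"
      unfolding m_def by (rule measure_mono_fmeasurable) (use lm in auto)
    also have "\<dots> \<le> m u + measure lebesgue (K \<inter> {u..v})"
      unfolding m_def by (rule measure_Un_le) (use lm in auto)
    finally show ?thesis .
  qed
  have piece: "measure lebesgue (K \<inter> {u..v}) \<le> v - u" if "u \<le> v" for u v
  proof -
    have "measure lebesgue (K \<inter> {u..v}) \<le> measure lebesgue {u..v}"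
      by (rule measure_mono_fmeasurable) (use lm in auto)
    then show ?thesis using that by simp
  qed
  have m_mono: "m u \<le> m v" if "u \<le> v" for u v
    unfolding m_def by (rule measure_mono_fmeasurable) (use lm that in auto)
  \<comment> \<open>Only continuity of \<open>m\<close> is wanted: it makes the set \<open>T\<close>
    closed, so that its supremum belongs to it.\<close>
  have "1-lipschitz_on {a..b} m"
  proof (rule lipschitz_on_leI)
    fix u v assume "u \<in> {a..b}" "v \<in> {a..b}" "u \<le> v"
    then show "dist (m u) (m v) \<le> 1 * dist u v"
      using m_incr[of u v] piece[of u v] m_mono[of u v] by (auto simp: dist_real_def)
  qed simp
  then have m_cont: "continuous_on {a..b} m" by (rule lipschitz_on_continuous_on)
  define T where "T = {t\<in>{a..b}. q * m t \<le> f t - f a}"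
  have "T = {a..b} \<inter> (\<lambda>t. f t - f a - q * m t) -` {0..}" by (auto simp: T_def)
  moreover have "continuous_on {a..b} (\<lambda>t. f t - f a - q * m t)"
    by (intro continuous_intros m_cont continuous_on_subset[OF cont]) auto
  ultimately have "closed T" by (simp add: continuous_closed_preimage)
  moreover have "bounded T"
    unfolding T_def by (rule bounded_subset[of "{a..b}"]) auto
  ultimately have "compact T" by (simp add: compact_eq_bounded_closed)
  moreover have "m a = 0"
    using piece[of a a] by (simp add: m_def measure_nonneg antisym)
  then have "a \<in> T" using \<open>a \<le> b\<close> by (simp add: T_def)
  ultimately obtain s where "s \<in> T" and s: "\<And>t. t \<in> T \<Longrightarrow> t \<le> s"
    using compact_attains_sup[of T] by auto
  have "s = b"
  proof (rule ccontr)
    assume "s \<noteq> b"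
    with \<open>s \<in> T\<close> have "a \<le> s" "s < b" "q * m s \<le> f s - f a" by (auto simp: T_def)
    \<comment> \<open>At a point of \<open>K\<close> a steep increment pays for the measure of
      \<open>K\<close> over [s, s + h], which is at most h; off \<open>K\<close> a short interval
      misses \<open>K\<close> and monotonicity of \<open>f\<close> suffices.\<close>
    have "\<exists>h>0. h < b - s \<and> q * measure lebesgue (K \<inter> {s..s+h}) \<le> f (s + h) - f s"
    proof (cases "s \<in> K")
      case True
      with steep[OF this, of "b - s"] \<open>s < b\<close>
      obtain h where h: "h > 0" "h < b - s" "q * h \<le> f (s + h) - f s" by auto
      moreover have "q * measure lebesgue (K \<inter> {s..s+h}) \<le> q * h"
        using piece[of s "s + h"] h \<open>q \<ge> 0\<close> by (intro mult_left_mono) auto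
      ultimately show ?thesis by force
    next
      case False
      then obtain e where e: "e > 0" "ball s e \<subseteq> - K"
        using \<open>closed K\<close> open_contains_ball[of "-K"] by auto
      define h where "h = min (e / 2) ((b - s) / 2)"
      have h: "h > 0" "h < b - s" "h < e"
        using e \<open>s < b\<close> by (auto simp: h_def min_less_iff_disj)
      have "{s..s+h} \<subseteq> ball s e" using h by (auto simp: dist_real_def)
      then have "K \<inter> {s..s+h} = {}" using e by auto
      moreover have "f s \<le> f (s + h)" using monoD[OF \<open>mono f\<close>, of s "s + h"] h by simp
      ultimately show ?thesis using h by auto
    qed
    then obtain h where h: "h > 0" "h < b - s"
      "q * measure lebesgue (K \<inter> {s..s+h}) \<le> f (s + h) - f s" by blast
    have "q * m (s + h) \<le> q * (m s + measure lebesgue (K \<inter> {s..s+h}))"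
      using m_incr[of s "s + h"] h \<open>a \<le> s\<close> \<open>q \<ge> 0\<close> by (intro mult_left_mono) auto
    then have "s + h \<in> T"
      using h \<open>a \<le> s\<close> \<open>q * m s \<le> f s - f a\<close> by (auto simp: T_def algebra_simps)
    with s[of "s + h"] h show False by simp
  qed
  with \<open>s \<in> T\<close> show ?thesis by (simp add: T_def m_def)
qed

text \<open>The sign c = 1 or c = -1 selects the right or the left upper Dini derivative; flat slopes of f
  are steep slopes of M * t - f t.\<close>

definition steep_at :: "real \<Rightarrow> real \<Rightarrow> (real \<Rightarrow> real) \<Rightarrow> real \<Rightarrow> bool" where
  "steep_at c q f t \<longleftrightarrow> (\<forall>e>0. \<exists>h>0. h < e \<and> q * h < c * (f (t + c * h) - f t))"

text \<open>Passing to - f (- t) preserves monotonicity and turns left slopes into right slopes, and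
  Lebesgue measure is invariant under reflection, so c = -1 reduces to c = 1.\<close>

lemma increment_ge_measure_steep_at:
  fixes f :: "real \<Rightarrow> real"
  assumes "mono f" and cont: "continuous_on UNIV f" and "closed K" and "q \<ge> 0" and "a \<le> b"
    and c: "c = 1 \<or> c = -1" and steep: "\<And>t. t \<in> K \<Longrightarrow> steep_at c q f t"
  shows "q * measure lebesgue (K \<inter> {a..b}) \<le> f b - f a"
  using c
proof
  assume "c = 1"
  then show ?thesis
    using steep unfolding steep_at_def
    by (intro increment_ge_measure_steep assms) (simp, meson less_imp_le)
next
  assume c: "c = -1"
  have "q * measure lebesgue (uminus ` K \<inter> {-b..-a}) \<le> (\<lambda>x. - f (- x)) (-a) - (\<lambda>x. - f (- x)) (-b)"
  proof (rule increment_ge_measure_steep)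
    show "mono (\<lambda>x. - f (- x))" using \<open>mono f\<close> by (auto simp: mono_def)
    show "continuous_on UNIV (\<lambda>x. - f (- x))"
      by (intro continuous_intros continuous_on_compose2[OF cont]) auto
    show "closed (uminus ` K)" using \<open>closed K\<close> by (rule closed_negations)
    fix t e :: real assume "t \<in> uminus ` K" "e > 0"
    then have "-t \<in> K" by auto
    from steep[OF this] \<open>e > 0\<close> obtain h where "h > 0" "h < e" "q * h < c * (f (-t + c * h) - f (-t))"
      unfolding steep_at_def by blast
    with c show "\<exists>h>0. h < e \<and> q * h \<le> - f (- (t + h)) - - f (- t)"
      by (intro exI[of _ h]) simp
  qed (use assms in auto)
  moreover have "uminus ` K \<inter> {-b..-a} = (\<lambda>x. (-1) *\<^sub>R x + 0) ` (K \<inter> {a..b})"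
    by (auto simp: image_iff)
  then have "measure lebesgue (uminus ` K \<inter> {-b..-a}) = measure lebesgue (K \<inter> {a..b})"
    using measure_lebesgue_affine[of "-1" 0 "K \<inter> {a..b}"] by simp
  ultimately show ?thesis by simp
qed

text \<open>An elementary stand-in for the Lebesgue density theorem: cover \<open>K\<close> by
  non-overlapping intervals of total length at most |K| + e; summing the hypothesis over them gives
  |K| <= \<theta> (|K| + e) for all e > 0, and \<theta> < 1 forces |K| = 0.\<close>

lemma negligible_if_interval_fraction_bounded:
  fixes K :: "real set"
  assumes "compact K" and "\<theta> < 1"
    and le: "\<And>a b. a \<le> b \<Longrightarrow> measure lebesgue (K \<inter> {a..b}) \<le> \<theta> * (b - a)"
  shows "negligible K"
proof -
  have K: "K \<in> lmeasurable" using \<open>compact K\<close> by (rule lmeasurable_compact)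
  have "\<theta> \<ge> 0" using order_trans[OF measure_nonneg le[of 0 1]] by simp
  obtain a b :: real where ab: "K \<subseteq> cbox a b"
    using compact_imp_bounded[OF \<open>compact K\<close>] bounded_subset_cbox_symmetric by blast
  have "measure lebesgue K \<le> \<theta> * (measure lebesgue K + e)" if "e > 0" for e
  proof -
    obtain \<D> where D: "countable \<D>"
        "\<And>I. I \<in> \<D> \<Longrightarrow> I \<subseteq> cbox a b \<and> I \<noteq> {} \<and> (\<exists>c d. I = cbox c d)"
        "pairwise (\<lambda>A B. interior A \<inter> interior B = {}) \<D>"
        "K \<subseteq> \<Union>\<D>" "\<Union>\<D> \<in> lmeasurable" "measure lebesgue (\<Union>\<D>) \<le> measure lebesgue K + e"
      using measurable_outer_intervals_bounded[OF K ab \<open>e > 0\<close>] by metis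
    have Dm: "I \<in> lmeasurable" if "I \<in> \<D>" for I using D(2)[OF that] by auto
    have fin: "sum (measure lebesgue) F \<le> measure lebesgue (\<Union>\<D>)" if "F \<subseteq> \<D>" "finite F" for F
    proof -
      have "sum (measure lebesgue) F = measure lebesgue (\<Union>F)"
      proof (rule measure_negligible_finite_Union[symmetric])
        show "pairwise (\<lambda>A B. negligible (A \<inter> B)) F"
        proof (rule pairwiseI)
          fix A B assume "A \<in> F" "B \<in> F" "A \<noteq> B"
          then have "A \<in> \<D>" "B \<in> \<D>" using \<open>F \<subseteq> \<D>\<close> by auto
          then obtain u v w z where AB: "A = cbox u v" "B = cbox w z" using D(2)[of A] D(2)[of B] by blast
          have "interior A \<inter> interior B = {}"
            using D(3) \<open>A \<in> \<D>\<close> \<open>B \<in> \<D>\<close> \<open>A \<noteq> B\<close> by (auto simp: pairwise_def)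
          then have "box u v \<inter> box w z = {}" by (simp add: AB)
          then show "negligible (A \<inter> B)"
            unfolding AB Int_interval box_Int_box negligible_interval(1) .
        qed
      qed (use that Dm in auto)
      also have "\<dots> \<le> measure lebesgue (\<Union>\<D>)"
        by (rule measure_mono_fmeasurable) (use that D Dm in \<open>auto intro!: fmeasurableD fmeasurable.finite_Union\<close>)
      finally show ?thesis .
    qed
    \<comment> \<open>The cover is countable; the estimate is made for finite subfamilies and passes
      to the whole union by approximation from below.\<close>
    have fincase: "measure lebesgue (\<Union>\<F>) \<le> \<theta> * (measure lebesgue K + e)"
      if sub: "\<F> \<subseteq> (\<inter>) K ` \<D>" and "finite \<F>" for \<F>
    proof -
      obtain F where F: "F \<subseteq> \<D>" "finite F" "\<F> = (\<inter>) K ` F"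
        using finite_subset_image[OF \<open>finite \<F>\<close> sub] by blast
      have "measure lebesgue (\<Union>\<F>) \<le> (\<Sum>I\<in>F. measure lebesgue (K \<inter> I))"
        unfolding F(3) by (rule measure_UNION_le) (use F Dm K in \<open>auto intro!: fmeasurableD fmeasurable.Int\<close>)
      also have "\<dots> \<le> (\<Sum>I\<in>F. \<theta> * measure lebesgue I)"
      proof (rule sum_mono)
        fix I assume "I \<in> F"
        then have "I \<noteq> {}" "\<exists>c d. I = cbox c d" using F D(2) by auto
        then obtain c d where "I = {c..d}" "c \<le> d" by auto
        then show "measure lebesgue (K \<inter> I) \<le> \<theta> * measure lebesgue I" using le by simp
      qed
      also have "\<dots> \<le> \<theta> * measure lebesgue (\<Union>\<D>)"
        unfolding sum_distrib_left[symmetric]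
        using fin[OF F(1,2)] \<open>\<theta> \<ge> 0\<close> by (rule mult_left_mono)
      also have "\<dots> \<le> \<theta> * (measure lebesgue K + e)"
        using D(6) \<open>\<theta> \<ge> 0\<close> by (rule mult_left_mono)
      finally show ?thesis .
    qed
    have "measure lebesgue (\<Union>((\<inter>) K ` \<D>)) \<le> \<theta> * (measure lebesgue K + e)"
    proof (rule field_le_epsilon)
      fix \<eta> :: real assume "\<eta> > 0"
      have "countable ((\<inter>) K ` \<D>)" using D(1) by simp
      moreover have "X \<in> lmeasurable" if "X \<in> (\<inter>) K ` \<D>" for X
        using that Dm K by (auto intro: fmeasurable.Int)
      ultimately obtain \<F> where "\<F> \<subseteq> (\<inter>) K ` \<D>" "finite \<F>"
        "measure lebesgue (\<Union>((\<inter>) K ` \<D>)) - \<eta> < measure lebesgue (\<Union>\<F>)"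
        by (rule measure_countable_Union_approachable[OF _ \<open>\<eta> > 0\<close> _ fincase])
      then show "measure lebesgue (\<Union>((\<inter>) K ` \<D>)) \<le> \<theta> * (measure lebesgue K + e) + \<eta>"
        using fincase[of \<F>] by linarith
    qed
    moreover have "\<Union>((\<inter>) K ` \<D>) = K" using D(4) by auto
    ultimately show ?thesis by simp
  qed
  note approx = this
  have le': "(1 - \<theta>) * measure lebesgue K \<le> \<theta> * e" if "e > 0" for e
    using approx[OF that] by (simp add: algebra_simps)
  have "(1 - \<theta>) * measure lebesgue K \<le> 0"
  proof (rule field_le_epsilon)
    fix e :: real assume "e > 0"
    then have "\<theta> * e \<le> 1 * e" using \<open>\<theta> < 1\<close> by (intro mult_right_mono) auto
    with le'[OF \<open>e > 0\<close>] show "(1 - \<theta>) * measure lebesgue K \<le> 0 + e" by simp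
  qed
  then have "measure lebesgue K = 0"
    using \<open>\<theta> < 1\<close> measure_nonneg[of lebesgue K] by (simp add: mult_le_0_iff)
  then show ?thesis using K by (simp add: negligible_iff_measure)
qed

text \<open>For each fixed increment \<open>h\<close> the condition on \<open>t\<close> is open, so
  the uncountable union over \<open>h\<close> is open too; only the quantifier over \<open>e\<close>
  must be made countable, by e = 1 / (n + 1).\<close>

lemma steep_at_measurable:
  fixes f :: "real \<Rightarrow> real"
  assumes cont: "continuous_on UNIV f"
  shows "{t. steep_at c q f t} \<in> sets lebesgue"
proof -
  have op: "open {t. q * h < c * (f (t + c * h) - f t)}" for h
    by (intro open_Collect_less continuous_intros continuous_on_compose2[OF cont]) auto
  have "{t. steep_at c q f t} =
      (\<Inter>n::nat. \<Union>h\<in>{0<..<1 / Suc n}. {t. q * h < c * (f (t + c * h) - f t)})" (is "_ = ?R")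
  proof (intro set_eqI iffI)
    fix t assume "t \<in> {t. steep_at c q f t}"
    then have "\<exists>h>0. h < 1 / Suc n \<and> q * h < c * (f (t + c * h) - f t)" for n :: nat
      by (simp add: steep_at_def)
    then show "t \<in> ?R" by (simp add: Bex_def conj_assoc)
  next
    fix t assume R: "t \<in> ?R"
    show "t \<in> {t. steep_at c q f t}"
      unfolding steep_at_def mem_Collect_eq
    proof (intro allI impI)
      fix e :: real assume "e > 0"
      then obtain n :: nat where "1 / Suc n < e" using nat_approx_posE by blast
      moreover have "\<exists>h\<in>{0<..<1 / Suc n}. q * h < c * (f (t + c * h) - f t)" using R by auto
      ultimately show "\<exists>h>0. h < e \<and> q * h < c * (f (t + c * h) - f t)" by force
    qed
  qed
  moreover have "?R \<in> sets borel"
    using op by (intro sets.countable_INT'') (auto intro!: borel_open open_UN)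
  ultimately show ?thesis by (simp add: sets_completionI_sets)
qed

text \<open>A slope of M * t - f t above M - p is a slope of \<open>f\<close> below p. On any
  interval the two increment bounds add up: q + (M - p) times the measure of such points is at most
  M (b - a). Since q > p, they fill a fraction below 1 of every interval.\<close>

lemma negligible_steep_and_flat:
  fixes f :: "real \<Rightarrow> real"
  assumes "mono f" and "mono (\<lambda>t. M * t - f t)" and cont: "continuous_on UNIV f"
    and "0 \<le> p" "p < q" "q \<le> M" and c: "c = 1 \<or> c = -1" "c' = 1 \<or> c' = -1"
  shows "negligible {t. steep_at c q f t \<and> steep_at c' (M - p) (\<lambda>t. M * t - f t) t}" (is "negligible ?E")
proof -
  have cont': "continuous_on UNIV (\<lambda>t. M * t - f t)" by (intro continuous_intros cont)
  have "?E = {t. steep_at c q f t} \<inter> {t. steep_at c' (M - p) (\<lambda>t. M * t - f t) t}" by auto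
  then have "?E \<in> sets lebesgue"
    by (auto intro!: sets.Int steep_at_measurable cont cont')
  \<comment> \<open>The increment bounds need closed sets, so the measurable set is exhausted from
    inside by compact ones, up to a null set.\<close>
  then obtain N C where NC: "negligible N" "\<And>n::nat. compact (C n)" "?E = (\<Union>n. C n) \<union> N"
    using lebesgue_regular_inner by metis
  have "negligible (C n)" for n
  proof (rule negligible_if_interval_fraction_bounded)
    show "compact (C n)" by fact
    show "M / (M + q - p) < 1" using assms by simp
    fix a b :: real assume "a \<le> b"
    have C: "C n \<subseteq> ?E" using NC(3) by blast
    have cl: "closed (C n)" using NC(2) by (rule compact_imp_closed)
    let ?m = "measure lebesgue (C n \<inter> {a..b})"
    have "q * ?m \<le> f b - f a"
      by (rule increment_ge_measure_steep_at[OF \<open>mono f\<close> cont cl _ \<open>a \<le> b\<close> c(1)]) (use assms C in auto)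
    moreover have "(M - p) * ?m \<le> (M * b - f b) - (M * a - f a)"
      by (rule increment_ge_measure_steep_at[OF \<open>mono (\<lambda>t. M * t - f t)\<close> cont' cl _ \<open>a \<le> b\<close> c(2)])
        (use assms C in auto)
    ultimately have "(M + q - p) * ?m \<le> M * (b - a)" by (simp add: algebra_simps)
    then show "?m \<le> M / (M + q - p) * (b - a)" using assms by (simp add: field_simps)
  qed
  then have "negligible (\<Union>n. C n)" by (intro negligible_countable_Union) auto
  then show ?thesis using NC(1,3) by simp
qed

lemma frequently_slope_steep_at:
  fixes f :: "real \<Rightarrow> real"
  assumes "\<exists>\<^sub>F h in at 0. q < (f (t + h) - f t) / h"
  shows "steep_at 1 q f t \<or> steep_at (-1) q f t"
proof (rule ccontr)
  assume "\<not> ?thesis"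
  then obtain e1 e2 where e: "e1 > 0" "e2 > 0"
     and 1: "\<And>h. 0 < h \<Longrightarrow> h < e1 \<Longrightarrow> \<not> q * h < f (t + h) - f t"
     and 2: "\<And>h. 0 < h \<Longrightarrow> h < e2 \<Longrightarrow> \<not> q * h < - (f (t - h) - f t)"
    unfolding steep_at_def by auto
  have "eventually (\<lambda>h. \<not> q < (f (t + h) - f t) / h) (at 0)"
    unfolding eventually_at
  proof (intro exI[of _ "min e1 e2"] conjI ballI impI)
    fix h :: real assume h: "h \<noteq> 0 \<and> dist h 0 < min e1 e2"
    then consider "h > 0" "h < e1" | "-h > 0" "-h < e2" by (cases "h > 0") auto
    then show "\<not> q < (f (t + h) - f t) / h"
      by cases (use 1[of h] 2[of "-h"] in \<open>auto simp: field_simps\<close>)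
  qed (use e in auto)
  with assms show False by (simp add: frequently_def)
qed

text \<open>The limit is the upper limit \<open>L\<close>, the infimum of the eventual upper bounds.
  If the values did not eventually exceed some c < L, rationals p < q between c and L would be
  frequently undercut and frequently exceeded. Rationals keep the exceptional sets countable in
  number.\<close>

lemma bounded_convergent_at_if_no_gap:
  fixes s :: "'a \<Rightarrow> real"
  assumes nb: "F \<noteq> bot" and bd: "\<forall>\<^sub>F h in F. 0 \<le> s h \<and> s h \<le> M"
    and gap: "\<And>p q. p \<in> \<rat> \<Longrightarrow> q \<in> \<rat> \<Longrightarrow> 0 \<le> p \<Longrightarrow> p < q \<Longrightarrow> q \<le> M \<Longrightarrow>
       \<exists>\<^sub>F h in F. q < s h \<Longrightarrow> \<exists>\<^sub>F h in F. s h < p \<Longrightarrow> False"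
  shows "\<exists>l. (s \<longlongrightarrow> l) F"
proof -
  define A where "A = {c. \<forall>\<^sub>F h in F. s h \<le> c}"
  have "M \<in> A" using bd by (auto simp: A_def elim: eventually_mono)
  have nonneg: "0 \<le> c" if "c \<in> A" for c
  proof -
    have "\<forall>\<^sub>F h in F. 0 \<le> s h \<and> s h \<le> c" using bd that unfolding A_def mem_Collect_eq by eventually_elim simp
    from eventually_happens'[OF nb this] show ?thesis by fastforce
  qed
  then have bb: "bdd_below A" by (auto simp: bdd_below_def)
  define L where "L = Inf A"
  have "(s \<longlongrightarrow> L) F"
  proof (rule order_tendstoI)
    fix c assume "L < c"
    then obtain c' where "c' \<in> A" "c' < c"
      using cInf_lessD[of A c] \<open>M \<in> A\<close> by (auto simp: L_def)
    then show "\<forall>\<^sub>F h in F. s h < c" by (auto simp: A_def elim!: eventually_mono)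
  next
    fix c assume "c < L"
    show "\<forall>\<^sub>F h in F. c < s h"
    \<comment> \<open>The gap hypothesis covers only p >= 0; below 0 the bound on the values does
      the work.\<close>
    proof (cases "c < 0")
      case True
      with bd show ?thesis by (auto elim!: eventually_mono)
    next
      case False
      obtain p where p: "p \<in> \<rat>" "c < p" "p < L" using Rats_dense_in_real[OF \<open>c < L\<close>] by blast
      obtain q where q: "q \<in> \<rat>" "p < q" "q < L" using Rats_dense_in_real[OF \<open>p < L\<close>] by blast
      have "L \<le> M" unfolding L_def by (rule cInf_lower[OF \<open>M \<in> A\<close> bb])
      have "q \<notin> A" using cInf_lower[OF _ bb, of q] q by (auto simp: L_def)
      then have "\<exists>\<^sub>F h in F. q < s h" by (auto simp: A_def frequently_def not_less)
      then have "\<not> (\<exists>\<^sub>F h in F. s h < p)"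
        using gap[OF p(1) q(1)] p q False \<open>L \<le> M\<close> by auto
      then show ?thesis using p by (auto simp: frequently_def not_less elim!: eventually_mono)
    qed
  qed
  then show ?thesis by blast
qed

text \<open>The two monotonicity hypotheses put all difference quotients into [0, M]. If those at a
  point fail to converge, some rationals p < q witness both a steep and a flat slope there, so the
  point lies in one of countably many null sets.\<close>

lemma mono_lipschitz_ae_differentiable:
  fixes f :: "real \<Rightarrow> real"
  assumes "mono f" and "mono (\<lambda>t. M * t - f t)" and cont: "continuous_on UNIV f"
  shows "negligible {t. \<not> (\<exists>D. (f has_real_derivative D) (at t))}"
proof -
  let ?S = "\<lambda>c c' p q. {t. steep_at c q f t \<and> steep_at c' (M - p) (\<lambda>t. M * t - f t) t}"
  \<comment> \<open>The steep and the flat slopes may occur on different sides of the point, hence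
    four sign patterns.\<close>
  define N where "N = (\<Union>(p, q)\<in>{(p, q). p \<in> \<rat> \<and> q \<in> \<rat> \<and> 0 \<le> p \<and> p < q \<and> q \<le> M}.
     ?S 1 1 p q \<union> ?S 1 (-1) p q \<union> ?S (-1) 1 p q \<union> ?S (-1) (-1) p q)"
  have "countable (\<rat> \<times> \<rat> :: (real \<times> real) set)" by (intro countable_SIGMA countable_rat)
  then have "countable {(p::real, q). p \<in> \<rat> \<and> q \<in> \<rat> \<and> 0 \<le> p \<and> p < q \<and> q \<le> M}"
    by (rule countable_subset[rotated]) auto
  then have "negligible N"
    unfolding N_def
    by (intro negligible_countable_Union countable_image) (auto intro!: negligible_Un negligible_steep_and_flat assms)
  moreover have "\<exists>D. (f has_real_derivative D) (at t)" if "t \<notin> N" for t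
  proof -
    let ?s = "\<lambda>h. (f (t + h) - f t) / h"
    have "\<exists>l. (?s \<longlongrightarrow> l) (at 0)"
    proof (rule bounded_convergent_at_if_no_gap)
      have "0 \<le> ?s h \<and> ?s h \<le> M" if "h \<noteq> 0" for h
        using monoD[OF assms(1), of t "t + h"] monoD[OF assms(1), of "t + h" t]
          monoD[OF assms(2), of t "t + h"] monoD[OF assms(2), of "t + h" t] that
        by (cases "h > 0") (auto simp: field_simps)
      then show "\<forall>\<^sub>F h in at 0. 0 \<le> ?s h \<and> ?s h \<le> M" by (auto simp: eventually_at_filter)
      fix p q :: real
      assume pq: "p \<in> \<rat>" "q \<in> \<rat>" "0 \<le> p" "p < q" "q \<le> M"
        and fq: "\<exists>\<^sub>F h in at 0. q < ?s h" and fp: "\<exists>\<^sub>F h in at 0. ?s h < p"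
      let ?g = "\<lambda>t. M * t - f t"
      have "\<forall>\<^sub>F h in at 0. ?s h < p \<longrightarrow> M - p < (?g (t + h) - ?g t) / h"
      proof -
        have "(?g (t + h) - ?g t) / h = M - ?s h" if "h \<noteq> 0" for h
          using that by (simp add: field_simps)
        then have "?s h < p \<longrightarrow> M - p < (?g (t + h) - ?g t) / h" if "h \<noteq> 0" for h
          using that by simp
        then show ?thesis unfolding eventually_at_filter by (intro always_eventually) blast
      qed
      with fp have "\<exists>\<^sub>F h in at 0. M - p < (?g (t + h) - ?g t) / h" by (rule frequently_mp[rotated])
      then have "steep_at 1 (M - p) ?g t \<or> steep_at (-1) (M - p) ?g t"
        by (rule frequently_slope_steep_at)
      moreover have "steep_at 1 q f t \<or> steep_at (-1) q f t"
        using fq by (rule frequently_slope_steep_at)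
      ultimately have "t \<in> N" using pq unfolding N_def by blast
      with that show False by simp
    qed simp
    then show ?thesis by (simp add: has_field_derivative_def[symmetric] DERIV_def)
  qed
  then have "{t. \<not> (\<exists>D. (f has_real_derivative D) (at t))} \<subseteq> N" by blast
  ultimately show ?thesis by (rule negligible_subset)
qed

text \<open>Each coordinate becomes nondecreasing, with slopes in [0, 2 M], once M * t is added to
  it.\<close>

lemma lipschitz_ae_vector_differentiable:
  fixes f :: "real \<Rightarrow> 'a::euclidean_space"
  assumes L: "M-lipschitz_on UNIV f"
  shows "negligible {t. \<not> (\<exists>D. (f has_vector_derivative D) (at t))}"
proof -
  have neg: "negligible {t. \<not> (\<exists>D. ((\<lambda>t. f t \<bullet> i) has_real_derivative D) (at t))}" if "i \<in> Basis" for i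
  proof -
    define g where "g t = M * t + f t \<bullet> i" for t
    have lip: "\<bar>f u \<bullet> i - f v \<bullet> i\<bar> \<le> M * \<bar>u - v\<bar>" for u v
    proof -
      have "\<bar>(f u - f v) \<bullet> i\<bar> \<le> norm (f u - f v)" by (rule Basis_le_norm[OF that])
      also have "\<dots> \<le> M * \<bar>u - v\<bar>" using lipschitz_on_normD[OF L, of u v] by simp
      finally show ?thesis by (simp add: inner_diff_left)
    qed
    have "negligible {t. \<not> (\<exists>D. (g has_real_derivative D) (at t))}"
    proof (rule mono_lipschitz_ae_differentiable)
      show "mono g"
      proof
        fix u v :: real assume "u \<le> v"
        then show "g u \<le> g v" using lip[of u v] by (simp add: g_def algebra_simps abs_if split: if_splits)
      qed
      show "mono (\<lambda>t. (2 * M) * t - g t)"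
      proof
        fix u v :: real assume "u \<le> v"
        then show "(2 * M) * u - g u \<le> (2 * M) * v - g v"
          using lip[of u v] by (simp add: g_def algebra_simps abs_if split: if_splits)
      qed
      show "continuous_on UNIV g" unfolding g_def
        by (intro continuous_intros lipschitz_on_continuous_on[OF L])
    qed
    moreover have "\<exists>D. ((\<lambda>t. f t \<bullet> i) has_real_derivative D) (at t)"
      if "(g has_real_derivative D) (at t)" for t D
    proof -
      have "((\<lambda>t. g t - M * t) has_real_derivative D - M * 1) (at t)"
        by (rule derivative_eq_intros that refl | simp)+
      then show ?thesis by (auto simp: g_def)
    qed
    ultimately show ?thesis by - (erule negligible_subset, blast)
  qed
  have "negligible (\<Union>i\<in>Basis. {t. \<not> (\<exists>D. ((\<lambda>t. f t \<bullet> i) has_real_derivative D) (at t))})"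
    by (intro negligible_Union finite_imageI finite_Basis) (use neg in auto)
  moreover have "\<exists>D. (f has_vector_derivative D) (at t)"
    if "\<And>i. i \<in> Basis \<Longrightarrow> \<exists>D. ((\<lambda>t. f t \<bullet> i) has_real_derivative D) (at t)" for t
  proof -
    have "\<forall>i\<in>Basis. \<exists>D. ((\<lambda>t. f t \<bullet> i) has_real_derivative D) (at t)" using that by blast
    then obtain D where D: "\<forall>i\<in>Basis. ((\<lambda>t. f t \<bullet> i) has_real_derivative D i) (at t)"
      using bchoice[of Basis "\<lambda>i D. ((\<lambda>t. f t \<bullet> i) has_real_derivative D) (at t)"] by blast
    have "(f has_vector_derivative (\<Sum>i\<in>Basis. D i *\<^sub>R i)) (at t)"
      unfolding has_vector_derivative_def
      by (subst has_derivative_componentwise_within)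
        (use D in \<open>auto simp: has_field_derivative_def mult_commute_abs\<close>)
    then show ?thesis by blast
  qed
  ultimately show ?thesis by - (erule negligible_subset, blast)
qed

section \<open>Mean value inequality for absolutely continuous functions\<close>

text \<open>Gauges deliver tagged divisions, whereas the definition of absolute continuity lists
  intervals by their end points; this bridges the two.\<close>

lemma absolutely_continuous_on_sum_bound:
  fixes g :: "real \<Rightarrow> 'a::real_normed_vector"
  assumes ac: "absolutely_continuous_on S g" and "e > 0"
  shows "\<exists>d>0. \<forall>P. P tagged_partial_division_of S \<and> (\<Sum>(x, k)\<in>P. Sup k - Inf k) < d
    \<longrightarrow> (\<Sum>(x, k)\<in>P. norm (g (Sup k) - g (Inf k))) < e"
proof -
  obtain d where "d > 0" and d: "\<And>(n::nat) u v. (\<forall>i<n. u i \<le> v i \<and> {u i..v i} \<subseteq> S) \<Longrightarrow>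
        disjoint_family_on (\<lambda>i. {u i<..<v i}) {..<n} \<Longrightarrow> (\<Sum>i<n. v i - u i) < d \<Longrightarrow>
        (\<Sum>i<n. norm (g (v i) - g (u i))) < e"
    using ac \<open>e > 0\<close> unfolding absolutely_continuous_on_def by meson
  show ?thesis
  proof (intro exI[of _ d] conjI allI impI \<open>d > 0\<close>)
    fix P :: "(real \<times> real set) set"
    assume "P tagged_partial_division_of S \<and> (\<Sum>(x, k)\<in>P. Sup k - Inf k) < d"
    then have tp: "P tagged_partial_division_of S" and small: "(\<Sum>(x, k)\<in>P. Sup k - Inf k) < d" by auto
    note P = tagged_partial_division_ofD[OF tp]
    have int: "k = {Inf k..Sup k} \<and> Inf k \<le> Sup k \<and> k \<subseteq> S" if xk: "(x, k) \<in> P" for x k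
    proof -
      obtain u v where "k = cbox u v" using P(4)[OF xk] by blast
      with P(2,3)[OF xk] show ?thesis by auto
    qed
    obtain h where h: "bij_betw h {..<card P} P"
      using ex_bij_betw_nat_finite[OF P(1)] by (auto simp: atLeast0LessThan)
    define u where "u i = Inf (snd (h i))" for i
    define v where "v i = Sup (snd (h i))" for i
    have hP: "h i \<in> P" if "i < card P" for i using bij_betwE[OF h] that by auto
    have uv: "snd (h i) = {u i..v i} \<and> u i \<le> v i \<and> {u i..v i} \<subseteq> S" if "i < card P" for i
      using int[of "fst (h i)" "snd (h i)"] hP[OF that] by (auto simp: u_def v_def)
    have "(\<Sum>i<card P. norm (g (v i) - g (u i))) < e"
    proof (rule d)
      show "\<forall>i<card P. u i \<le> v i \<and> {u i..v i} \<subseteq> S" using uv by blast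
      show "disjoint_family_on (\<lambda>i. {u i<..<v i}) {..<card P}"
        unfolding disjoint_family_on_def
      proof (intro ballI impI)
        fix i j assume ij: "i \<in> {..<card P}" "j \<in> {..<card P}" "i \<noteq> j"
        then have "h i \<noteq> h j" using bij_betw_imp_inj_on[OF h] by (auto dest: inj_onD)
        then have "interior (snd (h i)) \<inter> interior (snd (h j)) = {}"
          using P(5)[of "fst (h i)" "snd (h i)" "fst (h j)" "snd (h j)"] hP ij by simp
        then show "{u i<..<v i} \<inter> {u j<..<v j} = {}" using uv ij by simp
      qed
      have "(\<Sum>i<card P. v i - u i) = (\<Sum>(x, k)\<in>P. Sup k - Inf k)"
        unfolding u_def v_def by (subst sum.reindex_bij_betw[OF h, symmetric]) (simp add: case_prod_beta)
      with small show "(\<Sum>i<card P. v i - u i) < d" by simp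
    qed
    moreover have "(\<Sum>i<card P. norm (g (v i) - g (u i))) = (\<Sum>(x, k)\<in>P. norm (g (Sup k) - g (Inf k)))"
      unfolding u_def v_def by (subst sum.reindex_bij_betw[OF h, symmetric]) (simp add: case_prod_beta)
    ultimately show "(\<Sum>(x, k)\<in>P. norm (g (Sup k) - g (Inf k))) < e" by simp
  qed
qed

text \<open>The straddle estimate of gauge integration. The order u <= t <= v is essential: a
  derivative at t alone does not control increments between two points on the same side of
  t.\<close>

lemma has_real_derivative_straddle_ge:
  fixes g :: "real \<Rightarrow> real"
  assumes "(g has_real_derivative D) (at t within S)" and "\<eta> > 0"
  obtains r where "r > 0"
    "\<And>u v. u \<in> S \<Longrightarrow> v \<in> S \<Longrightarrow> t \<in> S \<Longrightarrow> u \<le> t \<Longrightarrow> t \<le> v \<Longrightarrow> \<bar>u - t\<bar> < r \<Longrightarrow> \<bar>v - t\<bar> < r \<Longrightarrow> (D - \<eta>) * (v - u) \<le> g v - g u"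
proof -
  obtain r where "r > 0" and r: "\<And>y. y \<in> S \<Longrightarrow> norm (y - t) < r \<Longrightarrow> norm (g y - g t - D * (y - t)) \<le> \<eta> * norm (y - t)"
    using assms unfolding has_field_derivative_def has_derivative_within_alt by blast
  show ?thesis
  proof (rule that[OF \<open>r > 0\<close>])
    fix u v assume "u \<in> S" "v \<in> S" "t \<in> S" "u \<le> t" "t \<le> v" "\<bar>u - t\<bar> < r" "\<bar>v - t\<bar> < r"
    then show "(D - \<eta>) * (v - u) \<le> g v - g u"
      using r[of u] r[of v] by (auto simp: abs_if algebra_simps split: if_splits)
  qed
qed

text \<open>A gauge argument in place of an integral. In a fine division, intervals tagged outside
  \<open>N\<close> satisfy the straddle estimate; those tagged in \<open>N\<close> lie in an open
  set of small measure around \<open>N\<close>, where absolute continuity makes the total increment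
  small.\<close>

lemma absolutely_continuous_increment_ge:
  fixes g :: "real \<Rightarrow> real"
  assumes "a \<le> b" and ac: "absolutely_continuous_on {a..b} g" and "negligible N"
    and deriv: "\<And>t. t \<in> {a..b} \<Longrightarrow> t \<notin> N \<Longrightarrow> \<exists>D\<ge>c. (g has_real_derivative D) (at t within {a..b})"
  shows "c * (b - a) \<le> g b - g a"
proof -
  \<comment> \<open>The term with |c - \<eta>| accounts for the length lost to the intervals tagged
    in \<open>N\<close>, the final \<eta> for the increments over them.\<close>
  have approx: "(c - \<eta>) * (b - a) - \<bar>c - \<eta>\<bar> * \<eta> - \<eta> \<le> g b - g a" if "\<eta> > 0" for \<eta>
  proof -
    obtain d where "d > 0" and d: "\<And>P. P tagged_partial_division_of {a..b} \<Longrightarrow>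
       (\<Sum>(x, k)\<in>P. Sup k - Inf k) < d \<Longrightarrow> (\<Sum>(x, k)\<in>P. norm (g (Sup k) - g (Inf k))) < \<eta>"
      using absolutely_continuous_on_sum_bound[OF ac \<open>\<eta> > 0\<close>] by blast
    \<comment> \<open>Measure below \<open>d\<close> lets absolute continuity act on the intervals
      tagged in \<open>N\<close>, and measure below \<eta> bounds the length they take from the
      rest.\<close>
    have "N \<in> sets lebesgue" "min d \<eta> > 0"
      using \<open>negligible N\<close> \<open>d > 0\<close> \<open>\<eta> > 0\<close> by (auto simp: negligible_imp_sets)
    then obtain U where U: "open U" "N \<subseteq> U" "U - N \<in> lmeasurable" "emeasure lebesgue (U - N) < ennreal (min d \<eta>)"
      using sets_lebesgue_outer_open by metis
    have "N \<in> lmeasurable" "measure lebesgue N = 0"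
      using \<open>negligible N\<close> by (auto simp: negligible_iff_measure)
    have "U = (U - N) \<union> N" using U(2) by auto
    then have U3: "U \<in> lmeasurable" using U(3) \<open>N \<in> lmeasurable\<close> by (metis fmeasurable.Un)
    have "measure lebesgue U \<le> measure lebesgue (U - N) + measure lebesgue N"
      by (subst \<open>U = (U - N) \<union> N\<close>, rule measure_Un_le)
        (use U(3) \<open>N \<in> lmeasurable\<close> in \<open>auto intro: fmeasurableD\<close>)
    moreover have "measure lebesgue (U - N) < min d \<eta>"
      using U(3,4) \<open>d > 0\<close> \<open>\<eta> > 0\<close> by (simp add: emeasure_eq_measure2 ennreal_less_iff)
    ultimately have U4: "measure lebesgue U < min d \<eta>" using \<open>measure lebesgue N = 0\<close> by simp
    have "\<exists>r>0. if t \<in> N then ball t r \<subseteq> U else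
       (\<forall>u v. a \<le> u \<and> u \<le> t \<and> t \<le> v \<and> v \<le> b \<and> u \<in> ball t r \<and> v \<in> ball t r \<longrightarrow> (c - \<eta>) * (v - u) \<le> g v - g u)" for t
    proof (cases "t \<in> N")
      case True
      then show ?thesis using U openE by (metis subsetD)
    next
      case False
      show ?thesis
      proof (cases "t \<in> {a..b}")
        case True
        with deriv False obtain D where D: "D \<ge> c" "(g has_real_derivative D) (at t within {a..b})" by blast
        obtain r where "r > 0" and r: "\<And>u v. u \<in> {a..b} \<Longrightarrow> v \<in> {a..b} \<Longrightarrow> t \<in> {a..b} \<Longrightarrow> u \<le> t \<Longrightarrow> t \<le> v \<Longrightarrow> \<bar>u - t\<bar> < r \<Longrightarrow> \<bar>v - t\<bar> < r \<Longrightarrow> (D - \<eta>) * (v - u) \<le> g v - g u"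
          using has_real_derivative_straddle_ge[OF D(2) \<open>\<eta> > 0\<close>] by blast
        have "(c - \<eta>) * (v - u) \<le> g v - g u"
          if "a \<le> u" "u \<le> t" "t \<le> v" "v \<le> b" "u \<in> ball t r" "v \<in> ball t r" for u v
        proof -
          have "(c - \<eta>) * (v - u) \<le> (D - \<eta>) * (v - u)" using D(1) that by (intro mult_right_mono) auto
          also have "\<dots> \<le> g v - g u" using that by (intro r) (auto simp: dist_real_def)
          finally show ?thesis .
        qed
        then show ?thesis using \<open>r > 0\<close> False by auto
      next
        case F: False
        then have "\<not> (a \<le> u \<and> u \<le> t \<and> t \<le> v \<and> v \<le> b)" for u v by auto
        then show ?thesis using False by (intro exI[of _ 1]) auto
      qed
    qed
    then obtain r where r0: "\<And>t. r t > 0" and r: "\<And>t. if t \<in> N then ball t (r t) \<subseteq> U else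
       (\<forall>u v. a \<le> u \<and> u \<le> t \<and> t \<le> v \<and> v \<le> b \<and> u \<in> ball t (r t) \<and> v \<in> ball t (r t) \<longrightarrow> (c - \<eta>) * (v - u) \<le> g v - g u)"
      by metis
    have "gauge (\<lambda>t. ball t (r t))" using r0 by (simp add: gauge_def)
    then obtain p where p: "p tagged_division_of {a..b}" and fine: "(\<lambda>t. ball t (r t)) fine p"
      by (rule fine_division_exists_real)
    have pfin: "finite p" using p by auto
    have pk: "x \<in> k \<and> k \<subseteq> {a..b} \<and> k \<subseteq> ball x (r x) \<and> (\<exists>u v. k = {u..v} \<and> u \<le> v)"
      if xk: "(x, k) \<in> p" for x k
    proof -
      have "x \<in> k" "k \<subseteq> {a..b}" using tagged_division_ofD(2,3)[OF p xk] .
      moreover obtain u v where "k = cbox u v" using tagged_division_ofD(4)[OF p xk] by blast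
      moreover have "k \<subseteq> ball x (r x)" using fineD[OF fine xk] .
      ultimately show ?thesis by auto
    qed
    define p1 where "p1 = {(x, k) \<in> p. x \<notin> N}"
    define p2 where "p2 = {(x, k) \<in> p. x \<in> N}"
    have p12: "p = p1 \<union> p2" "p1 \<inter> p2 = {}" "finite p1" "finite p2"
      using pfin by (auto simp: p1_def p2_def intro: finite_subset)
    have split: "(\<Sum>(x, k)\<in>p. F (Sup k) - F (Inf k)) = (\<Sum>(x, k)\<in>p1. F (Sup k) - F (Inf k)) + (\<Sum>(x, k)\<in>p2. F (Sup k) - F (Inf k))"
      for F :: "real \<Rightarrow> real"
      unfolding p12(1) by (rule sum.union_disjoint) (use p12 in auto)
    have total: "(\<Sum>(x, k)\<in>p. F (Sup k) - F (Inf k)) = F b - F a" for F :: "real \<Rightarrow> real"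
      by (rule additive_tagged_division_1[OF \<open>a \<le> b\<close> p])
    have p2: "p2 tagged_partial_division_of {a..b}"
      using p unfolding tagged_division_of_def
      by (rule conjunct1[THEN tagged_partial_division_subset]) (auto simp: p2_def)
    have p2lm: "k \<in> lmeasurable \<and> measure lebesgue k = Sup k - Inf k" if xk: "(x, k) \<in> p2" for x k
    proof -
      obtain u v where "k = {u..v}" "u \<le> v" using pk[of x k] xk unfolding p2_def by blast
      then show ?thesis by simp
    qed
    have "(\<Sum>(x, k)\<in>p2. Sup k - Inf k) = (\<Sum>i\<in>p2. measure lebesgue (snd i))"
      using p2lm by (intro sum.cong) auto
    also have "\<dots> = measure lebesgue (\<Union>(snd ` p2))"
    proof (rule measure_negligible_finite_Union_image[symmetric])
      show "finite p2" by fact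
      show "snd i \<in> lmeasurable" if "i \<in> p2" for i using p2lm[of "fst i" "snd i"] that by simp
      show "pairwise (\<lambda>i j. negligible (snd i \<inter> snd j)) p2"
      proof (rule pairwiseI)
        fix i j assume ij: "i \<in> p2" "j \<in> p2" "i \<noteq> j"
        obtain u v w z where uv: "snd i = cbox u v" "snd j = cbox w z"
          using tagged_partial_division_ofD(4)[OF p2, of "fst i" "snd i"]
            tagged_partial_division_ofD(4)[OF p2, of "fst j" "snd j"] ij by auto
        have "interior (snd i) \<inter> interior (snd j) = {}"
          using tagged_partial_division_ofD(5)[OF p2, of "fst i" "snd i" "fst j" "snd j"] ij by simp
        then have "box u v \<inter> box w z = {}" by (simp add: uv)
        then show "negligible (snd i \<inter> snd j)"
          unfolding uv Int_interval box_Int_box negligible_interval(1) .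
      qed
    qed
    also have "\<dots> \<le> measure lebesgue U"
    proof (rule measure_mono_fmeasurable)
      show "\<Union>(snd ` p2) \<subseteq> U"
      proof clarsimp
        fix y x k assume "(x, k) \<in> p2" "y \<in> k"
        then have "k \<subseteq> ball x (r x)" "x \<in> N" using pk by (auto simp: p2_def)
        then show "y \<in> U" using r[of x] \<open>y \<in> k\<close> by auto
      qed
      show "\<Union>(snd ` p2) \<in> sets lebesgue"
        by (intro sets.finite_Union finite_imageI p12) (use p2lm in \<open>auto intro: fmeasurableD\<close>)
    qed (rule U3)
    finally have len: "(\<Sum>(x, k)\<in>p2. Sup k - Inf k) < min d \<eta>" using U4 by linarith
    have "(\<Sum>(x, k)\<in>p2. norm (g (Sup k) - g (Inf k))) < \<eta>"
      by (rule d[OF p2]) (use len in simp)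
    moreover have "- (\<Sum>(x, k)\<in>p2. norm (g (Sup k) - g (Inf k))) \<le> (\<Sum>(x, k)\<in>p2. g (Sup k) - g (Inf k))"
      unfolding sum_negf[symmetric] by (intro sum_mono) auto
    moreover have "(c - \<eta>) * (\<Sum>(x, k)\<in>p1. Sup k - Inf k) \<le> (\<Sum>(x, k)\<in>p1. g (Sup k) - g (Inf k))"
      unfolding sum_distrib_left
    proof (intro sum_mono, clarify)
      fix x k assume "(x, k) \<in> p1"
      then have "x \<notin> N" "x \<in> k" "k \<subseteq> {a..b}" "k \<subseteq> ball x (r x)" "\<exists>u v. k = {u..v} \<and> u \<le> v"
        using pk[of x k] by (auto simp: p1_def)
      moreover from this obtain u v where "k = {u..v}" "u \<le> v" by blast
      moreover from this have "u \<in> k" "v \<in> k" by auto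
      then have "u \<in> ball x (r x)" "v \<in> ball x (r x)" using calculation(4) by blast+
      ultimately show "(c - \<eta>) * (Sup k - Inf k) \<le> g (Sup k) - g (Inf k)"
        using r[of x] by auto
    qed
    moreover have "(\<Sum>(x, k)\<in>p1. Sup k - Inf k) = (b - a) - (\<Sum>(x, k)\<in>p2. Sup k - Inf k)"
      using split[of "\<lambda>x. x"] total[of "\<lambda>x. x"] by simp
    moreover have "(c - \<eta>) * (\<Sum>(x, k)\<in>p2. Sup k - Inf k) \<le> \<bar>c - \<eta>\<bar> * \<eta>"
    proof -
      have "0 \<le> (\<Sum>(x, k)\<in>p2. Sup k - Inf k)"
      proof (intro sum_nonneg, clarify)
        fix x k assume "(x, k) \<in> p2"
        then have "measure lebesgue k = Sup k - Inf k" using p2lm by blast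
        then show "0 \<le> Sup k - Inf k" using measure_nonneg[of lebesgue k] by simp
      qed
      then have "(c - \<eta>) * (\<Sum>(x, k)\<in>p2. Sup k - Inf k) \<le> \<bar>c - \<eta>\<bar> * (\<Sum>(x, k)\<in>p2. Sup k - Inf k)"
        by (intro mult_right_mono) auto
      also have "\<dots> \<le> \<bar>c - \<eta>\<bar> * \<eta>" using len by (intro mult_left_mono) auto
      finally show ?thesis .
    qed
    ultimately show ?thesis
      using split[of g] total[of g] by (simp add: right_diff_distrib)
  qed
  have lim: "((\<lambda>\<eta>. (c - \<eta>) * (b - a) - \<bar>c - \<eta>\<bar> * \<eta> - \<eta>) \<longlongrightarrow> (c - 0) * (b - a) - \<bar>c - 0\<bar> * 0 - 0) (at_right 0)"
    by (intro tendsto_intros)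
  have "(c - 0) * (b - a) - \<bar>c - 0\<bar> * 0 - 0 \<le> g b - g a"
    by (rule tendsto_upperbound[OF lim]) (auto simp: eventually_at_right_less eventually_at_filter approx)
  then show ?thesis by simp
qed

section \<open>Compactness of flow arcs\<close>

lemma absolutely_continuous_on_subset:
  "absolutely_continuous_on S f \<Longrightarrow> T \<subseteq> S \<Longrightarrow> absolutely_continuous_on T f"
  unfolding absolutely_continuous_on_def by (meson subset_trans)

lemma absolutely_continuous_on_inner:
  fixes f :: "real \<Rightarrow> 'a::real_inner"
  assumes ac: "absolutely_continuous_on S f"
  shows "absolutely_continuous_on S (\<lambda>t. a \<bullet> f t)"
  unfolding absolutely_continuous_on_def
proof (intro allI impI)
  fix e :: real assume "e > 0"
  then have "e / (norm a + 1) > 0" by (simp add: add_nonneg_pos)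
  then obtain d where "d > 0" and d: "\<And>(n::nat) u v. (\<forall>i<n. u i \<le> v i \<and> {u i..v i} \<subseteq> S) \<and>
        disjoint_family_on (\<lambda>i. {u i<..<v i}) {..<n} \<and> (\<Sum>i<n. v i - u i) < d \<Longrightarrow>
        (\<Sum>i<n. norm (f (v i) - f (u i))) < e / (norm a + 1)"
    using ac unfolding absolutely_continuous_on_def by meson
  show "\<exists>d>0. \<forall>(n::nat) u v. (\<forall>i<n. u i \<le> v i \<and> {u i..v i} \<subseteq> S) \<and>
        disjoint_family_on (\<lambda>i. {u i<..<v i}) {..<n} \<and> (\<Sum>i<n. v i - u i) < d \<longrightarrow>
        (\<Sum>i<n. norm (a \<bullet> f (v i) - a \<bullet> f (u i))) < e"
  proof (intro exI[of _ d] conjI allI impI \<open>d > 0\<close>)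
    fix n :: nat and u v
    assume *: "(\<forall>i<n. u i \<le> v i \<and> {u i..v i} \<subseteq> S) \<and>
        disjoint_family_on (\<lambda>i. {u i<..<v i}) {..<n} \<and> (\<Sum>i<n. v i - u i) < d"
    have "(\<Sum>i<n. norm (a \<bullet> f (v i) - a \<bullet> f (u i))) \<le> (\<Sum>i<n. (norm a + 1) * norm (f (v i) - f (u i)))"
    proof (rule sum_mono)
      fix i
      have "norm (a \<bullet> f (v i) - a \<bullet> f (u i)) \<le> norm a * norm (f (v i) - f (u i))"
        by (simp add: inner_diff_right[symmetric] Cauchy_Schwarz_ineq2)
      also have "\<dots> \<le> (norm a + 1) * norm (f (v i) - f (u i))" by (intro mult_right_mono) auto
      finally show "norm (a \<bullet> f (v i) - a \<bullet> f (u i)) \<le> \<dots>" .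
    qed
    also have "\<dots> < (norm a + 1) * (e / (norm a + 1))"
      unfolding sum_distrib_left[symmetric]
      by (intro mult_strict_left_mono d *) (simp add: add_nonneg_pos)
    also have "\<dots> = e" by (simp add: add_nonneg_eq_0_iff)
    finally show "(\<Sum>i<n. norm (a \<bullet> f (v i) - a \<bullet> f (u i))) < e" .
  qed
qed

lemma lipschitz_imp_absolutely_continuous_on:
  assumes L: "M-lipschitz_on S f"
  shows "absolutely_continuous_on S f"
  unfolding absolutely_continuous_on_def
proof (intro allI impI)
  fix e :: real assume "e > 0"
  have "M \<ge> 0" using L by (rule lipschitz_on_nonneg)
  show "\<exists>d>0. \<forall>(n::nat) u v. (\<forall>i<n. u i \<le> v i \<and> {u i..v i} \<subseteq> S) \<and>
        disjoint_family_on (\<lambda>i. {u i<..<v i}) {..<n} \<and> (\<Sum>i<n. v i - u i) < d \<longrightarrow>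
        (\<Sum>i<n. norm (f (v i) - f (u i))) < e"
  proof (intro exI[of _ "e / (M + 1)"] conjI allI impI)
    show "0 < e / (M + 1)" using \<open>e > 0\<close> \<open>M \<ge> 0\<close> by simp
    fix n :: nat and u v
    assume *: "(\<forall>i<n. u i \<le> v i \<and> {u i..v i} \<subseteq> S) \<and>
        disjoint_family_on (\<lambda>i. {u i<..<v i}) {..<n} \<and> (\<Sum>i<n. v i - u i) < e / (M + 1)"
    have "(\<Sum>i<n. norm (f (v i) - f (u i))) \<le> (\<Sum>i<n. (M + 1) * (v i - u i))"
    proof (rule sum_mono)
      fix i assume "i \<in> {..<n}"
      then have i: "u i \<le> v i" "{u i..v i} \<subseteq> S" using * by auto
      then have "u i \<in> S" "v i \<in> S" by auto
      then have "norm (f (v i) - f (u i)) \<le> M * (v i - u i)"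
        using lipschitz_on_normD[OF L, of "v i" "u i"] i by simp
      also have "\<dots> \<le> (M + 1) * (v i - u i)" using i by (intro mult_right_mono) auto
      finally show "norm (f (v i) - f (u i)) \<le> (M + 1) * (v i - u i)" .
    qed
    also have "\<dots> < (M + 1) * (e / (M + 1))"
      unfolding sum_distrib_left[symmetric]
      using * \<open>M \<ge> 0\<close> by (intro mult_strict_left_mono) auto
    also have "\<dots> = e" using \<open>M \<ge> 0\<close> by simp
    finally show "(\<Sum>i<n. norm (f (v i) - f (u i))) < e" .
  qed
qed

text \<open>A flow piece with its clock restarted at 0. Only continuity is asked at the end time,
  since a solution may leave the flow set there; duration 0 is allowed, so that a step can be a bare
  jump.\<close>

definition flow_arc :: "'a::euclidean_space hybrid_system \<Rightarrow> real \<Rightarrow> (real \<Rightarrow> 'a) \<Rightarrow> bool" where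
  "flow_arc H \<tau> w \<longleftrightarrow> 0 \<le> \<tau> \<and> absolutely_continuous_on {0..\<tau>} w \<and>
     (\<forall>t\<in>{0..<\<tau>}. w t \<in> flow_set H) \<and>
     negligible {t\<in>{0<..<\<tau>}. \<not> (\<exists>v\<in>flow_map H (w t). (w has_vector_derivative v) (at t))}"

text \<open>Velocities in a half-space force increments into it. This scalar mean value inequality
  is all that the compactness argument uses of the differential inclusion: it yields both the
  Lipschitz bounds and the velocities of limits.\<close>

lemma flow_arc_increment_ge:
  assumes w: "flow_arc H \<tau> w" and uv: "0 \<le> u" "u \<le> v" "v \<le> \<tau>"
    and c: "\<And>t y. t \<in> {u<..<v} \<Longrightarrow> y \<in> flow_map H (w t) \<Longrightarrow> c \<le> a \<bullet> y"
  shows "c * (v - u) \<le> a \<bullet> (w v - w u)"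
proof -
  \<comment> \<open>The end points are added because velocities are controlled only on the open
    interval.\<close>
  define N where "N = {t\<in>{0<..<\<tau>}. \<not> (\<exists>v\<in>flow_map H (w t). (w has_vector_derivative v) (at t))} \<union> {u, v}"
  have "c * (v - u) \<le> (a \<bullet> w v) - (a \<bullet> w u)"
  proof (rule absolutely_continuous_increment_ge[where N = N])
    show "negligible N"
      using w unfolding N_def flow_arc_def by (intro negligible_Un) auto
    show "absolutely_continuous_on {u..v} (\<lambda>t. a \<bullet> w t)"
      using w uv unfolding flow_arc_def
      by (intro absolutely_continuous_on_inner) (auto elim!: absolutely_continuous_on_subset)
    fix t assume t: "t \<in> {u..v}" "t \<notin> N"
    then have t': "t \<in> {u<..<v}" "t \<in> {0<..<\<tau>}" using uv by (auto simp: N_def)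
    then obtain y where y: "y \<in> flow_map H (w t)" "(w has_vector_derivative y) (at t)"
      using t(2) by (auto simp: N_def)
    have "((\<lambda>t. a \<bullet> w t) has_vector_derivative a \<bullet> y) (at t)"
      using y(2) by (rule bounded_linear.has_vector_derivative[OF bounded_linear_inner_right])
    then have "((\<lambda>t. a \<bullet> w t) has_real_derivative a \<bullet> y) (at t within {u..v})"
      by (simp add: has_real_derivative_iff_has_vector_derivative has_vector_derivative_at_within)
    with c[OF t'(1) y(1)] show "\<exists>D\<ge>c. ((\<lambda>t. a \<bullet> w t) has_real_derivative D) (at t within {u..v})"
      by blast
  qed fact
  then show ?thesis by (simp add: inner_diff_right)
qed

text \<open>Test the increment d against its own direction: velocities satisfy d \<bullet> y <= |d|
  M, so |d|^2 <= |d| M (v - u).\<close>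

lemma flow_arc_lipschitz:
  assumes w: "flow_arc H \<tau> w" and "M \<ge> 0"
    and M: "\<And>t y. t \<in> {0<..<\<tau>} \<Longrightarrow> y \<in> flow_map H (w t) \<Longrightarrow> norm y \<le> M"
  shows "M-lipschitz_on {0..\<tau>} w"
proof (rule lipschitz_on_leI)
  fix u v assume uv: "u \<in> {0..\<tau>}" "v \<in> {0..\<tau>}" "u \<le> v"
  define d where "d = w v - w u"
  have "- (norm d * M) * (v - u) \<le> (- d) \<bullet> (w v - w u)"
  proof (rule flow_arc_increment_ge[OF w])
    fix t y assume "t \<in> {u<..<v}" "y \<in> flow_map H (w t)"
    then have "norm y \<le> M" using uv by (intro M) auto
    have "d \<bullet> y \<le> norm d * norm y" by (rule norm_cauchy_schwarz)
    also have "\<dots> \<le> norm d * M" using \<open>norm y \<le> M\<close> by (intro mult_left_mono) auto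
    finally show "- (norm d * M) \<le> - d \<bullet> y" by simp
  qed (use uv in auto)
  then have "norm d * norm d \<le> norm d * (M * (v - u))"
    by (simp add: d_def[symmetric] dot_square_norm power2_eq_square algebra_simps)
  then have "norm d \<le> M * (v - u)"
    using \<open>M \<ge> 0\<close> uv by (cases "norm d = 0") (auto simp: mult_le_cancel_left)
  then show "dist (w u) (w v) \<le> M * dist u v"
    using uv by (simp add: d_def dist_norm norm_minus_commute)
qed fact

section \<open>Outer semicontinuous and locally bounded set-valued maps\<close>

lemma locally_bounded_on_compact:
  assumes lb: "locally_bounded_on S F" and "compact K" "K \<subseteq> S"
  obtains M where "M \<ge> 0" "\<And>x y. x \<in> K \<Longrightarrow> y \<in> F x \<Longrightarrow> norm y \<le> M"
proof -
  have "\<forall>x\<in>K. \<exists>U. open U \<and> x \<in> U \<and> bounded (\<Union>y\<in>U. F y)"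
    using lb \<open>K \<subseteq> S\<close> by (auto simp: locally_bounded_on_def)
  then obtain U where U: "\<And>x. x \<in> K \<Longrightarrow> open (U x)" "\<And>x. x \<in> K \<Longrightarrow> x \<in> U x"
    "\<And>x. x \<in> K \<Longrightarrow> bounded (\<Union>y\<in>U x. F y)" by metis
  obtain D where D: "D \<subseteq> K" "finite D" "K \<subseteq> (\<Union>x\<in>D. U x)"
    by (rule compactE_image[OF \<open>compact K\<close>, of K U]) (use U in auto)
  have "bounded (\<Union>x\<in>D. \<Union>y\<in>U x. F y)" using D U by (intro bounded_UN) auto
  then obtain M where "M > 0" and M: "\<And>z. z \<in> (\<Union>x\<in>D. \<Union>y\<in>U x. F y) \<Longrightarrow> norm z \<le> M"
    by (auto simp: bounded_pos)
  show ?thesis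
  proof (rule that)
    show "M \<ge> 0" using \<open>M > 0\<close> by simp
    fix x y assume "x \<in> K" "y \<in> F x"
    then show "norm y \<le> M" using D(3) by (intro M) blast
  qed
qed

text \<open>Outer semicontinuity with local boundedness gives upper semicontinuity: values violating
  the strict inequality at points tending to \<open>x\<close> are bounded, and a limit point of them
  would lie in \<open>F x\<close> and violate it too.\<close>

lemma outer_semicontinuous_halfspace_nbhd:
  fixes F :: "'a::metric_space \<Rightarrow> 'b::euclidean_space set"
  assumes osc: "outer_semicontinuous F" and lb: "locally_bounded_on S F" and "x \<in> S"
    and a: "\<And>y. y \<in> F x \<Longrightarrow> b < a \<bullet> y"
  obtains \<rho> where "\<rho> > 0" "\<And>x' y. x' \<in> ball x \<rho> \<Longrightarrow> y \<in> F x' \<Longrightarrow> b < a \<bullet> y"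
proof (rule ccontr)
  assume no: "\<not> thesis"
  obtain U where U: "open U" "x \<in> U" "bounded (\<Union>y\<in>U. F y)"
    using lb \<open>x \<in> S\<close> by (auto simp: locally_bounded_on_def)
  then obtain r where r: "r > 0" "ball x r \<subseteq> U" using openE by blast
  have "\<exists>x' y. x' \<in> ball x (min r (1 / real (Suc n))) \<and> y \<in> F x' \<and> a \<bullet> y \<le> b" for n
  proof (rule ccontr)
    assume n: "\<not> ?thesis"
    have "min r (1 / real (Suc n)) > 0" using r(1) by simp
    with no show False by (rule notE[OF _ that]) (use n in \<open>meson not_le\<close>)
  qed
  then obtain X Y where XY: "\<And>n. X n \<in> ball x (min r (1 / real (Suc n)))" "\<And>n. Y n \<in> F (X n)"
    "\<And>n. a \<bullet> Y n \<le> b" by metis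
  have "range Y \<subseteq> (\<Union>y\<in>U. F y)"
  proof clarify
    fix n
    have "X n \<in> U" using XY(1)[of n] r(2) by auto
    with XY(2) show "Y n \<in> (\<Union>y\<in>U. F y)" by blast
  qed
  then have "bounded (range Y)" using U(3) bounded_subset by blast
  then obtain y \<sigma> where y: "strict_mono (\<sigma> :: nat \<Rightarrow> nat)" "(Y \<circ> \<sigma>) \<longlonglongrightarrow> y"
    using bounded_imp_convergent_subsequence by blast
  have "X \<longlonglongrightarrow> x"
  proof (rule metric_LIMSEQ_I)
    fix e :: real assume "e > 0"
    then obtain N :: nat where N: "1 / real (Suc N) < e" using nat_approx_posE by blast
    have "dist (X n) x < e" if "n \<ge> N" for n
    proof -
      have "dist (X n) x < 1 / real (Suc n)" using XY(1)[of n] by (simp add: dist_commute)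
      also have "\<dots> \<le> 1 / real (Suc N)" using that by (simp add: frac_le)
      finally show ?thesis using N by simp
    qed
    then show "\<exists>N. \<forall>n\<ge>N. dist (X n) x < e" by blast
  qed
  then have "(X \<circ> \<sigma>) \<longlonglongrightarrow> x" using y(1) by (rule LIMSEQ_subseq_LIMSEQ)
  then have "y \<in> F x"
    using osc y(2) XY(2) unfolding outer_semicontinuous_def by (metis comp_apply)
  moreover have "a \<bullet> y \<le> b"
    by (rule LIMSEQ_le_const2[OF tendsto_inner[OF tendsto_const y(2)]]) (use XY(3) in auto)
  ultimately show False using a by force
qed

lemma outer_semicontinuous_closed_values:
  fixes F :: "'a::metric_space \<Rightarrow> 'b::metric_space set"
  assumes "outer_semicontinuous F"
  shows "closed (F x)"
  unfolding closed_sequential_limits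
proof (intro allI impI, elim conjE)
  fix Y y assume "\<forall>n. Y n \<in> F x" "Y \<longlonglongrightarrow> y"
  then show "y \<in> F x"
    using assms tendsto_const[of x sequentially] unfolding outer_semicontinuous_def by blast
qed

section \<open>Limits of flow arcs\<close>

lemma clamp_lipschitz_on:
  fixes g :: "real \<Rightarrow> 'a::metric_space"
  assumes L: "M-lipschitz_on {0..T} g" and "0 \<le> T"
  shows "M-lipschitz_on UNIV (\<lambda>t. g (max 0 (min t T)))"
proof (rule lipschitz_onI)
  fix s t :: real
  have "dist (g (max 0 (min s T))) (g (max 0 (min t T))) \<le> M * dist (max 0 (min s T)) (max 0 (min t T))"
    using \<open>0 \<le> T\<close> by (intro lipschitz_onD[OF L]) auto
  also have "\<dots> \<le> M * dist s t"
    by (intro mult_left_mono lipschitz_on_nonneg[OF L]) (auto simp: dist_real_def)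
  finally show "dist (g (max 0 (min s T))) (g (max 0 (min t T))) \<le> M * dist s t" .
qed (rule lipschitz_on_nonneg[OF L])

lemma lipschitz_arcs_convergent_subsequence:
  fixes w :: "nat \<Rightarrow> real \<Rightarrow> 'a::euclidean_space"
  assumes L: "\<And>i. M-lipschitz_on UNIV (w i)" and p: "(\<lambda>i. w i 0) \<longlonglongrightarrow> p"
  obtains g \<sigma> where "strict_mono (\<sigma> :: nat \<Rightarrow> nat)" "\<And>t. t \<in> {0..1} \<Longrightarrow> (\<lambda>i. w (\<sigma> i) t) \<longlonglongrightarrow> g t"
    "M-lipschitz_on {0..1} g"
proof -
  have "M \<ge> 0" using L[of 0] by (rule lipschitz_on_nonneg)
  have "Bseq (\<lambda>i. w i 0)" using p by (intro convergent_imp_Bseq convergentI)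
  then obtain B where B: "\<And>i. norm (w i 0) \<le> B" by (auto simp: Bseq_def)
  have nrm: "norm (w i s - w i t) \<le> M * \<bar>s - t\<bar>" for i s t
    using lipschitz_on_normD[OF L] by simp
  obtain g \<sigma> where \<sigma>: "strict_mono (\<sigma> :: nat \<Rightarrow> nat)"
    and g: "\<And>e. 0 < e \<Longrightarrow> \<exists>N. \<forall>n x. n \<ge> N \<and> x \<in> {0..1} \<longrightarrow> norm (w (\<sigma> n) x - g x) < e"
  proof (rule Arzela_Ascoli[of "{0..1::real}" w "B + M"])
    fix i and t :: real assume t: "t \<in> {0..1}"
    have "norm (w i t) \<le> norm (w i 0) + norm (w i t - w i 0)" by norm
    also have "\<dots> \<le> B + M * \<bar>t - 0\<bar>" by (intro add_mono B nrm)
    also have "\<dots> \<le> B + M * 1" using t \<open>M \<ge> 0\<close> by (intro add_left_mono mult_left_mono) auto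
    finally show "norm (w i t) \<le> B + M" by simp
  next
    fix t e :: real assume "0 < e"
    show "\<exists>d>0. \<forall>n y. y \<in> {0..1} \<and> norm (t - y) < d \<longrightarrow> norm (w n t - w n y) < e"
    proof (intro exI[of _ "e / (M + 1)"] conjI allI impI)
      show "0 < e / (M + 1)" using \<open>0 < e\<close> \<open>M \<ge> 0\<close> by simp
      fix n y assume y: "y \<in> {0..1} \<and> norm (t - y) < e / (M + 1)"
      have "norm (w n t - w n y) \<le> (M + 1) * \<bar>t - y\<bar>"
        using nrm[of n t y] by (simp add: algebra_simps)
      also have "\<dots> < (M + 1) * (e / (M + 1))"
        using y \<open>M \<ge> 0\<close> by (intro mult_strict_left_mono) auto
      also have "\<dots> = e" using \<open>M \<ge> 0\<close> by simp
      finally show "norm (w n t - w n y) < e" .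
    qed
  qed auto
  have lim: "(\<lambda>i. w (\<sigma> i) t) \<longlonglongrightarrow> g t" if "t \<in> {0..1}" for t
    unfolding LIMSEQ_iff using g that by blast
  have "M-lipschitz_on {0..1} g"
  proof (rule lipschitz_onI)
    fix s t :: real assume st: "s \<in> {0..1}" "t \<in> {0..1}"
    show "dist (g s) (g t) \<le> M * dist s t"
      by (rule LIMSEQ_le_const2[OF tendsto_dist[OF lim lim]])
        (use st lipschitz_onD[OF L] in auto)
  qed fact
  with \<sigma> lim show ?thesis by (rule that)
qed

text \<open>Bounded velocities make the arcs uniformly Lipschitz, so Arzela-Ascoli gives a Lipschitz
  limit. Its velocities are identified pointwise wherever it is differentiable, which avoids weak
  convergence of derivatives.\<close>

lemma flow_arc_limit:
  fixes H :: "'a::euclidean_space hybrid_system"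
  assumes H: "basic_assumptions H" and "compact K" "closed \<Gamma>" "\<Gamma> \<noteq> {}"
    and w: "\<And>i. flow_arc H (\<tau> i) (w i)" and \<tau>1: "\<And>i. \<tau> i \<le> 1"
    and wK: "\<And>i t. t \<in> {0..<\<tau> i} \<Longrightarrow> w i t \<in> K"
    and w\<Gamma>: "\<And>i t. t \<in> {0..<\<tau> i} \<Longrightarrow> infdist (w i t) \<Gamma> \<le> \<eta> i" and \<eta>: "\<eta> \<longlonglongrightarrow> 0"
    and p: "(\<lambda>i. w i 0) \<longlonglongrightarrow> p"
  obtains \<sigma> T W where "strict_mono (\<sigma> :: nat \<Rightarrow> nat)" "(\<lambda>i. \<tau> (\<sigma> i)) \<longlonglongrightarrow> T"
    "(\<lambda>i. w (\<sigma> i) (\<tau> (\<sigma> i))) \<longlonglongrightarrow> W T" "W 0 = p" "flow_arc (restrict_system H \<Gamma>) T W"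
proof -
  have C: "closed (flow_set H)" and osc: "outer_semicontinuous (flow_map H)"
    and lb: "locally_bounded_on (flow_set H) (flow_map H)"
    and cvx: "\<And>x. x \<in> flow_set H \<Longrightarrow> convex (flow_map H x)"
    using H by (auto simp: basic_assumptions_def)
  have wC: "w i t \<in> flow_set H" if "t \<in> {0..<\<tau> i}" for i t
    using w[of i] that by (auto simp: flow_arc_def)
  have \<tau>0: "0 \<le> \<tau> i" for i using w[of i] by (simp add: flow_arc_def)
  have "compact (flow_set H \<inter> K)" using C \<open>compact K\<close> by (rule closed_Int_compact)
  then obtain M where "M \<ge> 0" and M: "\<And>x y. x \<in> flow_set H \<inter> K \<Longrightarrow> y \<in> flow_map H x \<Longrightarrow> norm y \<le> M"
    by (rule locally_bounded_on_compact[OF lb]) auto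
  have wL: "M-lipschitz_on {0..\<tau> i} (w i)" for i
    using \<open>M \<ge> 0\<close>
  proof (rule flow_arc_lipschitz[OF w])
    fix t y assume "t \<in> {0<..<\<tau> i}" "y \<in> flow_map H (w i t)"
    then show "norm y \<le> M" using wC[of t i] wK[of t i] by (intro M[of "w i t"]) auto
  qed
  \<comment> \<open>Durations vary with \<open>i\<close>, so the arcs are frozen outside
    [0, \<tau> i] to share one domain.\<close>
  define V where "V i t = w i (max 0 (min t (\<tau> i)))" for i t
  have VL: "M-lipschitz_on UNIV (V i)" for i
    unfolding V_def by (rule clamp_lipschitz_on[OF wL \<tau>0])
  have V_eq: "V i t = w i t" if "0 \<le> t" "t \<le> \<tau> i" for i t using that by (simp add: V_def)
  have "(\<lambda>i. V i 0) \<longlonglongrightarrow> p" using p by (simp add: V_eq \<tau>0)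
  then obtain g \<sigma>1 where \<sigma>1: "strict_mono (\<sigma>1 :: nat \<Rightarrow> nat)"
    and g1: "\<And>t. t \<in> {0..1} \<Longrightarrow> (\<lambda>i. V (\<sigma>1 i) t) \<longlonglongrightarrow> g t" and gL: "M-lipschitz_on {0..1} g"
    by (rule lipschitz_arcs_convergent_subsequence[OF VL]) blast
  have "\<forall>i. \<tau> (\<sigma>1 i) \<in> {0..1}" using \<tau>0 \<tau>1 by auto
  then obtain T \<sigma>2 where T: "T \<in> {0..1}" "strict_mono (\<sigma>2 :: nat \<Rightarrow> nat)" "((\<lambda>i. \<tau> (\<sigma>1 i)) \<circ> \<sigma>2) \<longlonglongrightarrow> T"
    using compact_Icc[of "0::real" 1] unfolding compact_def by metis
  define \<sigma> where "\<sigma> = \<sigma>1 \<circ> \<sigma>2"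
  have \<sigma>: "strict_mono \<sigma>" unfolding \<sigma>_def using \<sigma>1 T(2) by (rule strict_mono_o)
  have \<tau>T: "(\<lambda>i. \<tau> (\<sigma> i)) \<longlonglongrightarrow> T" using T(3) by (simp add: \<sigma>_def comp_def)
  have Vg: "(\<lambda>i. V (\<sigma> i) t) \<longlonglongrightarrow> g t" if "t \<in> {0..1}" for t
    using LIMSEQ_subseq_LIMSEQ[OF g1[OF that] T(2)] by (simp add: \<sigma>_def comp_def)
  have \<eta>\<sigma>: "(\<lambda>i. \<eta> (\<sigma> i)) \<longlonglongrightarrow> 0" using LIMSEQ_subseq_LIMSEQ[OF \<eta> \<sigma>] by (simp add: comp_def)
  define W where "W t = g (max 0 (min t T))" for t
  have WL: "M-lipschitz_on UNIV W"
    unfolding W_def using T(1) by (intro clamp_lipschitz_on lipschitz_on_subset[OF gL]) auto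
  have VW: "(\<lambda>i. V (\<sigma> i) t) \<longlonglongrightarrow> W t" if "0 \<le> t" "t \<le> T" for t
    using Vg[of t] that T(1) by (simp add: W_def)
  \<comment> \<open>Constraints hold only before the end of each arc; a time below \<open>T\<close>
    is eventually below \<tau> (\<sigma> i), so they pass to the limit on [0, T).\<close>
  have before: "\<forall>\<^sub>F i in sequentially. t < \<tau> (\<sigma> i)" if "t < T" for t
    using order_tendstoD(1)[OF \<tau>T that] .
  have W_in: "W t \<in> flow_set H \<inter> \<Gamma>" if "0 \<le> t" "t < T" for t
  proof
    have ev: "\<forall>\<^sub>F i in sequentially. V (\<sigma> i) t \<in> flow_set H \<and> infdist (V (\<sigma> i) t) \<Gamma> \<le> \<eta> (\<sigma> i)"
      using before[OF \<open>t < T\<close>] by eventually_elim (use that wC w\<Gamma> V_eq in auto)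
    note lim = VW[of t]
    show "W t \<in> flow_set H"
      by (rule Lim_in_closed_set[OF C _ _ lim]) (use ev that in \<open>auto elim: eventually_mono\<close>)
    have "infdist (W t) \<Gamma> \<le> 0"
      by (rule tendsto_le[OF _ \<eta>\<sigma> tendsto_infdist[OF lim]])
        (use ev that in \<open>auto elim: eventually_mono\<close>)
    then have "infdist (W t) \<Gamma> = 0" using infdist_nonneg[of "W t" \<Gamma>] by simp
    then show "W t \<in> \<Gamma>" using in_closed_iff_infdist_zero[OF \<open>closed \<Gamma>\<close> \<open>\<Gamma> \<noteq> {}\<close>] by simp
  qed
  \<comment> \<open>A derivative outside the closed convex set of velocities would be strictly separated from it;
    by outer semicontinuity the velocities of the approximating arcs near t lie in the same
    half-space, hence so do their difference quotients and those of the limit.\<close>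
  have deriv: "D \<in> flow_map H (W t)" if t: "0 < t" "t < T" and D: "(W has_vector_derivative D) (at t)" for t D
  proof (rule ccontr)
    assume "D \<notin> flow_map H (W t)"
    have WC: "W t \<in> flow_set H" using W_in t by auto
    obtain a b where ab: "a \<bullet> D < b" "\<And>y. y \<in> flow_map H (W t) \<Longrightarrow> b < a \<bullet> y"
      using separating_hyperplane_closed_point[OF cvx[OF WC] outer_semicontinuous_closed_values[OF osc]
          \<open>D \<notin> flow_map H (W t)\<close>] by blast
    obtain \<rho> where "\<rho> > 0" and \<rho>: "\<And>x' y. x' \<in> ball (W t) \<rho> \<Longrightarrow> y \<in> flow_map H x' \<Longrightarrow> b < a \<bullet> y"
      using outer_semicontinuous_halfspace_nbhd[OF osc lb WC ab(2)] by blast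
    have "((\<lambda>s. a \<bullet> W s) has_vector_derivative a \<bullet> D) (at t)"
      using D by (rule bounded_linear.has_vector_derivative[OF bounded_linear_inner_right])
    then have "((\<lambda>s. a \<bullet> W s) has_real_derivative a \<bullet> D) (at t)"
      by (simp add: has_real_derivative_iff_has_vector_derivative)
    \<comment> \<open>Subtracting b * s turns the strict separation into a negative derivative, so
      just to the right of \<open>t\<close> the limit falls short of slope \<open>b\<close>.\<close>
    then have "((\<lambda>s. a \<bullet> W s - b * s) has_real_derivative a \<bullet> D - b) (at t)"
      by (auto intro!: derivative_eq_intros)
    then obtain d where "d > 0" and d: "\<And>h. 0 < h \<Longrightarrow> h < d \<Longrightarrow> a \<bullet> W t - b * t > a \<bullet> W (t + h) - b * (t + h)"
      using DERIV_neg_dec_right[of "\<lambda>s. a \<bullet> W s - b * s" "a \<bullet> D - b" t] ab(1) by auto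
    \<comment> \<open>d / 2 keeps the decrease valid, (T - t) / 2 keeps t + h before
      \<open>T\<close>, and the last bound makes M * h < \<rho> / 2, so that arcs within \<rho> / 2
      of \<open>W t\<close> at time \<open>t\<close> stay in the ball of radius \<rho> up to t +
      h.\<close>
    define h where "h = min (d / 2) (min ((T - t) / 2) (\<rho> / (2 * (M + 1))))"
    have h: "0 < h" "h < d" "t + h < T" "h \<le> \<rho> / (2 * (M + 1))"
    proof -
      have "\<rho> / (2 * (M + 1)) > 0" using \<open>\<rho> > 0\<close> \<open>M \<ge> 0\<close> by simp
      then show "0 < h" using \<open>d > 0\<close> t by (simp add: h_def)
      have "h \<le> d / 2" "h \<le> (T - t) / 2"
        unfolding h_def by (meson min.cobounded1 min.cobounded2 order_trans)+
      then show "h < d" "t + h < T" using \<open>d > 0\<close> t by auto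
      show "h \<le> \<rho> / (2 * (M + 1))" by (simp add: h_def)
    qed
    have "(M + 1) * h \<le> \<rho> / 2" using h(4) \<open>M \<ge> 0\<close> by (simp add: field_simps)
    then have Mh: "M * h < \<rho> / 2" using h(1) by (simp add: algebra_simps)
    have "\<forall>\<^sub>F i in sequentially. dist (V (\<sigma> i) t) (W t) < \<rho> / 2"
      using VW[of t] t \<open>\<rho> > 0\<close> by (intro tendstoD) auto
    then have "\<forall>\<^sub>F i in sequentially. b * h \<le> a \<bullet> (V (\<sigma> i) (t + h) - V (\<sigma> i) t)"
      using before[OF h(3)]
    proof eventually_elim
      fix i assume i: "dist (V (\<sigma> i) t) (W t) < \<rho> / 2" "t + h < \<tau> (\<sigma> i)"
      have "b * (t + h - t) \<le> a \<bullet> (w (\<sigma> i) (t + h) - w (\<sigma> i) t)"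
      proof (rule flow_arc_increment_ge[OF w])
        fix s y assume s: "s \<in> {t<..<t + h}" and y: "y \<in> flow_map H (w (\<sigma> i) s)"
        have "dist (V (\<sigma> i) t) (V (\<sigma> i) s) \<le> M * dist t s" by (rule lipschitz_onD[OF VL]) auto
        also have "\<dots> \<le> M * h" using s \<open>M \<ge> 0\<close> by (intro mult_left_mono) (auto simp: dist_real_def)
        finally have "dist (W t) (V (\<sigma> i) s) < \<rho>"
          using i(1) Mh dist_triangle[of "W t" "V (\<sigma> i) s" "V (\<sigma> i) t"] by (simp add: dist_commute)
        then have "w (\<sigma> i) s \<in> ball (W t) \<rho>" using s t i(2) V_eq[of s "\<sigma> i"] by simp
        from \<rho>[OF this y] show "b \<le> a \<bullet> y" by simp
      qed (use t h i in auto)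
      then show "b * h \<le> a \<bullet> (V (\<sigma> i) (t + h) - V (\<sigma> i) t)"
        using t h i by (simp add: V_eq)
    qed
    moreover have "(\<lambda>i. a \<bullet> (V (\<sigma> i) (t + h) - V (\<sigma> i) t)) \<longlonglongrightarrow> a \<bullet> (W (t + h) - W t)"
      using t h by (intro tendsto_intros VW) auto
    ultimately have "b * h \<le> a \<bullet> (W (t + h) - W t)"
      using tendsto_lowerbound by fastforce
    with d[OF h(1,2)] show False by (simp add: algebra_simps)
  qed
  show ?thesis
  proof (rule that[OF \<sigma> \<tau>T])
    \<comment> \<open>Convergence at the fixed time \<open>T\<close> is moved to the varying end
      times by the common Lipschitz constant.\<close>
    show "(\<lambda>i. w (\<sigma> i) (\<tau> (\<sigma> i))) \<longlonglongrightarrow> W T"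
    proof (rule Lim_transform)
      show "(\<lambda>i. V (\<sigma> i) T) \<longlonglongrightarrow> W T" using T(1) by (intro VW) auto
      have "(\<lambda>i. M * \<bar>\<tau> (\<sigma> i) - T\<bar>) \<longlonglongrightarrow> M * \<bar>T - T\<bar>" by (intro tendsto_intros \<tau>T)
      then have lim0: "(\<lambda>i. M * \<bar>\<tau> (\<sigma> i) - T\<bar>) \<longlonglongrightarrow> 0" by simp
      have "norm (w (\<sigma> i) (\<tau> (\<sigma> i)) - V (\<sigma> i) T) \<le> M * \<bar>\<tau> (\<sigma> i) - T\<bar>" for i
        using lipschitz_on_normD[OF VL, of "\<tau> (\<sigma> i)" T "\<sigma> i"] V_eq[of "\<tau> (\<sigma> i)" "\<sigma> i"] \<tau>0 by simp
      then show "(\<lambda>i. w (\<sigma> i) (\<tau> (\<sigma> i)) - V (\<sigma> i) T) \<longlonglongrightarrow> 0"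
        by (intro Lim_null_comparison[OF _ lim0] always_eventually) blast
    qed
    have "(\<lambda>i. V (\<sigma> i) 0) \<longlonglongrightarrow> W 0" using T(1) by (intro VW) auto
    moreover have "(\<lambda>i. V (\<sigma> i) 0) \<longlonglongrightarrow> p"
      using LIMSEQ_subseq_LIMSEQ[OF \<open>(\<lambda>i. V i 0) \<longlonglongrightarrow> p\<close> \<sigma>] by (simp add: comp_def)
    ultimately show "W 0 = p" by (rule LIMSEQ_unique)
    show "flow_arc (restrict_system H \<Gamma>) T W"
      unfolding flow_arc_def
    proof (intro conjI ballI)
      show "0 \<le> T" using T(1) by simp
      show "absolutely_continuous_on {0..T} W"
        using lipschitz_imp_absolutely_continuous_on[OF WL] by (rule absolutely_continuous_on_subset) auto
      show "W t \<in> flow_set (restrict_system H \<Gamma>)" if "t \<in> {0..<T}" for t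
        using W_in that by (simp add: restrict_system_def)
      show "negligible {t \<in> {0<..<T}. \<not> (\<exists>v\<in>flow_map (restrict_system H \<Gamma>) (W t). (W has_vector_derivative v) (at t))}"
        by (rule negligible_subset[OF lipschitz_ae_vector_differentiable[OF WL]])
          (use deriv in \<open>auto simp: restrict_system_def\<close>)
    qed
  qed
qed

section \<open>Hybrid time domains\<close>

text \<open>A characterisation of hybrid time domains without switching times. Every clause mentions at
  most two given points, so it passes to unions of chains.\<close>

definition hybrid_interval :: "(real \<times> nat) set \<Rightarrow> bool" where
  "hybrid_interval E \<longleftrightarrow> (0, 0) \<in> E \<and> (\<forall>t j. (t, j) \<in> E \<longrightarrow> 0 \<le> t) \<and>
     (\<forall>s t u j. (s, j) \<in> E \<and> (u, j) \<in> E \<and> s \<le> t \<and> t \<le> u \<longrightarrow> (t, j) \<in> E) \<and>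
     (\<forall>t j s k. (t, j) \<in> E \<and> (s, k) \<in> E \<and> j < k \<longrightarrow> t \<le> s) \<and>
     (\<forall>t j. (t, Suc j) \<in> E \<longrightarrow> (\<exists>s. (s, j) \<in> E \<and> (s, Suc j) \<in> E))"

lemma hybrid_intervalD:
  assumes "hybrid_interval E"
  shows "(0, 0) \<in> E" "\<And>t j. (t, j) \<in> E \<Longrightarrow> 0 \<le> t"
    "\<And>s t u j. (s, j) \<in> E \<Longrightarrow> (u, j) \<in> E \<Longrightarrow> s \<le> t \<Longrightarrow> t \<le> u \<Longrightarrow> (t, j) \<in> E"
    "\<And>t j s k. (t, j) \<in> E \<Longrightarrow> (s, k) \<in> E \<Longrightarrow> j < k \<Longrightarrow> t \<le> s"
    "\<And>t j. (t, Suc j) \<in> E \<Longrightarrow> \<exists>s. (s, j) \<in> E \<and> (s, Suc j) \<in> E"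
  using assms unfolding hybrid_interval_def by blast+

lemma hybrid_time_domain_imp_hybrid_interval:
  assumes "hybrid_time_domain E"
  shows "hybrid_interval E"
proof -
  obtain t :: "nat \<Rightarrow> real" where t0: "t 0 = 0" and "mono t" and E: "E = (\<Union>j. {t j..t (Suc j)} \<times> {j}) \<or>
         (\<exists>J L. E = (\<Union>j<J. {t j..t (Suc j)} \<times> {j}) \<union> L \<times> {J} \<and>
            (L = {t J..t (Suc J)} \<or> (t J < t (Suc J) \<and> L = {t J..<t (Suc J)}) \<or> L = {t J..}))"
    using assms unfolding hybrid_time_domain_def by blast
  have tm: "t i \<le> t j" if "i \<le> j" for i j using \<open>mono t\<close> that by (rule monoD)
  have tp: "0 \<le> t j" for j using tm[of 0 j] t0 by simp
  from E show ?thesis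
  proof
    assume "E = (\<Union>j. {t j..t (Suc j)} \<times> {j})"
    then have E: "(s, j) \<in> E \<longleftrightarrow> t j \<le> s \<and> s \<le> t (Suc j)" for s j by auto
    show ?thesis
      unfolding hybrid_interval_def E
    proof (intro conjI allI impI)
      show "t 0 \<le> 0" "0 \<le> t (Suc 0)" using t0 tp by auto
      fix s u :: real and j k :: nat
      show "0 \<le> s" if "t j \<le> s \<and> s \<le> t (Suc j)" using that tp[of j] by simp
      show "s \<le> u" if "(t j \<le> s \<and> s \<le> t (Suc j)) \<and> (t k \<le> u \<and> u \<le> t (Suc k)) \<and> j < k"
        using that tm[of "Suc j" k] by simp
      show "\<exists>s. (t j \<le> s \<and> s \<le> t (Suc j)) \<and> (t (Suc j) \<le> s \<and> s \<le> t (Suc (Suc j)))"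
        by (intro exI[of _ "t (Suc j)"]) (simp add: tm)
    qed auto
  next
    assume "\<exists>J L. E = (\<Union>j<J. {t j..t (Suc j)} \<times> {j}) \<union> L \<times> {J} \<and>
            (L = {t J..t (Suc J)} \<or> (t J < t (Suc J) \<and> L = {t J..<t (Suc J)}) \<or> L = {t J..})"
    then obtain J L where "E = (\<Union>j<J. {t j..t (Suc j)} \<times> {j}) \<union> L \<times> {J}"
      and L': "L = {t J..t (Suc J)} \<or> (t J < t (Suc J) \<and> L = {t J..<t (Suc J)}) \<or> L = {t J..}" by blast
    then have E: "(s, j) \<in> E \<longleftrightarrow> j < J \<and> t j \<le> s \<and> s \<le> t (Suc j) \<or> j = J \<and> s \<in> L" for s j by auto
    have L1: "t J \<in> L" using L' tm[of J "Suc J"] by auto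
    have L2: "t J \<le> s" if "s \<in> L" for s using L' that by auto
    have L3: "s \<in> L" if "u \<in> L" "v \<in> L" "u \<le> s" "s \<le> v" for s u v using L' that by auto
    show ?thesis
      unfolding hybrid_interval_def E
    proof (intro conjI allI impI)
      show "0 < J \<and> t 0 \<le> 0 \<and> 0 \<le> t (Suc 0) \<or> 0 = J \<and> 0 \<in> L" using t0 tp[of "Suc 0"] L1 by (cases J) auto
      fix s u v :: real and j k :: nat
      show "0 \<le> s" if "j < J \<and> t j \<le> s \<and> s \<le> t (Suc j) \<or> j = J \<and> s \<in> L"
        using that tp[of j] L2[of s] by fastforce
      show "s \<le> u" if "(j < J \<and> t j \<le> s \<and> s \<le> t (Suc j) \<or> j = J \<and> s \<in> L) \<and>
         (k < J \<and> t k \<le> u \<and> u \<le> t (Suc k) \<or> k = J \<and> u \<in> L) \<and> j < k"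
        using that tm[of "Suc j" k] L2[of u] by fastforce
      show "j < J \<and> t j \<le> s \<and> s \<le> t (Suc j) \<or> j = J \<and> s \<in> L"
        if "(j < J \<and> t j \<le> v \<and> v \<le> t (Suc j) \<or> j = J \<and> v \<in> L) \<and>
            (j < J \<and> t j \<le> u \<and> u \<le> t (Suc j) \<or> j = J \<and> u \<in> L) \<and> v \<le> s \<and> s \<le> u"
        using that L3[of v u s] by fastforce
      show "\<exists>s. (j < J \<and> t j \<le> s \<and> s \<le> t (Suc j) \<or> j = J \<and> s \<in> L) \<and>
          (Suc j < J \<and> t (Suc j) \<le> s \<and> s \<le> t (Suc (Suc j)) \<or> Suc j = J \<and> s \<in> L)"
        if "Suc j < J \<and> t (Suc j) \<le> s \<and> s \<le> t (Suc (Suc j)) \<or> Suc j = J \<and> s \<in> L"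
        using that tm[of j "Suc j"] tm[of "Suc j" "Suc (Suc j)"] L1 by (intro exI[of _ "t (Suc j)"]) auto
    qed
  qed
qed

lemma hybrid_interval_imp_hybrid_time_domain:
  assumes "hybrid_interval E"
  shows "hybrid_time_domain E"
proof -
  note E = hybrid_intervalD[OF assms]
  \<comment> \<open>Meaningful only when level \<open>Suc j\<close> is inhabited.\<close>
  define s where "s j = (SOME s. (s, j) \<in> E \<and> (s, Suc j) \<in> E)" for j
  have s: "(s j, j) \<in> E \<and> (s j, Suc j) \<in> E" if "(u, Suc j) \<in> E" for u j
    unfolding s_def using E(5)[OF that] by (rule someI_ex)
  show ?thesis
  proof (cases "\<forall>j. \<exists>u. (u, j) \<in> E")
    case True
    then have s: "(s j, j) \<in> E" "(s j, Suc j) \<in> E" for j using s by blast+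
    define t where "t = case_nat 0 s"
    have t: "t 0 = 0" "t (Suc j) = s j" for j by (auto simp: t_def)
    have tE: "(t j, j) \<in> E" for j using E(1) s by (cases j) (auto simp: t)
    have "E = (\<Union>j. {t j..t (Suc j)} \<times> {j})"
    proof (intro set_eqI iffI)
      fix p assume "p \<in> E"
      then obtain u j where p: "p = (u, j)" "(u, j) \<in> E" by (cases p) auto
      have "t j \<le> u" using E(2)[OF p(2)] E(4)[OF s(1) p(2)] by (cases j) (auto simp: t)
      moreover have "u \<le> t (Suc j)" using E(4)[OF p(2) s(2)[of j]] by (simp add: t)
      ultimately show "p \<in> (\<Union>j. {t j..t (Suc j)} \<times> {j})" using p(1) by auto
    next
      fix p assume "p \<in> (\<Union>j. {t j..t (Suc j)} \<times> {j})"
      then obtain u j where p: "p = (u, j)" "t j \<le> u" "u \<le> t (Suc j)" by auto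
      then show "p \<in> E" using E(3)[OF tE s(1)[of j]] by (simp add: t)
    qed
    moreover have "mono t"
      unfolding mono_iff_le_Suc
    proof
      fix j
      show "t j \<le> t (Suc j)" using E(2)[OF s(1)[of 0]] E(4)[OF s(1) s(1)] by (cases j) (auto simp: t)
    qed
    ultimately show ?thesis unfolding hybrid_time_domain_def using t(1) by blast
  next
    case False
    define J where "J = (LEAST j. \<forall>u. (u, Suc j) \<notin> E)"
    obtain j0 where j0: "\<forall>u. (u, j0) \<notin> E" using False by blast
    with E(1) obtain j1 where "j0 = Suc j1" by (cases j0) auto
    with j0 have J: "\<forall>u. (u, Suc J) \<notin> E"
      unfolding J_def by (intro LeastI[of "\<lambda>j. \<forall>u. (u, Suc j) \<notin> E" j1]) simp
    have beyond: "(u, j) \<notin> E" if "j > J" for u j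
    proof -
      have "\<forall>u. (u, Suc J + n) \<notin> E" for n
      proof (induction n)
        case (Suc n)
        then show ?case using E(5)[of _ "Suc J + n"] by (metis add_Suc_right)
      qed (use J in simp)
      from this[of "j - Suc J"] show ?thesis using that by simp
    qed
    have s: "(s j, j) \<in> E" "(s j, Suc j) \<in> E" if "j < J" for j
    proof -
      have "\<exists>u. (u, Suc j) \<in> E" using not_less_Least[of j "\<lambda>j. \<forall>u. (u, Suc j) \<notin> E"] that by (simp add: J_def)
      then show "(s j, j) \<in> E" "(s j, Suc j) \<in> E" using s by blast+
    qed
    define L where "L = time_slice E J"
    define tJ where "tJ = case_nat 0 s J"
    have tJE: "(tJ, J) \<in> E" using E(1) s by (cases J) (auto simp: tJ_def)
    have tJ_le: "tJ \<le> u" if "u \<in> L" for u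
    proof (cases J)
      case 0
      then show ?thesis using that E(2)[of u J] by (simp add: tJ_def L_def time_slice_def)
    next
      case (Suc i)
      then show ?thesis using that E(4)[OF s(1)[of i], of u J] by (simp add: tJ_def L_def time_slice_def)
    qed
    have tJL: "tJ \<in> L" using tJE by (simp add: L_def time_slice_def)
    have conv: "u \<in> L" if "v \<in> L" "tJ \<le> u" "u \<le> v" for u v
      using E(3)[OF tJE, of v u] that by (simp add: L_def time_slice_def)
    have "\<exists>m\<ge>tJ. L = {tJ..m} \<or> (tJ < m \<and> L = {tJ..<m}) \<or> L = {tJ..}"
    proof (cases "bdd_above L")
      case True
      obtain M where M: "Sup L = M" by blast
      have up: "u \<le> M" if "u \<in> L" for u using cSup_upper[OF that True] M by simp
      show ?thesis
      proof (cases "M \<in> L")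
        case True
        have "L = {tJ..M}" by (rule set_eqI) (meson atLeastAtMost_iff conv True up tJ_le)
        then show ?thesis using up[OF tJL] by blast
      next
        case False
        have "u \<in> L" if "tJ \<le> u" and uM: "u < M" for u
        proof -
          have "L \<noteq> {}" using tJL by blast
          then obtain v where "v \<in> L" "u < v" using less_cSupD[of L u] uM M by blast
          then show ?thesis using conv[of v u] that by simp
        qed
        moreover have "u < M" if "u \<in> L" for u using up[OF that] False that by (cases "u = M") auto
        ultimately have "L = {tJ..<M}" by (intro set_eqI) (meson atLeastLessThan_iff tJ_le)
        moreover have "tJ < M" using up[OF tJL] False tJL by (cases "tJ = M") auto
        ultimately show ?thesis by (intro exI[of _ "M"]) auto
      qed
    next
      case False
      have "u \<in> L" if "tJ \<le> u" for u
      proof -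
        obtain v where "v \<in> L" "u \<le> v" using False unfolding bdd_above_def by (meson linear)
        then show ?thesis using conv[of v u] that by simp
      qed
      then have "L = {tJ..}" by (intro set_eqI) (meson atLeast_iff tJ_le)
      then show ?thesis by (intro exI[of _ tJ]) auto
    qed
    then obtain m where m: "tJ \<le> m" "L = {tJ..m} \<or> (tJ < m \<and> L = {tJ..<m}) \<or> L = {tJ..}" by blast
    \<comment> \<open>Beyond level \<open>J\<close> the sequence is frozen at \<open>m\<close>,
      which keeps it monotone.\<close>
    define t where "t n = (if n \<le> J then case_nat 0 s n else m)" for n
    have t: "t 0 = 0" "t J = tJ" "t (Suc J) = m" "\<And>j. j < J \<Longrightarrow> t (Suc j) = s j" "\<And>j. j > J \<Longrightarrow> t j = m"
      by (auto simp: t_def tJ_def)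
    have tE: "(t j, j) \<in> E" if "j \<le> J" for j using E(1) s that by (cases j) (auto simp: t_def)
    have "E = (\<Union>j<J. {t j..t (Suc j)} \<times> {j}) \<union> L \<times> {J}"
    proof (intro set_eqI iffI)
      fix p assume "p \<in> E"
      then obtain u j where p: "p = (u, j)" "(u, j) \<in> E" by (cases p) auto
      then consider "j < J" | "j = J" using beyond[of j u] by linarith
      then show "p \<in> (\<Union>j<J. {t j..t (Suc j)} \<times> {j}) \<union> L \<times> {J}"
      proof cases
        case 1
        have "t j \<le> u"
        proof (cases j)
          case 0
          then show ?thesis using E(2)[OF p(2)] t(1) by simp
        next
          case (Suc i)
          then show ?thesis using E(4)[OF s(1) p(2), of i] 1 t(4)[of i] by simp
        qed
        moreover have "u \<le> t (Suc j)" using E(4)[OF p(2) s(2)[of j]] 1 by (simp add: t)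
        ultimately show ?thesis using p(1) 1 by auto
      next
        case 2
        then show ?thesis using p by (simp add: L_def time_slice_def)
      qed
    next
      fix p assume "p \<in> (\<Union>j<J. {t j..t (Suc j)} \<times> {j}) \<union> L \<times> {J}"
      then consider u j where "p = (u, j)" "j < J" "t j \<le> u" "u \<le> t (Suc j)" | u where "p = (u, J)" "u \<in> L"
        by auto
      then show "p \<in> E"
      proof cases
        case 1
        then show ?thesis using E(3)[OF tE s(1), of j u] t(4) by simp
      next
        case 2
        then show ?thesis by (simp add: L_def time_slice_def)
      qed
    qed
    moreover have "mono t"
      unfolding mono_iff_le_Suc
    proof
      fix j
      consider "j < J" | "j = J" | "j > J" by linarith
      then show "t j \<le> t (Suc j)"
      proof cases
        case 1
        show ?thesis
        proof (cases j)
          case 0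
          then show ?thesis using E(2)[OF s(1)[OF 1]] 1 t(1,4) by simp
        next
          case (Suc i)
          then show ?thesis using E(4)[OF s(1)[of i] s(1)[of j]] 1 t(4) by simp
        qed
      qed (use t m in auto)
    qed
    ultimately show ?thesis
      unfolding hybrid_time_domain_def using t(1) m(2)
      by (intro exI[of _ t]) (rule conjI, simp, rule conjI, simp, rule disjI2,
        intro exI[of _ J] exI[of _ L], simp only: t(2,3) simp_thms)
  qed
qed

lemma hybrid_time_domain_iff: "hybrid_time_domain E \<longleftrightarrow> hybrid_interval E"
  using hybrid_time_domain_imp_hybrid_interval hybrid_interval_imp_hybrid_time_domain by blast

section \<open>Unions of chains of solutions and maximal extensions\<close>

lemma AE_lebesgue_iff_negligible: "(AE t in lebesgue. P t) \<longleftrightarrow> negligible {t. \<not> P t}"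
proof
  assume "AE t in lebesgue. P t"
  then obtain N where "N \<in> null_sets lebesgue" "{t. \<not> P t} \<subseteq> N"
    by (auto simp: eventually_ae_filter)
  then show "negligible {t. \<not> P t}" using negligible_iff_null_sets negligible_subset by blast
next
  assume "negligible {t. \<not> P t}"
  then show "AE t in lebesgue. P t"
    by (auto simp: eventually_ae_filter negligible_iff_null_sets)
qed

lemma absolutely_continuous_on_cong:
  assumes "\<And>t. t \<in> S \<Longrightarrow> f t = g t"
  shows "absolutely_continuous_on S f \<longleftrightarrow> absolutely_continuous_on S g"
proof -
  have "absolutely_continuous_on S g"
    if f: "absolutely_continuous_on S f" and eq: "\<And>t. t \<in> S \<Longrightarrow> f t = g t" for f g :: "real \<Rightarrow> 'a"
    unfolding absolutely_continuous_on_def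
  proof (intro allI impI)
    fix e :: real assume "e > 0"
    then obtain d where "d > 0" and d: "\<And>(n::nat) u v. (\<forall>i<n. u i \<le> v i \<and> {u i..v i} \<subseteq> S) \<and>
        disjoint_family_on (\<lambda>i. {u i<..<v i}) {..<n} \<and> (\<Sum>i<n. v i - u i) < d \<Longrightarrow>
        (\<Sum>i<n. norm (f (v i) - f (u i))) < e"
      using f unfolding absolutely_continuous_on_def by meson
    show "\<exists>d>0. \<forall>(n::nat) u v. (\<forall>i<n. u i \<le> v i \<and> {u i..v i} \<subseteq> S) \<and>
        disjoint_family_on (\<lambda>i. {u i<..<v i}) {..<n} \<and> (\<Sum>i<n. v i - u i) < d \<longrightarrow>
        (\<Sum>i<n. norm (g (v i) - g (u i))) < e"
    proof (intro exI[of _ d] conjI allI impI \<open>d > 0\<close>)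
      fix n :: nat and u v
      assume *: "(\<forall>i<n. u i \<le> v i \<and> {u i..v i} \<subseteq> S) \<and>
        disjoint_family_on (\<lambda>i. {u i<..<v i}) {..<n} \<and> (\<Sum>i<n. v i - u i) < d"
      have "(\<Sum>i<n. norm (g (v i) - g (u i))) = (\<Sum>i<n. norm (f (v i) - f (u i)))"
      proof (rule sum.cong[OF refl])
        fix i assume "i \<in> {..<n}"
        then have "u i \<le> v i" "{u i..v i} \<subseteq> S" using * by auto
        then have "u i \<in> S" "v i \<in> S" by auto
        then show "norm (g (v i) - g (u i)) = norm (f (v i) - f (u i))" using eq by simp
      qed
      with d[OF *] show "(\<Sum>i<n. norm (g (v i) - g (u i))) < e" by simp
    qed
  qed
  from this[of f g] this[of g f] assms show ?thesis by metis
qed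

lemma absolutely_continuous_on_degenerate:
  assumes "b \<le> a"
  shows "absolutely_continuous_on {a..b} f"
proof -
  have "norm (f v - f u) = 0" if uv: "u \<le> v" "{u..v} \<subseteq> {a..b}" for u v
  proof -
    have "u \<in> {a..b}" "v \<in> {a..b}" using uv by auto
    then have "u = v" using assms uv(1) by auto
    then show ?thesis by simp
  qed
  then have "(\<Sum>i<n. norm (f (v i) - f (u i))) = 0"
    if "\<forall>i<n. u i \<le> v i \<and> {u i..v i} \<subseteq> {a..b}" for u v :: "nat \<Rightarrow> real" and n
    using that by (intro sum.neutral) blast
  then show ?thesis unfolding absolutely_continuous_on_def by (metis zero_less_one)
qed

lemma absolutely_continuous_on_join:
  assumes 1: "absolutely_continuous_on {a..c} f" and 2: "absolutely_continuous_on {c..b} f"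
    and "a \<le> c" "c \<le> b"
  shows "absolutely_continuous_on {a..b} f"
  unfolding absolutely_continuous_on_def
proof (intro allI impI)
  fix e :: real assume "e > 0"
  then have "e / 2 > 0" by simp
  obtain d1 where "d1 > 0" and d1: "\<And>(n::nat) u v. (\<forall>i<n. u i \<le> v i \<and> {u i..v i} \<subseteq> {a..c}) \<and>
        disjoint_family_on (\<lambda>i. {u i<..<v i}) {..<n} \<and> (\<Sum>i<n. v i - u i) < d1 \<Longrightarrow>
        (\<Sum>i<n. norm (f (v i) - f (u i))) < e / 2"
    using 1 \<open>e / 2 > 0\<close> unfolding absolutely_continuous_on_def by meson
  obtain d2 where "d2 > 0" and d2: "\<And>(n::nat) u v. (\<forall>i<n. u i \<le> v i \<and> {u i..v i} \<subseteq> {c..b}) \<and>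
        disjoint_family_on (\<lambda>i. {u i<..<v i}) {..<n} \<and> (\<Sum>i<n. v i - u i) < d2 \<Longrightarrow>
        (\<Sum>i<n. norm (f (v i) - f (u i))) < e / 2"
    using 2 \<open>e / 2 > 0\<close> unfolding absolutely_continuous_on_def by meson
  show "\<exists>d>0. \<forall>(n::nat) u v. (\<forall>i<n. u i \<le> v i \<and> {u i..v i} \<subseteq> {a..b}) \<and>
        disjoint_family_on (\<lambda>i. {u i<..<v i}) {..<n} \<and> (\<Sum>i<n. v i - u i) < d \<longrightarrow>
        (\<Sum>i<n. norm (f (v i) - f (u i))) < e"
  proof (intro exI[of _ "min d1 d2"] conjI allI impI)
    show "min d1 d2 > 0" using \<open>d1 > 0\<close> \<open>d2 > 0\<close> by simp
    fix n :: nat and u v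
    assume *: "(\<forall>i<n. u i \<le> v i \<and> {u i..v i} \<subseteq> {a..b}) \<and>
        disjoint_family_on (\<lambda>i. {u i<..<v i}) {..<n} \<and> (\<Sum>i<n. v i - u i) < min d1 d2"
    then have disj: "disjoint_family_on (\<lambda>i. {u i<..<v i}) {..<n}"
      and len: "(\<Sum>i<n. v i - u i) < d1" "(\<Sum>i<n. v i - u i) < d2" by auto
    have uv: "u i \<le> v i" "a \<le> u i" "v i \<le> b" if "i < n" for i using * that by auto
    have "(\<Sum>i<n. norm (f (min (v i) c) - f (min (u i) c))) < e / 2"
    proof (rule d1, intro conjI allI impI)
      fix i assume "i < n"
      with uv[OF this] \<open>a \<le> c\<close> show "min (u i) c \<le> min (v i) c" "{min (u i) c..min (v i) c} \<subseteq> {a..c}" by auto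
    next
      show "disjoint_family_on (\<lambda>i. {min (u i) c<..<min (v i) c}) {..<n}"
        using disj by (fastforce simp: disjoint_family_on_def min_def split: if_splits)
      have "(\<Sum>i<n. min (v i) c - min (u i) c) \<le> (\<Sum>i<n. v i - u i)"
        using uv(1) by (intro sum_mono) (force simp: min_def)
      with len show "(\<Sum>i<n. min (v i) c - min (u i) c) < d1" by simp
    qed
    moreover have "(\<Sum>i<n. norm (f (max (v i) c) - f (max (u i) c))) < e / 2"
    proof (rule d2, intro conjI allI impI)
      fix i assume "i < n"
      with uv[OF this] \<open>c \<le> b\<close> show "max (u i) c \<le> max (v i) c" "{max (u i) c..max (v i) c} \<subseteq> {c..b}" by auto
    next
      show "disjoint_family_on (\<lambda>i. {max (u i) c<..<max (v i) c}) {..<n}"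
        using disj by (fastforce simp: disjoint_family_on_def max_def split: if_splits)
      have "(\<Sum>i<n. max (v i) c - max (u i) c) \<le> (\<Sum>i<n. v i - u i)"
        using uv(1) by (intro sum_mono) (force simp: max_def)
      with len show "(\<Sum>i<n. max (v i) c - max (u i) c) < d2" by simp
    qed
    moreover have "(\<Sum>i<n. norm (f (v i) - f (u i))) \<le>
        (\<Sum>i<n. norm (f (min (v i) c) - f (min (u i) c)) + norm (f (max (v i) c) - f (max (u i) c)))"
    proof (rule sum_mono)
      fix i
      \<comment> \<open>Clamping at c splits every interval without a case distinction on the straddling ones.\<close>
      have "f (v i) - f (u i) = (f (min (v i) c) - f (min (u i) c)) + (f (max (v i) c) - f (max (u i) c))"
        by (auto simp: min_def max_def)
      then show "norm (f (v i) - f (u i)) \<le>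
          norm (f (min (v i) c) - f (min (u i) c)) + norm (f (max (v i) c) - f (max (u i) c))"
        by (metis norm_triangle_ineq)
    qed
    ultimately show "(\<Sum>i<n. norm (f (v i) - f (u i))) < e" by (simp add: sum.distrib)
  qed
qed

lemma absolutely_continuous_on_shift:
  assumes ac: "absolutely_continuous_on {a..b} f"
  shows "absolutely_continuous_on {a + c..b + c} (\<lambda>t. f (t - c))"
  unfolding absolutely_continuous_on_def
proof (intro allI impI)
  fix e :: real assume "e > 0"
  obtain d where "d > 0" and d: "\<And>(n::nat) u v. (\<forall>i<n. u i \<le> v i \<and> {u i..v i} \<subseteq> {a..b}) \<and>
        disjoint_family_on (\<lambda>i. {u i<..<v i}) {..<n} \<and> (\<Sum>i<n. v i - u i) < d \<Longrightarrow>
        (\<Sum>i<n. norm (f (v i) - f (u i))) < e"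
    using ac \<open>e > 0\<close> unfolding absolutely_continuous_on_def by meson
  show "\<exists>d>0. \<forall>(n::nat) u v. (\<forall>i<n. u i \<le> v i \<and> {u i..v i} \<subseteq> {a + c..b + c}) \<and>
        disjoint_family_on (\<lambda>i. {u i<..<v i}) {..<n} \<and> (\<Sum>i<n. v i - u i) < d \<longrightarrow>
        (\<Sum>i<n. norm (f (v i - c) - f (u i - c))) < e"
  proof (intro exI[of _ d] conjI allI impI \<open>d > 0\<close>)
    fix n :: nat and u v
    assume *: "(\<forall>i<n. u i \<le> v i \<and> {u i..v i} \<subseteq> {a + c..b + c}) \<and>
        disjoint_family_on (\<lambda>i. {u i<..<v i}) {..<n} \<and> (\<Sum>i<n. v i - u i) < d"
    show "(\<Sum>i<n. norm (f (v i - c) - f (u i - c))) < e"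
    proof (rule d, intro conjI)
      show "\<forall>i<n. u i - c \<le> v i - c \<and> {u i - c..v i - c} \<subseteq> {a..b}" using * by auto
      have "{u i - c<..<v i - c} \<inter> {u j - c<..<v j - c} = {}"
        if "{u i<..<v i} \<inter> {u j<..<v j} = {}" for i j
      proof -
        have "t + c \<in> {u i<..<v i} \<inter> {u j<..<v j}" if "t \<in> {u i - c<..<v i - c} \<inter> {u j - c<..<v j - c}" for t
          using that by auto
        with that show ?thesis by blast
      qed
      then show "disjoint_family_on (\<lambda>i. {u i - c<..<v i - c}) {..<n}"
        using * unfolding disjoint_family_on_def by blast
    qed (use * in simp)
  qed
qed

text \<open>Arcs are total functions, so values off the domain must be shown not to matter;
  derivatives are taken within the slice and hence transfer.\<close>

lemma solution_cong:
  assumes sol: "solution H E x" and eq: "\<And>p. p \<in> E \<Longrightarrow> x p = x' p"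
  shows "solution H E x'"
proof -
  have sl: "t \<in> time_slice E j \<Longrightarrow> x (t, j) = x' (t, j)" for t j
    using eq by (simp add: time_slice_def)
  have vd: "((\<lambda>s. x' (s, j)) has_vector_derivative v) (at t within time_slice E j)"
    if "t \<in> time_slice E j" "((\<lambda>s. x (s, j)) has_vector_derivative v) (at t within time_slice E j)" for v t j
    by (rule has_vector_derivative_transform[OF that(1) _ that(2)]) (simp add: sl)
  show ?thesis
    unfolding solution_def hybrid_arc_def
  proof (intro conjI allI impI ballI)
    show "hybrid_time_domain E" using sol by (simp add: solution_def hybrid_arc_def)
    fix j
    show "locally_absolutely_continuous_on (time_slice E j) (\<lambda>t. x' (t, j))"
      unfolding locally_absolutely_continuous_on_def
    proof (intro allI impI)
      fix a b assume ab: "{a..b} \<subseteq> time_slice E j"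
      then have "absolutely_continuous_on {a..b} (\<lambda>t. x (t, j))"
        using sol by (simp add: solution_def hybrid_arc_def locally_absolutely_continuous_on_def)
      then show "absolutely_continuous_on {a..b} (\<lambda>t. x' (t, j))"
        by (subst absolutely_continuous_on_cong[where g = "\<lambda>t. x (t, j)"]) (use ab sl in auto)
    qed
    assume ne: "interior (time_slice E j) \<noteq> {}"
    then have "AE t in lebesgue. t \<in> time_slice E j \<longrightarrow> (\<exists>v\<in>flow_map H (x (t, j)).
              ((\<lambda>s. x (s, j)) has_vector_derivative v) (at t within time_slice E j))"
      using sol by (simp add: solution_def)
    then show "AE t in lebesgue. t \<in> time_slice E j \<longrightarrow> (\<exists>v\<in>flow_map H (x' (t, j)).
              ((\<lambda>s. x' (s, j)) has_vector_derivative v) (at t within time_slice E j))"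
      by (rule eventually_mono) (use sl vd in metis)
    fix t assume "t \<in> time_slice E j" "\<exists>s\<in>time_slice E j. t < s"
    moreover from this have "x (t, j) \<in> flow_set H" using sol ne unfolding solution_def by blast
    ultimately show "x' (t, j) \<in> flow_set H" using sl by metis
  next
    fix t j assume "(t, j) \<in> E \<and> (t, Suc j) \<in> E"
    then show "x' (t, j) \<in> jump_set H" "x' (t, Suc j) \<in> jump_map H (x' (t, j))"
      using sol eq unfolding solution_def by metis+
  qed
qed

text \<open>Two distinct times in a slice replace its nonempty interior as the condition for flow.
  Being a condition on points, it survives unions of chains.\<close>

lemma solutionD:
  assumes "solution H E x"
  shows "hybrid_interval E"
    "\<And>a b j. {a..b} \<subseteq> time_slice E j \<Longrightarrow> absolutely_continuous_on {a..b} (\<lambda>t. x (t, j))"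
    "\<And>s t j. (s, j) \<in> E \<Longrightarrow> (t, j) \<in> E \<Longrightarrow> s < t \<Longrightarrow> x (s, j) \<in> flow_set H"
    "\<And>s t j. (s, j) \<in> E \<Longrightarrow> (t, j) \<in> E \<Longrightarrow> s < t \<Longrightarrow>
       AE t in lebesgue. t \<in> time_slice E j \<longrightarrow> (\<exists>v\<in>flow_map H (x (t, j)).
              ((\<lambda>s. x (s, j)) has_vector_derivative v) (at t within time_slice E j))"
    "\<And>t j. (t, j) \<in> E \<Longrightarrow> (t, Suc j) \<in> E \<Longrightarrow> x (t, j) \<in> jump_set H"
    "\<And>t j. (t, j) \<in> E \<Longrightarrow> (t, Suc j) \<in> E \<Longrightarrow> x (t, Suc j) \<in> jump_map H (x (t, j))"
proof -
  show E: "hybrid_interval E"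
    using assms by (simp add: solution_def hybrid_arc_def hybrid_time_domain_iff)
  fix j
  show "absolutely_continuous_on {a..b} (\<lambda>t. x (t, j))" if "{a..b} \<subseteq> time_slice E j" for a b
    using assms that by (simp add: solution_def hybrid_arc_def locally_absolutely_continuous_on_def)
  have ne: "interior (time_slice E j) \<noteq> {}" if st: "(s, j) \<in> E" "(t, j) \<in> E" "s < t" for s t
  proof -
    have "{s..t} \<subseteq> time_slice E j"
      using hybrid_intervalD(3)[OF E st(1,2)] by (auto simp: time_slice_def)
    from interior_mono[OF this] show ?thesis using \<open>s < t\<close> by auto
  qed
  show "x (s, j) \<in> flow_set H" if st: "(s, j) \<in> E" "(t, j) \<in> E" "s < t" for s t
    using assms ne[OF st] st unfolding solution_def time_slice_def by blast
  show "AE t in lebesgue. t \<in> time_slice E j \<longrightarrow> (\<exists>v\<in>flow_map H (x (t, j)).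
              ((\<lambda>s. x (s, j)) has_vector_derivative v) (at t within time_slice E j))"
    if st: "(s, j) \<in> E" "(t, j) \<in> E" "s < t" for s t
    using assms ne[OF st] unfolding solution_def by blast
  show "x (t, j) \<in> jump_set H" "x (t, Suc j) \<in> jump_map H (x (t, j))"
    if "(t, j) \<in> E" "(t, Suc j) \<in> E" for t using assms that unfolding solution_def by blast+
qed

lemma interior_time_slice_nonemptyD:
  assumes "interior (time_slice E j) \<noteq> {}"
  obtains s t where "(s, j) \<in> E" "(t, j) \<in> E" "s < t"
proof -
  from assms obtain s where "s \<in> interior (time_slice E j)" by blast
  then obtain e where e: "e > 0" "ball s e \<subseteq> time_slice E j" by (meson mem_interior)
  then have "s \<in> ball s e" "s + e / 2 \<in> ball s e" by (auto simp: dist_real_def)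
  with e show ?thesis by (intro that[of s "s + e / 2"]) (auto simp: time_slice_def subset_iff)
qed

lemma solutionI:
  assumes E: "hybrid_interval E"
    and ac: "\<And>a b j. a \<le> b \<Longrightarrow> (a, j) \<in> E \<Longrightarrow> (b, j) \<in> E \<Longrightarrow> absolutely_continuous_on {a..b} (\<lambda>t. x (t, j))"
    and fl: "\<And>s t j. (s, j) \<in> E \<Longrightarrow> (t, j) \<in> E \<Longrightarrow> s < t \<Longrightarrow> x (s, j) \<in> flow_set H"
    and ae: "\<And>s t j. (s, j) \<in> E \<Longrightarrow> (t, j) \<in> E \<Longrightarrow> s < t \<Longrightarrow>
       AE t in lebesgue. t \<in> time_slice E j \<longrightarrow> (\<exists>v\<in>flow_map H (x (t, j)).
              ((\<lambda>s. x (s, j)) has_vector_derivative v) (at t within time_slice E j))"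
    and ju: "\<And>t j. (t, j) \<in> E \<Longrightarrow> (t, Suc j) \<in> E \<Longrightarrow> x (t, j) \<in> jump_set H \<and> x (t, Suc j) \<in> jump_map H (x (t, j))"
  shows "solution H E x"
  unfolding solution_def hybrid_arc_def hybrid_time_domain_iff
proof (intro conjI allI impI ballI)
  show "hybrid_interval E" by fact
  fix j
  show "locally_absolutely_continuous_on (time_slice E j) (\<lambda>t. x (t, j))"
    unfolding locally_absolutely_continuous_on_def
  proof (intro allI impI)
    fix a b assume ab: "{a..b} \<subseteq> time_slice E j"
    show "absolutely_continuous_on {a..b} (\<lambda>t. x (t, j))"
    proof (cases "a \<le> b")
      case True
      then have "a \<in> {a..b}" "b \<in> {a..b}" by auto
      with ab have "(a, j) \<in> E" "(b, j) \<in> E" by (auto simp: time_slice_def)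
      with True show ?thesis by (rule ac)
    next
      case False
      then show ?thesis by (intro absolutely_continuous_on_degenerate) simp
    qed
  qed
  assume "interior (time_slice E j) \<noteq> {}"
  then obtain s t where "(s, j) \<in> E" "(t, j) \<in> E" "s < t" by (rule interior_time_slice_nonemptyD)
  then show "AE t in lebesgue. t \<in> time_slice E j \<longrightarrow> (\<exists>v\<in>flow_map H (x (t, j)).
              ((\<lambda>s. x (s, j)) has_vector_derivative v) (at t within time_slice E j))" by (rule ae)
  fix t assume "t \<in> time_slice E j" "\<exists>s\<in>time_slice E j. t < s"
  then show "x (t, j) \<in> flow_set H" using fl unfolding time_slice_def by blast
qed (use ju in blast)+

text \<open>Enlarging a domain can add only later times to a level already reached: the level begins
  at 0 or at the switching time from the previous one, which is already present.\<close>

lemma hybrid_interval_initial_segment: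
  assumes E: "hybrid_interval E" and E': "hybrid_interval E'" and "E \<subseteq> E'"
    and "(q, j) \<in> E" "(t, j) \<in> E'" "t \<le> q"
  shows "(t, j) \<in> E"
proof -
  have "\<exists>s. (s, j) \<in> E \<and> s \<le> t"
  proof (cases j)
    case 0
    then show ?thesis using hybrid_intervalD(1)[OF E] hybrid_intervalD(2)[OF E' assms(5)] by blast
  next
    case (Suc i)
    then obtain s where s: "(s, i) \<in> E" "(s, Suc i) \<in> E" using hybrid_intervalD(5)[OF E] assms(4) by blast
    then have "s \<le> t" using hybrid_intervalD(4)[OF E', of s i t j] assms Suc by blast
    with s Suc show ?thesis by blast
  qed
  then show ?thesis using hybrid_intervalD(3)[OF E] assms by blast
qed

lemma hybrid_interval_chain_Union:
  assumes "\<C> \<noteq> {}" and int: "\<And>E. E \<in> \<C> \<Longrightarrow> hybrid_interval E"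
    and chain: "\<And>E E'. E \<in> \<C> \<Longrightarrow> E' \<in> \<C> \<Longrightarrow> E \<subseteq> E' \<or> E' \<subseteq> E"
  shows "hybrid_interval (\<Union>\<C>)"
proof -
  have two: "\<exists>E\<in>\<C>. p \<in> E \<and> q \<in> E" if "p \<in> \<Union>\<C>" "q \<in> \<Union>\<C>" for p q
    using that chain by blast
  show ?thesis
    unfolding hybrid_interval_def
  proof (intro conjI allI impI)
    show "(0, 0) \<in> \<Union>\<C>" using \<open>\<C> \<noteq> {}\<close> hybrid_intervalD(1)[OF int] by blast
    fix s t u :: real and j k :: nat
    show "0 \<le> t" if "(t, j) \<in> \<Union>\<C>" using that hybrid_intervalD(2)[OF int] by blast
    show "(t, j) \<in> \<Union>\<C>" if "(s, j) \<in> \<Union>\<C> \<and> (u, j) \<in> \<Union>\<C> \<and> s \<le> t \<and> t \<le> u"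
      using two[of "(s, j)" "(u, j)"] hybrid_intervalD(3)[OF int] that by blast
    show "t \<le> s" if "(t, j) \<in> \<Union>\<C> \<and> (s, k) \<in> \<Union>\<C> \<and> j < k"
      using two[of "(t, j)" "(s, k)"] hybrid_intervalD(4)[OF int] that by blast
    show "\<exists>s. (s, j) \<in> \<Union>\<C> \<and> (s, Suc j) \<in> \<Union>\<C>" if "(t, Suc j) \<in> \<Union>\<C>"
      using hybrid_intervalD(5)[OF int] that by blast
  qed
qed

text \<open>All members share the function \<open>x\<close>, so only the domain grows. Every clause
  but the almost everywhere one concerns two points, and some member contains both.\<close>

lemma solution_chain_Union:
  assumes "\<C> \<noteq> {}" and sol: "\<And>E. E \<in> \<C> \<Longrightarrow> solution H E x"
    and chain: "\<And>E E'. E \<in> \<C> \<Longrightarrow> E' \<in> \<C> \<Longrightarrow> E \<subseteq> E' \<or> E' \<subseteq> E"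
  shows "solution H (\<Union>\<C>) x"
proof -
  have two: "\<exists>E\<in>\<C>. p \<in> E \<and> q \<in> E" if "p \<in> \<Union>\<C>" "q \<in> \<Union>\<C>" for p q
    using that chain by blast
  have U: "hybrid_interval (\<Union>\<C>)"
    using assms by (intro hybrid_interval_chain_Union solutionD(1))
  show ?thesis
  proof (rule solutionI[OF U])
    fix a b j assume ab: "a \<le> b" "(a, j) \<in> \<Union>\<C>" "(b, j) \<in> \<Union>\<C>"
    then obtain E where E: "E \<in> \<C>" "(a, j) \<in> E" "(b, j) \<in> E" using two by blast
    then show "absolutely_continuous_on {a..b} (\<lambda>t. x (t, j))"
      using hybrid_intervalD(3)[OF solutionD(1)[OF sol[OF E(1)]] E(2,3)]
      by (intro solutionD(2)[OF sol[OF E(1)]]) (auto simp: time_slice_def)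
  next
    fix s t j assume "(s, j) \<in> \<Union>\<C>" "(t, j) \<in> \<Union>\<C>" "s < t"
    then show "x (s, j) \<in> flow_set H" using two[of "(s, j)" "(t, j)"] solutionD(3)[OF sol] by blast
  next
    fix t j assume "(t, j) \<in> \<Union>\<C>" "(t, Suc j) \<in> \<Union>\<C>"
    then show "x (t, j) \<in> jump_set H \<and> x (t, Suc j) \<in> jump_map H (x (t, j))"
      using two[of "(t, j)" "(t, Suc j)"] solutionD(5,6)[OF sol] by blast
  next
    fix j :: nat
    let ?S = "time_slice (\<Union>\<C>) j"
    \<comment> \<open>The chain may be uncountable, but members reaching the rational times already cover
      every time of the slice except possibly its maximum.\<close>
    define EQ where "EQ q = (SOME E. E \<in> \<C> \<and> (q, j) \<in> E)" for q
    have EQ: "EQ q \<in> \<C> \<and> (q, j) \<in> EQ q" if "(q, j) \<in> \<Union>\<C>" for q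
      unfolding EQ_def by (rule someI_ex) (use that in blast)
    have seg: "(t, j) \<in> EQ q" if "(q, j) \<in> \<Union>\<C>" "(t, j) \<in> \<Union>\<C>" "t \<le> q" for q t
    proof (rule hybrid_interval_initial_segment[OF _ U])
      show "hybrid_interval (EQ q)" using EQ[OF that(1)] solutionD(1)[OF sol] by blast
      show "EQ q \<subseteq> \<Union>\<C>" using EQ[OF that(1)] by blast
    qed (use EQ that in auto)
    have "AE t in lebesgue. \<forall>q\<in>{q\<in>\<rat>. (q, j) \<in> \<Union>\<C>}. (\<exists>s. (s, j) \<in> EQ q \<and> s < q) \<longrightarrow>
       t \<in> time_slice (EQ q) j \<longrightarrow> (\<exists>v\<in>flow_map H (x (t, j)).
              ((\<lambda>s. x (s, j)) has_vector_derivative v) (at t within time_slice (EQ q) j))"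
      (is "AE t in lebesgue. \<forall>q\<in>?Q. ?P q t")
    proof (subst AE_ball_countable)
      show "countable ?Q" by (rule countable_subset[OF _ countable_rat]) auto
      show "\<forall>q\<in>?Q. AE t in lebesgue. ?P q t"
      proof
        fix q assume "q \<in> ?Q"
        then have q: "EQ q \<in> \<C>" "(q, j) \<in> EQ q" using EQ by auto
        show "AE t in lebesgue. ?P q t"
        proof (cases "\<exists>s. (s, j) \<in> EQ q \<and> s < q")
          case True
          then obtain s where "(s, j) \<in> EQ q" "s < q" by blast
          from solutionD(4)[OF sol[OF q(1)] this(1) q(2) this(2)] show ?thesis by (rule eventually_mono) blast
        next
          case False
          then show ?thesis by (intro AE_I2) blast
        qed
      qed
    qed
    \<comment> \<open>No rational time of the slice lies beyond its maximum, so the maximum is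
      discarded as a single point.\<close>
    moreover have "AE t in lebesgue. \<not> (t \<in> ?S \<and> (\<forall>s\<in>?S. s \<le> t))"
      unfolding AE_lebesgue_iff_negligible not_not
    proof (rule negligible_subset)
      show "negligible {Sup ?S}" by simp
      show "{t. t \<in> ?S \<and> (\<forall>s\<in>?S. s \<le> t)} \<subseteq> {Sup ?S}"
        by (auto intro!: cSup_eq_maximum[symmetric])
    qed
    ultimately show "AE t in lebesgue. t \<in> ?S \<longrightarrow> (\<exists>v\<in>flow_map H (x (t, j)).
              ((\<lambda>s. x (s, j)) has_vector_derivative v) (at t within ?S))"
    proof eventually_elim
      fix t assume P: "\<forall>q\<in>?Q. ?P q t" and nmax: "\<not> (t \<in> ?S \<and> (\<forall>s\<in>?S. s \<le> t))"
      show "t \<in> ?S \<longrightarrow> (\<exists>v\<in>flow_map H (x (t, j)).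
              ((\<lambda>s. x (s, j)) has_vector_derivative v) (at t within ?S))"
      proof
        assume t: "t \<in> ?S"
        with nmax obtain u where u: "u \<in> ?S" "t < u" by force
        obtain q where q: "q \<in> \<rat>" "t < q" "q < u" using Rats_dense_in_real[OF u(2)] by blast
        have tU: "(t, j) \<in> \<Union>\<C>" and uU: "(u, j) \<in> \<Union>\<C>" using t u by (simp_all add: time_slice_def)
        have qU: "(q, j) \<in> \<Union>\<C>" using hybrid_intervalD(3)[OF U tU uU] q by simp
        have tq: "(t, j) \<in> EQ q" using seg[OF qU tU] q by simp
        have "?P q t" using P q(1) qU by blast
        moreover have "\<exists>s. (s, j) \<in> EQ q \<and> s < q" using tq q by blast
        moreover have "t \<in> time_slice (EQ q) j" using tq by (simp add: time_slice_def)
        ultimately obtain v where v: "v \<in> flow_map H (x (t, j))"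
          "((\<lambda>s. x (s, j)) has_vector_derivative v) (at t within time_slice (EQ q) j)" by blast
        \<comment> \<open>To the left of \<open>q\<close> the two slices coincide, and q > t, so
          derivatives at \<open>t\<close> within them are the same.\<close>
        have "at t within time_slice (EQ q) j = at t within ?S"
        proof (rule at_within_nhd)
          show "t \<in> {..<q}" "open {..<q}" using q by auto
          show "time_slice (EQ q) j \<inter> {..<q} - {t} = ?S \<inter> {..<q} - {t}"
          proof -
            have "(s, j) \<in> EQ q \<longleftrightarrow> (s, j) \<in> \<Union>\<C>" if "s < q" for s
              using seg[OF qU, of s] EQ[OF qU] that by (meson UnionI less_imp_le)
            then show ?thesis unfolding time_slice_def by blast
          qed
        qed
        with v show "\<exists>v\<in>flow_map H (x (t, j)).
              ((\<lambda>s. x (s, j)) has_vector_derivative v) (at t within ?S)" by auto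
      qed
    qed
  qed
qed

text \<open>Zorn's lemma is applied to graphs over the domain rather than to pairs of domain and
  total function: inclusion of graphs is exactly extension, and values off the domain
  disappear.\<close>

lemma solution_extends_to_maximal:
  assumes sol0: "solution H E0 x0"
  obtains E x where "maximal_solution H E x" "E0 \<subseteq> E" "\<And>p. p \<in> E0 \<Longrightarrow> x p = x0 p"
proof -
  define graph where "graph E x = (\<lambda>p. (p, x p)) ` E" for E :: "(real \<times> nat) set" and x :: "real \<times> nat \<Rightarrow> 'a"
  define \<G> where "\<G> = {graph E x | E x. solution H E x \<and> E0 \<subseteq> E \<and> (\<forall>p\<in>E0. x p = x0 p)}"
  have fst_graph: "fst ` graph E x = E" for E x by (force simp: graph_def)
  have graph_iff: "(p, y) \<in> graph E x \<longleftrightarrow> p \<in> E \<and> y = x p" for p y E x by (auto simp: graph_def)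
  have "\<exists>M\<in>\<G>. \<forall>X\<in>\<G>. M \<subseteq> X \<longrightarrow> X = M"
  proof (rule subset_Zorn_nonempty)
    show "\<G> \<noteq> {}" using sol0 by (auto simp: \<G>_def)
    fix \<C> assume "\<C> \<noteq> {}" and ch: "subset.chain \<G> \<C>"
    have chain: "A \<subseteq> B \<or> B \<subseteq> A" if "A \<in> \<C>" "B \<in> \<C>" for A B
      using ch that by (auto simp: subset_chain_def)
    have sub: "\<exists>E x. A = graph E x \<and> solution H E x \<and> E0 \<subseteq> E \<and> (\<forall>p\<in>E0. x p = x0 p)" if "A \<in> \<C>" for A
      using ch that by (auto simp: subset_chain_def \<G>_def)
    have fn: "y = y'" if yy: "(p, y) \<in> \<Union>\<C>" "(p, y') \<in> \<Union>\<C>" for p y y'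
    proof -
      obtain A where A: "A \<in> \<C>" "(p, y) \<in> A" "(p, y') \<in> A" using yy chain by blast
      with sub[OF A(1)] graph_iff show ?thesis by metis
    qed
    define x where "x p = (SOME y. (p, y) \<in> \<Union>\<C>)" for p
    have x: "x p = y" if "(p, y) \<in> \<Union>\<C>" for p y
      using fn[OF _ that] someI[of "\<lambda>y. (p, y) \<in> \<Union>\<C>", OF that] by (simp add: x_def)
    have sol: "solution H (fst ` A) x \<and> E0 \<subseteq> fst ` A \<and> (\<forall>p\<in>E0. x p = x0 p)" if A: "A \<in> \<C>" for A
    proof -
      obtain E x' where E: "A = graph E x'" "solution H E x'" "E0 \<subseteq> E" "\<forall>p\<in>E0. x' p = x0 p"
        using sub[OF A] by blast
      have eq: "x p = x' p" if "p \<in> E" for p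
        by (rule x) (use \<open>A \<in> \<C>\<close> E(1) graph_iff that in blast)
      then have "solution H E x" using E(2) by (metis solution_cong)
      then show ?thesis using E eq by (auto simp: fst_graph)
    qed
    have "solution H (\<Union>((`) fst ` \<C>)) x"
    proof (rule solution_chain_Union)
      show "(`) fst ` \<C> \<noteq> {}" using \<open>\<C> \<noteq> {}\<close> by simp
      show "solution H E x" if "E \<in> (`) fst ` \<C>" for E using sol that by auto
      show "E \<subseteq> E' \<or> E' \<subseteq> E" if EE: "E \<in> (`) fst ` \<C>" "E' \<in> (`) fst ` \<C>" for E E'
      proof -
        obtain A B where "A \<in> \<C>" "B \<in> \<C>" "E = fst ` A" "E' = fst ` B" using EE by blast
        with chain[of A B] show ?thesis by blast
      qed
    qed
    moreover have "\<Union>((`) fst ` \<C>) = fst ` \<Union>\<C>" by blast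
    moreover have "\<Union>\<C> = graph (fst ` \<Union>\<C>) x"
    proof (intro set_eqI iffI)
      fix r assume "r \<in> \<Union>\<C>"
      then show "r \<in> graph (fst ` \<Union>\<C>) x" using x by (cases r) (force simp: graph_iff)
    next
      fix r assume "r \<in> graph (fst ` \<Union>\<C>) x"
      then obtain p y where "r = (p, x p)" "(p, y) \<in> \<Union>\<C>" by (force simp: graph_def)
      then show "r \<in> \<Union>\<C>" using x by metis
    qed
    moreover have "E0 \<subseteq> fst ` \<Union>\<C>" "\<forall>p\<in>E0. x p = x0 p" using sol \<open>\<C> \<noteq> {}\<close> by blast+
    ultimately show "\<Union>\<C> \<in> \<G>" unfolding \<G>_def mem_Collect_eq
      by (intro exI[of _ "fst ` \<Union>\<C>"] exI[of _ x]) simp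
  qed
  then obtain M where M: "M \<in> \<G>" "\<And>X. X \<in> \<G> \<Longrightarrow> M \<subseteq> X \<Longrightarrow> X = M" by blast
  then obtain E x where E: "M = graph E x" "solution H E x" "E0 \<subseteq> E" "\<forall>p\<in>E0. x p = x0 p"
    by (auto simp: \<G>_def)
  have "maximal_solution H E x"
    unfolding maximal_solution_def
  proof (intro conjI E notI, elim exE conjE)
    fix E' x' assume E': "solution H E' x'" "E \<subset> E'" "\<forall>p\<in>E. x' p = x p"
    have "E0 \<subseteq> E'" "\<forall>p\<in>E0. x' p = x0 p" using E E' by (blast, metis subsetD)
    then have "graph E' x' \<in> \<G>" using E'(1) unfolding \<G>_def by blast
    moreover have "M \<subseteq> graph E' x'" using E(1) E' by (auto simp: graph_def)
    ultimately have "graph E' x' = M" using M(2) by blast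
    then have "fst ` graph E' x' = fst ` graph E x" using E(1) by simp
    then show False using E'(2) unfolding fst_graph by simp
  qed
  then show ?thesis using E(3,4) by (intro that[of E x]) auto
qed

section \<open>Concatenation of solutions\<close>

text \<open>Arcs are continued at an attained end, which half-open or unbounded domains
  lack.\<close>

definition last_point :: "(real \<times> nat) set \<Rightarrow> real \<Rightarrow> nat \<Rightarrow> bool" where
  "last_point E t j \<longleftrightarrow> (t, j) \<in> E \<and> (\<forall>(s, k)\<in>E. s \<le> t \<and> k \<le> j)"

lemma last_pointD:
  assumes "last_point E t j"
  shows "(t, j) \<in> E" "\<And>s k. (s, k) \<in> E \<Longrightarrow> s \<le> t" "\<And>s k. (s, k) \<in> E \<Longrightarrow> k \<le> j"
  using assms by (auto simp: last_point_def)

lemma hybrid_interval_append_flow: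
  assumes E: "hybrid_interval E" and last: "last_point E t j" and "0 \<le> \<tau>"
  shows "hybrid_interval (E \<union> {t..t + \<tau>} \<times> {j})"
proof -
  note E = hybrid_intervalD[OF E] and l = last_pointD[OF last]
  show ?thesis
    unfolding hybrid_interval_def
  proof (intro conjI allI impI)
    show "(0, 0) \<in> E \<union> {t..t + \<tau>} \<times> {j}" using E(1) by simp
    fix s u v :: real and k i :: nat
    show "0 \<le> s" if "(s, k) \<in> E \<union> {t..t + \<tau>} \<times> {j}" using that E(2) E(2)[OF l(1)] by auto
    show "s \<le> u" if "(s, k) \<in> E \<union> {t..t + \<tau>} \<times> {j} \<and> (u, i) \<in> E \<union> {t..t + \<tau>} \<times> {j} \<and> k < i"
    proof -
      have "k < j" using that l(3)[of u i] by auto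
      then have "(s, k) \<in> E" using that by auto
      then show ?thesis using that E(4)[of s k u i] l(2)[of s k] by auto
    qed
    show "\<exists>s. (s, k) \<in> E \<union> {t..t + \<tau>} \<times> {j} \<and> (s, Suc k) \<in> E \<union> {t..t + \<tau>} \<times> {j}"
      if "(s, Suc k) \<in> E \<union> {t..t + \<tau>} \<times> {j}"
    proof -
      have "(s, Suc k) \<in> E \<or> (t, Suc k) \<in> E" using that l(1) by auto
      then show ?thesis using E(5) by blast
    qed
    show "(u, k) \<in> E \<union> {t..t + \<tau>} \<times> {j}"
      if "(s, k) \<in> E \<union> {t..t + \<tau>} \<times> {j} \<and> (v, k) \<in> E \<union> {t..t + \<tau>} \<times> {j} \<and> s \<le> u \<and> u \<le> v"
    proof (cases "k = j")
      case True
      then show ?thesis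
        using that E(3)[of s j v u] E(3)[of s j t u] l(1) l(2)[of v j] l(2)[of s j]
        by (cases "u \<le> t") auto
    next
      case False
      then show ?thesis using that E(3) by blast
    qed
  qed
qed

text \<open>The appended flow may merge with a flow already running on level \<open>j\<close> into a
  single slice. Hence absolute continuity is joined at \<open>t\<close>, and \<open>t\<close> itself
  goes into the exceptional null set, since the one-sided derivatives there may differ.\<close>

lemma solution_append_flow:
  assumes sol: "solution H E x" and last: "last_point E t j"
    and w: "flow_arc H \<tau> w" and w0: "w 0 = x (t, j)"
  obtains E' x' where "solution H E' x'" "E \<subseteq> E'" "\<And>p. p \<in> E \<Longrightarrow> x' p = x p"
    "last_point E' (t + \<tau>) j" "x' (t + \<tau>, j) = w \<tau>"
proof (cases "\<tau> = 0")
  case True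
  then show ?thesis using that[of E x] sol last w0 by simp
next
  case False
  with w have "\<tau> > 0" by (simp add: flow_arc_def)
  \<comment> \<open>Old values take precedence on \<open>E\<close>; at the common point (t, j) both
    agree by \<open>w0\<close>.\<close>
  define x' where "x' p = (if p \<in> E then x p else w (fst p - t))" for p
  define E' where "E' = E \<union> {t..t + \<tau>} \<times> {j}"
  note l = last_pointD[OF last]
  have sol': "solution H E x'" using sol by (rule solution_cong) (simp add: x'_def)
  have E: "hybrid_interval E" using sol by (rule solutionD(1))
  have E'int: "hybrid_interval E'" unfolding E'_def using E last \<open>\<tau> > 0\<close> by (intro hybrid_interval_append_flow) auto
  have new: "x' (s, j) = w (s - t)" if "t \<le> s" for s
    using that l(2)[of s j] w0 by (auto simp: x'_def)
  have inE: "(s, k) \<in> E" if "(s, k) \<in> E'" "s \<le> t \<or> k \<noteq> j" for s k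
    using that l(1) by (auto simp: E'_def)
  have slice: "time_slice E' k = time_slice E k" if "k \<noteq> j" for k
    using that by (auto simp: E'_def time_slice_def)
  have wC: "w s \<in> flow_set H" if "0 \<le> s" "s < \<tau>" for s using w that by (simp add: flow_arc_def)
  have "solution H E' x'"
  proof (rule solutionI[OF E'int])
    fix a b k assume ab: "a \<le> b" "(a, k) \<in> E'" "(b, k) \<in> E'"
    have old: "absolutely_continuous_on {c..d} (\<lambda>s. x' (s, k))" if "(c, k) \<in> E" "(d, k) \<in> E" for c d
      using hybrid_intervalD(3)[OF E that] by (intro solutionD(2)[OF sol']) (auto simp: time_slice_def)
    have "absolutely_continuous_on {0 + t..\<tau> + t} (\<lambda>s. w (s - t))"
      using w by (intro absolutely_continuous_on_shift) (simp add: flow_arc_def)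
    then have "absolutely_continuous_on {t..t + \<tau>} (\<lambda>s. x' (s, j))"
      by (subst absolutely_continuous_on_cong[where g = "\<lambda>s. w (s - t)"]) (auto simp: new add.commute)
    then have nw: "absolutely_continuous_on {c..d} (\<lambda>s. x' (s, j))" if "t \<le> c" "d \<le> t + \<tau>" for c d
      by (rule absolutely_continuous_on_subset) (use that in auto)
    consider "(b, k) \<in> E" | "(b, k) \<notin> E" "k = j" "t \<le> b" "b \<le> t + \<tau>" using ab(3) by (auto simp: E'_def)
    then show "absolutely_continuous_on {a..b} (\<lambda>s. x' (s, k))"
    proof cases
      case 1
      then have "(a, k) \<in> E" using ab l(2)[of b k] by (intro inE) auto
      with 1 show ?thesis by (intro old)
    next
      case 2
      show ?thesis
      proof (cases "a \<le> t")
        case True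
        then have "(a, j) \<in> E" using ab 2 inE by auto
        then show ?thesis unfolding 2(2) using 2 True old[of a t] l(1) nw[of t b]
          by (intro absolutely_continuous_on_join[of a t _ b]) (auto simp: 2(2))
      next
        case False
        then show ?thesis unfolding 2(2) using 2 by (intro nw) auto
      qed
    qed
  next
    fix s u k assume su: "(s, k) \<in> E'" "(u, k) \<in> E'" "s < u"
    show "x' (s, k) \<in> flow_set H"
    proof (cases "k = j")
      case False
      with su inE show ?thesis using solutionD(3)[OF sol'] by blast
    next
      case True
      show ?thesis
      proof (cases "s < t")
        case s: True
        with True su inE have "(s, j) \<in> E" by auto
        from solutionD(3)[OF sol' this l(1) s] True show ?thesis by simp
      next
        case False
        have "u \<le> t + \<tau>" using su l(2)[of u k] \<open>\<tau> > 0\<close> by (auto simp: E'_def)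
        then show ?thesis using False True su by (auto simp: new intro!: wC)
      qed
    qed
  next
    fix s k assume sk: "(s, k) \<in> E'" "(s, Suc k) \<in> E'"
    have "(s, k) \<in> E \<and> (s, Suc k) \<in> E"
    proof (cases "k = j")
      case True
      then show ?thesis using sk l(3)[of s "Suc k"] by (auto simp: E'_def)
    next
      case False
      then have "(s, k) \<in> E" using sk inE by auto
      then show ?thesis using l(2)[of s k] sk inE by auto
    qed
    then show "x' (s, k) \<in> jump_set H \<and> x' (s, Suc k) \<in> jump_map H (x' (s, k))"
      using solutionD(5,6)[OF sol'] by blast
  next
    fix s u k assume su: "(s, k) \<in> E'" "(u, k) \<in> E'" "s < u"
    show "AE t in lebesgue. t \<in> time_slice E' k \<longrightarrow> (\<exists>v\<in>flow_map H (x' (t, k)).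
              ((\<lambda>s. x' (s, k)) has_vector_derivative v) (at t within time_slice E' k))"
    proof (cases "k = j")
      case False
      then show ?thesis
        unfolding slice[OF False] using su inE by (intro solutionD(4)[OF sol' _ _ su(3)]) auto
    next
      case True
      let ?P = "\<lambda>S r. \<exists>v\<in>flow_map H (x' (r, j)). ((\<lambda>s. x' (s, j)) has_vector_derivative v) (at r within S)"
      \<comment> \<open>Left of \<open>t\<close> the slices of \<open>E\<close> and
        \<open>E'\<close> coincide, so derivatives are inherited; if level \<open>j\<close> has no
        earlier time, there is nothing to show.\<close>
      have "AE r in lebesgue. r < t \<longrightarrow> r \<in> time_slice E' j \<longrightarrow> ?P (time_slice E' j) r"
      proof (cases "\<exists>r. (r, j) \<in> E \<and> r < t")
        case True
        then obtain r where "(r, j) \<in> E" "r < t" by blast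
        from solutionD(4)[OF sol' this(1) l(1) this(2)] show ?thesis
        proof (rule eventually_mono, intro impI)
          fix r assume r: "r \<in> time_slice E j \<longrightarrow> ?P (time_slice E j) r" "r < t" "r \<in> time_slice E' j"
          then have "r \<in> time_slice E j" using inE by (auto simp: time_slice_def)
          moreover have "at r within time_slice E j = at r within time_slice E' j"
          proof (rule at_within_nhd)
            show "r \<in> {..<t}" "open {..<t}" using r by auto
            show "time_slice E j \<inter> {..<t} - {r} = time_slice E' j \<inter> {..<t} - {r}"
              by (auto simp: time_slice_def E'_def)
          qed
          ultimately show "?P (time_slice E' j) r" using r by simp
        qed
      next
        case False
        then have "\<not> (r < t \<and> r \<in> time_slice E' j)" for r
          using inE[of r j] unfolding time_slice_def by force
        then show ?thesis by (intro AE_I2) blast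
      qed
      moreover
      define N where "N = {r\<in>{0<..<\<tau>}. \<not> (\<exists>v\<in>flow_map H (w r). (w has_vector_derivative v) (at r))}"
      have "negligible N" using w by (simp add: flow_arc_def N_def)
      then have "negligible ((+) t ` N \<union> {t, t + \<tau>})"
        by (intro negligible_Un negligible_translation) auto
      then have "AE r in lebesgue. r \<notin> (+) t ` N \<union> {t, t + \<tau>}"
        by (simp add: AE_lebesgue_iff_negligible)
      ultimately show ?thesis
        unfolding True
      proof (eventually_elim, intro impI)
        fix r assume old: "r < t \<longrightarrow> r \<in> time_slice E' j \<longrightarrow> ?P (time_slice E' j) r"
          and r: "r \<notin> (+) t ` N \<union> {t, t + \<tau>}" "r \<in> time_slice E' j"
        show "?P (time_slice E' j) r"
        proof (cases "r < t")
          case True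
          with old r show ?thesis by blast
        next
          case False
          then have rt: "t < r" "r < t + \<tau>" using r l(2)[of r j] by (auto simp: time_slice_def E'_def)
          have "r = t + (r - t)" by simp
          then have "r - t \<notin> N" using r(1) by blast
          then obtain v where v: "v \<in> flow_map H (w (r - t))" "(w has_vector_derivative v) (at (r - t))"
            using rt by (auto simp: N_def)
          have "((\<lambda>s. s - t) has_vector_derivative 1) (at r)"
            by (auto intro!: derivative_eq_intros)
          then have "((w \<circ> (\<lambda>s. s - t)) has_vector_derivative 1 *\<^sub>R v) (at r)"
            by (rule vector_diff_chain_at) (use v(2) in simp)
          then have "((\<lambda>s. w (s - t)) has_vector_derivative v) (at r)" by (simp add: comp_def)
          then have "((\<lambda>s. x' (s, j)) has_vector_derivative v) (at r)"
            by (rule has_vector_derivative_transform_within_open[of _ _ _ "{t<..}"])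
              (use rt in \<open>auto simp: new\<close>)
          then show ?thesis
            using v(1) rt by (intro bexI[of _ v]) (auto simp: new intro: has_vector_derivative_at_within)
        qed
      qed
    qed
  qed
  moreover have "last_point E' (t + \<tau>) j"
    unfolding last_point_def E'_def using l \<open>\<tau> > 0\<close> by fastforce
  moreover have "x' (t + \<tau>, j) = w \<tau>" using \<open>\<tau> > 0\<close> by (simp add: new)
  ultimately show ?thesis
    by (intro that[of E' x']) (auto simp: E'_def x'_def)
qed

text \<open>The new level holds a single time, so it carries no flow condition, and the only new
  jump starts at (t, j).\<close>

lemma solution_append_jump:
  assumes sol: "solution H E x" and last: "last_point E t j"
    and D: "x (t, j) \<in> jump_set H" and q: "q \<in> jump_map H (x (t, j))"
  obtains E' x' where "solution H E' x'" "E \<subseteq> E'" "\<And>p. p \<in> E \<Longrightarrow> x' p = x p"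
    "last_point E' t (Suc j)" "x' (t, Suc j) = q"
proof -
  define x' where "x' = x((t, Suc j) := q)"
  define E' where "E' = insert (t, Suc j) E"
  note l = last_pointD[OF last]
  have nE: "(s, Suc j) \<notin> E" for s using l(3)[of s "Suc j"] by auto
  have xx': "x' p = x p" if "p \<in> E" for p using nE that by (auto simp: x'_def)
  have sol': "solution H E x'" using sol by (rule solution_cong) (simp add: xx')
  note E = hybrid_intervalD[OF solutionD(1)[OF sol]]
  have E': "(s, k) \<in> E' \<longleftrightarrow> (s, k) \<in> E \<or> s = t \<and> k = Suc j" for s k by (auto simp: E'_def)
  have two: "(s, k) \<in> E \<and> (u, k) \<in> E" if "(s, k) \<in> E'" "(u, k) \<in> E'" "s < u" for s u k
    using that nE by (auto simp: E')
  have "hybrid_interval E'"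
    unfolding hybrid_interval_def
  proof (intro conjI allI impI)
    show "(0, 0) \<in> E'" using E(1) by (simp add: E')
    fix s u v :: real and k i :: nat
    show "0 \<le> s" if "(s, k) \<in> E'" using that E(2) E(2)[OF l(1)] by (auto simp: E')
    show "s \<le> u" if "(s, k) \<in> E' \<and> (u, i) \<in> E' \<and> k < i"
      using that E(4)[of s k u i] l(2)[of s k] l(3)[of u i] by (auto simp: E')
    show "\<exists>s. (s, k) \<in> E' \<and> (s, Suc k) \<in> E'" if "(s, Suc k) \<in> E'"
      using that E(5)[of s k] l(1) by (auto simp: E')
    show "(u, k) \<in> E'" if "(s, k) \<in> E' \<and> (v, k) \<in> E' \<and> s \<le> u \<and> u \<le> v"
      using that E(3)[of s k v u] nE by (auto simp: E')
  qed
  then have "solution H E' x'"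
  proof (rule solutionI)
    fix a b k assume ab: "a \<le> b" "(a, k) \<in> E'" "(b, k) \<in> E'"
    show "absolutely_continuous_on {a..b} (\<lambda>t. x' (t, k))"
    proof (cases "a < b")
      case True
      with two ab have *: "(a, k) \<in> E" "(b, k) \<in> E" by blast+
      show ?thesis using E(3)[OF *] by (intro solutionD(2)[OF sol']) (auto simp: time_slice_def)
    next
      case False
      then show ?thesis by (intro absolutely_continuous_on_degenerate) simp
    qed
  next
    fix s u k assume su: "(s, k) \<in> E'" "(u, k) \<in> E'" "s < u"
    then have *: "(s, k) \<in> E" "(u, k) \<in> E" using two by blast+
    show "x' (s, k) \<in> flow_set H" using solutionD(3)[OF sol' * su(3)] .
    have "k \<noteq> Suc j" using nE * by auto
    then have "time_slice E' k = time_slice E k" by (auto simp: time_slice_def E')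
    then show "AE t in lebesgue. t \<in> time_slice E' k \<longrightarrow> (\<exists>v\<in>flow_map H (x' (t, k)).
              ((\<lambda>s. x' (s, k)) has_vector_derivative v) (at t within time_slice E' k))"
      using solutionD(4)[OF sol' * su(3)] by simp
  next
    fix s k assume sk: "(s, k) \<in> E'" "(s, Suc k) \<in> E'"
    show "x' (s, k) \<in> jump_set H \<and> x' (s, Suc k) \<in> jump_map H (x' (s, k))"
    proof (cases "(s, Suc k) \<in> E")
      case True
      then have "k < j" using l(3)[of s "Suc k"] by simp
      then have "(s, k) \<in> E" using sk by (simp add: E')
      with True show ?thesis using solutionD(5,6)[OF sol'] by blast
    next
      case False
      then have "s = t" "k = j" using sk by (auto simp: E')
      then show ?thesis using D q l(1) by (simp add: xx') (simp add: x'_def)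
    qed
  qed
  moreover have "last_point E' t (Suc j)"
    unfolding last_point_def using l by (force simp: E'_def)
  ultimately show ?thesis using xx' by (intro that[of E' x']) (auto simp: E'_def x'_def)
qed

lemma solution_trivial: "solution H {(0, 0)} x"
proof (rule solutionI)
  show "hybrid_interval {(0, 0)}" by (auto simp: hybrid_interval_def)
qed (auto intro: absolutely_continuous_on_degenerate[of 0 0, simplified])

section \<open>Decomposition of solutions into steps\<close>

text \<open>A step is a flow of duration at most 1, followed by a jump if b holds. The flag m demands that
  the step advances hybrid time by at least 1, so that infinite chains of such steps are complete. The
  set A constrains all points of the step except the end point: for the first exit from a ball nothing
  is known about the exit point, and likewise jumps of a restricted system may leave the restricting
  set.\<close>

definition near_step :: "'a::euclidean_space hybrid_system \<Rightarrow> 'a set \<Rightarrow> bool \<Rightarrow> 'a \<Rightarrow> 'a \<Rightarrow> bool" where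
  "near_step H A m p q \<longleftrightarrow> (\<exists>b \<tau> w. flow_arc H \<tau> w \<and> \<tau> \<le> 1 \<and> w 0 = p \<and>
     (\<forall>t\<in>{0..<\<tau>}. w t \<in> A) \<and> (b \<longrightarrow> w \<tau> \<in> jump_set H \<inter> A \<and> q \<in> jump_map H (w \<tau>)) \<and>
     (\<not> b \<longrightarrow> q = w \<tau>) \<and> (m \<longrightarrow> b \<or> \<tau> = 1))"

text \<open>The notion for limits: there the constraint to stay near \<Gamma>2 has been absorbed
  into the restricted system.\<close>

definition step :: "'a::euclidean_space hybrid_system \<Rightarrow> bool \<Rightarrow> 'a \<Rightarrow> 'a \<Rightarrow> bool" where
  "step H m p q \<longleftrightarrow> near_step H UNIV m p q"

section \<open>Limits and boundedness of steps\<close>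

lemma closed_limit_infinitely_often:
  fixes a :: "nat \<Rightarrow> 'a::metric_space"
  assumes "infinite I" "\<And>i. i \<in> I \<Longrightarrow> a i \<in> S" "closed S" "a \<longlonglongrightarrow> l"
  shows "l \<in> S"
proof -
  obtain r :: "nat \<Rightarrow> nat" where r: "strict_mono r" "\<And>n. r n \<in> I"
    using infinite_enumerate[OF \<open>infinite I\<close>] by blast
  show ?thesis
    by (rule closed_sequentially[OF \<open>closed S\<close> _ LIMSEQ_subseq_LIMSEQ[OF \<open>a \<longlonglongrightarrow> l\<close> r(1)]])
      (use r(2) assms(2) in auto)
qed

text \<open>With the kind \<open>b\<close> of the step fixed, every clause is closed: flows by
  compactness, jumps by closedness of the jump set and outer semicontinuity, and membership in
  \<Gamma> because the distances are at most \<eta> i. Without a jump the flag makes all durations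
  1, hence also their limit.\<close>

lemma near_step_limit_fixed_kind:
  fixes H :: "'a::euclidean_space hybrid_system"
  assumes H: "basic_assumptions H" and "compact K" "closed \<Gamma>" "\<Gamma> \<noteq> {}"
    and w: "\<And>i. flow_arc H (\<tau> i) (w i)" and \<tau>1: "\<And>i. \<tau> i \<le> 1" and w0: "\<And>i. w i 0 = p i"
    and A: "\<And>i t. t \<in> {0..<\<tau> i} \<Longrightarrow> w i t \<in> K \<inter> {y. infdist y \<Gamma> \<le> \<eta> i}"
    and jmp: "\<And>i. b \<Longrightarrow> w i (\<tau> i) \<in> jump_set H \<inter> (K \<inter> {y. infdist y \<Gamma> \<le> \<eta> i}) \<and> q i \<in> jump_map H (w i (\<tau> i))"
    and nojmp: "\<And>i. \<not> b \<Longrightarrow> q i = w i (\<tau> i)" and m: "\<And>i. m \<Longrightarrow> b \<or> \<tau> i = 1"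
    and \<eta>: "\<eta> \<longlonglongrightarrow> 0" and p: "p \<longlonglongrightarrow> p'" and q: "q \<longlonglongrightarrow> q'"
  shows "step (restrict_system H \<Gamma>) m p' q'"
proof -
  have p': "(\<lambda>i. w i 0) \<longlonglongrightarrow> p'" using p by (simp add: w0)
  obtain \<sigma> T W where \<sigma>: "strict_mono (\<sigma> :: nat \<Rightarrow> nat)" and T: "(\<lambda>i. \<tau> (\<sigma> i)) \<longlonglongrightarrow> T"
    and WT: "(\<lambda>i. w (\<sigma> i) (\<tau> (\<sigma> i))) \<longlonglongrightarrow> W T" and W0: "W 0 = p'" and W: "flow_arc (restrict_system H \<Gamma>) T W"
    by (rule flow_arc_limit[OF H \<open>compact K\<close> \<open>closed \<Gamma>\<close> \<open>\<Gamma> \<noteq> {}\<close> w \<tau>1 _ _ \<eta> p']) (use A in auto)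
  have q\<sigma>: "(\<lambda>i. q (\<sigma> i)) \<longlonglongrightarrow> q'" using LIMSEQ_subseq_LIMSEQ[OF q \<sigma>] by (simp add: comp_def)
  have \<eta>\<sigma>: "(\<lambda>i. \<eta> (\<sigma> i)) \<longlonglongrightarrow> 0" using LIMSEQ_subseq_LIMSEQ[OF \<eta> \<sigma>] by (simp add: comp_def)
  have "T \<le> 1" by (rule LIMSEQ_le_const2[OF T]) (use \<tau>1 in auto)
  have 1: "W T \<in> jump_set (restrict_system H \<Gamma>) \<inter> UNIV \<and> q' \<in> jump_map (restrict_system H \<Gamma>) (W T)" if b
  proof -
    note j = jmp[OF that]
    have "closed (jump_set H)" using H by (simp add: basic_assumptions_def)
    then have "W T \<in> jump_set H"
      by (rule closed_sequentially[OF _ _ WT]) (use j in auto)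
    moreover have "infdist (W T) \<Gamma> \<le> 0"
      by (rule LIMSEQ_le[OF tendsto_infdist[OF WT] \<eta>\<sigma>]) (use j in auto)
    then have "W T \<in> \<Gamma>" using infdist_nonneg[of "W T" \<Gamma>] in_closed_iff_infdist_zero[OF \<open>closed \<Gamma>\<close> \<open>\<Gamma> \<noteq> {}\<close>] by simp
    moreover have "q' \<in> jump_map H (W T)"
    proof -
      have "outer_semicontinuous (jump_map H)" using H by (simp add: basic_assumptions_def)
      moreover have "\<forall>i. q (\<sigma> i) \<in> jump_map H (w (\<sigma> i) (\<tau> (\<sigma> i)))" using j by blast
      ultimately show ?thesis using WT q\<sigma> unfolding outer_semicontinuous_def by blast
    qed
    ultimately show ?thesis by (simp add: restrict_system_def)
  qed
  have 2: "q' = W T" if "\<not> b"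
    using LIMSEQ_unique[OF q\<sigma>] WT nojmp[OF that] by simp
  have 3: "b \<or> T = 1" if m
  proof (rule disjCI)
    assume "T \<noteq> 1"
    then show b using m[OF that] T by (cases b) (auto dest: LIMSEQ_unique[OF tendsto_const])
  qed
  show ?thesis
    unfolding step_def near_step_def
    by (rule exI[of _ b], rule exI[of _ T], rule exI[of _ W]) (use W \<open>T \<le> 1\<close> W0 1 2 3 in simp)
qed

text \<open>By the pigeonhole principle infinitely many of the steps are of the same kind, with or
  without a jump. The index set is an arbitrary infinite one because the chains differ in length, so
  step m may exist, or carry the given flag, only in some of them.\<close>

lemma near_step_limit:
  fixes H :: "'a::euclidean_space hybrid_system"
  assumes H: "basic_assumptions H" and "compact K" "closed \<Gamma>" "\<Gamma> \<noteq> {}"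
    and inf: "infinite I"
    and step: "\<And>i. i \<in> I \<Longrightarrow> near_step H (K \<inter> {y. infdist y \<Gamma> \<le> \<eta> i}) m (p i) (q i)"
    and \<eta>: "\<eta> \<longlonglongrightarrow> 0" and p: "p \<longlonglongrightarrow> p'" and q: "q \<longlonglongrightarrow> q'"
  shows "step (restrict_system H \<Gamma>) m p' q'"
proof -
  let ?A = "\<lambda>i. K \<inter> {y. infdist y \<Gamma> \<le> \<eta> i}"
  define R where "R i b \<tau> w \<longleftrightarrow> flow_arc H \<tau> w \<and> \<tau> \<le> 1 \<and> w 0 = p i \<and>
     (\<forall>t\<in>{0..<\<tau>}. w t \<in> ?A i) \<and> (b \<longrightarrow> w \<tau> \<in> jump_set H \<inter> ?A i \<and> q i \<in> jump_map H (w \<tau>)) \<and>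
     (\<not> b \<longrightarrow> q i = w \<tau>) \<and> (m \<longrightarrow> b \<or> \<tau> = 1)" for i b \<tau> w
  have ex: "\<exists>b \<tau> w. R i b \<tau> w" if "i \<in> I" for i
    using step[OF that] unfolding near_step_def R_def .
  have "I \<subseteq> {i\<in>I. \<exists>\<tau> w. R i True \<tau> w} \<union> {i\<in>I. \<exists>\<tau> w. R i False \<tau> w}"
  proof
    fix i assume i: "i \<in> I"
    then obtain b \<tau> w where "R i b \<tau> w" using ex by blast
    with i show "i \<in> {i\<in>I. \<exists>\<tau> w. R i True \<tau> w} \<union> {i\<in>I. \<exists>\<tau> w. R i False \<tau> w}"
      by (cases b) auto
  qed
  then obtain b where "infinite {i\<in>I. \<exists>\<tau> w. R i b \<tau> w}"
    using inf finite_subset finite_UnI by blast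
  then obtain r :: "nat \<Rightarrow> nat" where r: "strict_mono r" "\<forall>n. r n \<in> {i\<in>I. \<exists>\<tau> w. R i b \<tau> w}"
    using infinite_enumerate by blast
  then have "\<forall>n. \<exists>\<tau> w. R (r n) b \<tau> w" by blast
  then obtain \<tau> w where "\<And>n. R (r n) b (\<tau> n) (w n)" by metis
  note R = this[unfolded R_def]
  have sub: "(\<lambda>n. f (r n)) \<longlonglongrightarrow> l" if "f \<longlonglongrightarrow> l" for f :: "nat \<Rightarrow> 'b::topological_space" and l
    using LIMSEQ_subseq_LIMSEQ[OF that r(1)] by (simp add: comp_def)
  show ?thesis
  proof (rule near_step_limit_fixed_kind[OF H \<open>compact K\<close> \<open>closed \<Gamma>\<close> \<open>\<Gamma> \<noteq> {}\<close>,
        where \<tau> = \<tau> and w = w and b = b and \<eta> = "\<lambda>n. \<eta> (r n)" and p = "\<lambda>n. p (r n)" and q = "\<lambda>n. q (r n)"])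
    fix i
    note Ri = R[of i]
    show "flow_arc H (\<tau> i) (w i)" "\<tau> i \<le> 1" "w i 0 = p (r i)" using Ri by simp_all
    show "w i t \<in> ?A (r i)" if "t \<in> {0..<\<tau> i}" for t using Ri that by simp
    show "w i (\<tau> i) \<in> jump_set H \<inter> ?A (r i) \<and> q (r i) \<in> jump_map H (w i (\<tau> i))" if b
      using Ri that by simp
    show "q (r i) = w i (\<tau> i)" if "\<not> b" using Ri that by simp
    show "b \<or> \<tau> i = 1" if m using Ri that by simp
  qed (rule sub[OF \<eta>] sub[OF p] sub[OF q])+
qed

text \<open>The end point of a step may leave \<open>K\<close>, so compactness of \<open>K\<close>
  does not bound it. A jump lands within the bound of the jump map on \<open>K\<close>; a flow of
  duration at most 1 moves by at most the bound on its velocities.\<close>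

lemma near_step_bounded:
  fixes H :: "'a::euclidean_space hybrid_system"
  assumes H: "basic_assumptions H" and "compact K"
  obtains R where "\<And>A m p q. A \<subseteq> K \<Longrightarrow> p \<in> K \<Longrightarrow> near_step H A m p q \<Longrightarrow> norm q \<le> R"
proof -
  have "compact (flow_set H \<inter> K)" "compact (jump_set H \<inter> K)"
    using H \<open>compact K\<close> by (auto simp: basic_assumptions_def intro: closed_Int_compact)
  moreover have lb: "locally_bounded_on (flow_set H) (flow_map H)" "locally_bounded_on (jump_set H) (jump_map H)"
    using H by (auto simp: basic_assumptions_def)
  ultimately obtain M1 M2 where "M1 \<ge> 0" "M2 \<ge> 0"
    and M1: "\<And>x y. x \<in> flow_set H \<inter> K \<Longrightarrow> y \<in> flow_map H x \<Longrightarrow> norm y \<le> M1"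
    and M2: "\<And>x y. x \<in> jump_set H \<inter> K \<Longrightarrow> y \<in> jump_map H x \<Longrightarrow> norm y \<le> M2"
    using locally_bounded_on_compact[OF lb(1), of "flow_set H \<inter> K"]
      locally_bounded_on_compact[OF lb(2), of "jump_set H \<inter> K"] by (metis inf_le1)
  obtain B where B: "\<And>x. x \<in> K \<Longrightarrow> norm x \<le> B"
    using compact_imp_bounded[OF \<open>compact K\<close>] by (auto simp: bounded_iff)
  show ?thesis
  proof (rule that[of "max M2 (B + M1)"])
    fix A m p q assume "A \<subseteq> K" "p \<in> K" "near_step H A m p q"
    then obtain b \<tau> w where w: "flow_arc H \<tau> w" "\<tau> \<le> 1" "w 0 = p" "\<forall>t\<in>{0..<\<tau>}. w t \<in> A"
     "b \<longrightarrow> w \<tau> \<in> jump_set H \<inter> A \<and> q \<in> jump_map H (w \<tau>)" "\<not> b \<longrightarrow> q = w \<tau>"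
      unfolding near_step_def by blast
    show "norm q \<le> max M2 (B + M1)"
    proof (cases b)
      case True
      then have "norm q \<le> M2" using w(5) \<open>A \<subseteq> K\<close> by (intro M2[of "w \<tau>"]) auto
      then show ?thesis by simp
    next
      case False
      have "0 \<le> \<tau>" using w(1) by (simp add: flow_arc_def)
      have "M1-lipschitz_on {0..\<tau>} w"
      proof (rule flow_arc_lipschitz[OF w(1) \<open>M1 \<ge> 0\<close>])
        fix t y assume t: "t \<in> {0<..<\<tau>}" "y \<in> flow_map H (w t)"
        then have "t \<in> {0..<\<tau>}" by simp
        then have "w t \<in> flow_set H \<inter> K" using w(1,4) \<open>A \<subseteq> K\<close> unfolding flow_arc_def by blast
        then show "norm y \<le> M1" using t(2) by (rule M1)
      qed
      then have "norm (w \<tau> - w 0) \<le> M1 * \<tau>"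
        using lipschitz_on_normD[of M1 "{0..\<tau>}" w \<tau> 0] \<open>0 \<le> \<tau>\<close> by simp
      also have "\<dots> \<le> M1 * 1" using \<open>M1 \<ge> 0\<close> w(2) by (intro mult_left_mono) auto
      finally have "norm (w \<tau>) \<le> norm (w 0) + M1" by norm
      then show ?thesis using False w(3,6) B[OF \<open>p \<in> K\<close>] by simp
    qed
  qed
qed

section \<open>Cutting a solution into steps\<close>

lemma solution_segment_flow_arc:
  assumes sol: "solution H E x" and E: "(s, k) \<in> E" "(s + \<tau>, k) \<in> E" and "0 \<le> \<tau>"
  shows "flow_arc H \<tau> (\<lambda>r. x (s + r, k))"
  unfolding flow_arc_def
proof (intro conjI ballI)
  have int: "(u, k) \<in> E" if "s \<le> u" "u \<le> s + \<tau>" for u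
    using hybrid_intervalD(3)[OF solutionD(1)[OF sol] E that] .
  show "0 \<le> \<tau>" by fact
  have "absolutely_continuous_on {s..s + \<tau>} (\<lambda>t. x (t, k))"
    by (rule solutionD(2)[OF sol]) (auto simp: time_slice_def int)
  from absolutely_continuous_on_shift[OF this, of "- s"]
  show "absolutely_continuous_on {0..\<tau>} (\<lambda>r. x (s + r, k))" by (simp add: add.commute)
  show "x (s + t, k) \<in> flow_set H" if "t \<in> {0..<\<tau>}" for t
    by (rule solutionD(3)[OF sol int E(2)]) (use that in auto)
  show "negligible {t \<in> {0<..<\<tau>}. \<not> (\<exists>v\<in>flow_map H (x (s + t, k)). ((\<lambda>r. x (s + r, k)) has_vector_derivative v) (at t))}"
    (is "negligible ?N")
  proof (cases "\<tau> = 0")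
    case False
    with \<open>0 \<le> \<tau>\<close> have "s < s + \<tau>" by simp
    from solutionD(4)[OF sol E this] have "negligible {t. \<not> (t \<in> time_slice E k \<longrightarrow>
        (\<exists>v\<in>flow_map H (x (t, k)). ((\<lambda>s. x (s, k)) has_vector_derivative v) (at t within time_slice E k)))}"
      (is "negligible ?B") by (simp add: AE_lebesgue_iff_negligible)
    then have "negligible ((+) (-s) ` ?B)" by (rule negligible_translation)
    moreover have "?N \<subseteq> (+) (-s) ` ?B"
    proof
      fix t assume t: "t \<in> ?N"
      have "s + t \<in> ?B"
      proof (rule ccontr)
        assume "s + t \<notin> ?B"
        moreover have "s + t \<in> time_slice E k" using t int by (simp add: time_slice_def)
        ultimately obtain v where v: "v \<in> flow_map H (x (s + t, k))"
          "((\<lambda>s. x (s, k)) has_vector_derivative v) (at (s + t) within time_slice E k)" by blast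
        have "{s<..<s + \<tau>} \<subseteq> time_slice E k" using int by (auto simp: time_slice_def)
        then have "((\<lambda>s. x (s, k)) has_vector_derivative v) (at (s + t) within {s<..<s + \<tau>})"
          using v(2) by (rule has_vector_derivative_within_subset[rotated])
        then have "((\<lambda>s. x (s, k)) has_vector_derivative v) (at (s + t))"
          using t by (subst (asm) has_vector_derivative_within_open) auto
        moreover have "((\<lambda>r. s + r) has_vector_derivative 1) (at t)"
          by (auto intro!: derivative_eq_intros)
        ultimately have "(((\<lambda>s. x (s, k)) \<circ> (\<lambda>r. s + r)) has_vector_derivative 1 *\<^sub>R v) (at t)"
          by (intro vector_diff_chain_at)
        then show False using t v(1) by (auto simp: comp_def)
      qed
      then show "t \<in> (+) (-s) ` ?B" by (intro image_eqI[of _ _ "s + t"]) auto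
    qed
    ultimately show ?thesis by (rule negligible_subset)
  qed simp
qed

lemma hybrid_interval_switch:
  assumes E: "hybrid_interval E" and "(t, j) \<in> E" "k < j"
  obtains \<sigma> where "(\<sigma>, k) \<in> E" "(\<sigma>, Suc k) \<in> E"
proof -
  have "\<exists>s. (s, j - n) \<in> E" if "n \<le> j" for n
    using that
  proof (induction n)
    case (Suc n)
    then obtain s where "(s, j - n) \<in> E" by auto
    moreover have "j - n = Suc (j - Suc n)" using Suc.prems by simp
    ultimately show ?case using hybrid_intervalD(5)[OF E, of s "j - Suc n"] by auto
  qed (use assms in auto)
  from this[of "j - Suc k"] \<open>k < j\<close> obtain s where "(s, Suc k) \<in> E" by auto
  then show ?thesis using hybrid_intervalD(5)[OF E] that by blast
qed

text \<open>Greedy cutting: flow for one time unit if the level lasts longer than that, otherwise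
  flow to the switching time and jump. Only the final flow on level \<open>J\<close> may fall short
  of the flag, hence \<open>Suc n < N\<close>.\<close>

lemma solution_decomposition:
  assumes sol: "solution H E x" and end_in: "(T, J) \<in> E"
    and A: "\<And>s k. (s, k) \<in> E \<Longrightarrow> s \<le> T \<Longrightarrow> k \<le> J \<Longrightarrow> (s, k) \<noteq> (T, J) \<Longrightarrow> x (s, k) \<in> A"
  obtains N u where "u 0 = x (0, 0)" "u N = x (T, J)"
    "\<And>n. n < N \<Longrightarrow> u n \<in> A" "\<And>n. n < N \<Longrightarrow> near_step H A (Suc n < N) (u n) (u (Suc n))"
proof -
  have E: "hybrid_interval E" using sol by (rule solutionD(1))
  have step: "near_step H A m (x (s, k)) q"
    if sk: "(s, k) \<in> E" "(s + \<tau>, k) \<in> E" "0 \<le> \<tau>" "\<tau> \<le> 1" "s + \<tau> \<le> T" "k \<le> J"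
      and b: "b \<Longrightarrow> (s + \<tau>, Suc k) \<in> E \<and> Suc k \<le> J \<and> q = x (s + \<tau>, Suc k)"
      and nb: "\<not> b \<Longrightarrow> q = x (s + \<tau>, k)" and m: "m \<Longrightarrow> b \<or> \<tau> = 1" for s k \<tau> b m q
    unfolding near_step_def
  proof (rule exI[of _ b], rule exI[of _ \<tau>], rule exI[of _ "\<lambda>r. x (s + r, k)"], intro conjI ballI impI)
    show "flow_arc H \<tau> (\<lambda>r. x (s + r, k))" using sol sk(1,2,3) by (rule solution_segment_flow_arc)
    show "x (s + t, k) \<in> A" if "t \<in> {0..<\<tau>}" for t
      using that sk hybrid_intervalD(3)[OF E sk(1,2), of "s + t"] by (intro A) auto
    show "x (s + \<tau>, k) \<in> jump_set H \<inter> A" if b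
      using solutionD(5)[OF sol sk(2)] b[OF that] sk by (auto intro!: A)
    show "q \<in> jump_map H (x (s + \<tau>, k))" if b
      using solutionD(6)[OF sol sk(2)] b[OF that] by simp
  qed (use sk nb m in auto)
  \<comment> \<open>Induction on \<lceil>T - s\<rceil> + (J - k): a unit flow lowers the first
    summand by 1 on the same level, and a jump lowers the second without raising the first.\<close>
  have "\<exists>N u. u 0 = x (s, k) \<and> u N = x (T, J) \<and> (\<forall>n<N. u n \<in> A) \<and>
      (\<forall>n<N. near_step H A (Suc n < N) (u n) (u (Suc n)))"
    if "(s, k) \<in> E" "s \<le> T" "k \<le> J" "nat \<lceil>T - s\<rceil> + (J - k) = c" for s k c
    using that
  proof (induction c arbitrary: s k rule: less_induct)
    case (less c)
    \<comment> \<open>Whether the new first step is also the last depends on the rest of the chain,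
      so the step is supplied for every flag \<open>m\<close>.\<close>
    have prepend: ?case
      if s'k': "(s', k') \<in> E" "s' \<le> T" "k' \<le> J" "nat \<lceil>T - s'\<rceil> + (J - k') < c"
        and ne: "(s, k) \<noteq> (T, J)" and st: "\<And>m. near_step H A m (x (s, k)) (x (s', k'))" for s' k'
    proof -
      obtain N u where u: "u 0 = x (s', k')" "u N = x (T, J)" "\<forall>n<N. u n \<in> A"
         "\<forall>n<N. near_step H A (Suc n < N) (u n) (u (Suc n))"
        using less.IH[OF s'k'(4,1,2,3) refl] by blast
      show ?thesis
      proof (intro exI[of _ "Suc N"] exI[of _ "case_nat (x (s, k)) u"] conjI allI impI)
        fix n assume "n < Suc N"
        then show "case_nat (x (s, k)) u n \<in> A"
          using u(3) A[OF less.prems(1,2,3) ne] by (cases n) auto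
        show "near_step H A (Suc n < Suc N) (case_nat (x (s, k)) u n) (case_nat (x (s, k)) u (Suc n))"
          using u(1,4) st \<open>n < Suc N\<close> by (cases n) auto
      qed (use u in auto)
    qed
    have flow1: ?case if "(s + 1, k) \<in> E" "s + 1 \<le> T"
    proof (rule prepend[of "s + 1" k])
      have "\<lceil>T - (s + 1)\<rceil> = \<lceil>T - s\<rceil> - 1" by linarith
      moreover have "\<lceil>T - s\<rceil> \<ge> 1" using that(2) by linarith
      ultimately show "nat \<lceil>T - (s + 1)\<rceil> + (J - k) < c" using less.prems(4) by linarith
      show "near_step H A m (x (s, k)) (x (s + 1, k))" for m
        by (rule step[of s k 1 False]) (use that less.prems in auto)
    qed (use that less.prems in auto)
    show ?case
    proof (cases "k = J")
      case True
      show ?thesis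
      proof (cases "T - s \<le> 1")
        case short: True
        show ?thesis
        proof (cases "s = T")
          case True
          then show ?thesis using \<open>k = J\<close> by (intro exI[of _ 0] exI[of _ "\<lambda>_. x (T, J)"]) auto
        next
          case False
          have "near_step H A False (x (s, k)) (x (T, J))"
            by (rule step[of s k "T - s" False]) (use short True less.prems end_in in auto)
          moreover have "x (s, k) \<in> A" using False less.prems by (intro A) auto
          ultimately show ?thesis
            by (intro exI[of _ 1] exI[of _ "case_nat (x (s, k)) (\<lambda>_. x (T, J))"]) auto
        qed
      next
        case False
        then show ?thesis
          using hybrid_intervalD(3)[OF E less.prems(1), of T "s + 1"] end_in True by (intro flow1) auto
      qed
    next
      case False
      then have "k < J" using less.prems by simp
      then obtain \<sigma> where \<sigma>: "(\<sigma>, k) \<in> E" "(\<sigma>, Suc k) \<in> E"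
        by (rule hybrid_interval_switch[OF E end_in])
      have s\<sigma>: "s \<le> \<sigma>" using hybrid_intervalD(4)[OF E less.prems(1) \<sigma>(2)] by simp
      have \<sigma>T: "\<sigma> \<le> T" using hybrid_intervalD(4)[OF E \<sigma>(1) end_in \<open>k < J\<close>] .
      show ?thesis
      proof (cases "\<sigma> - s \<le> 1")
        case True
        show ?thesis
        proof (rule prepend[of \<sigma> "Suc k"])
          have "nat \<lceil>T - \<sigma>\<rceil> \<le> nat \<lceil>T - s\<rceil>" using s\<sigma> by (intro nat_mono ceiling_mono) simp
          then show "nat \<lceil>T - \<sigma>\<rceil> + (J - Suc k) < c" using less.prems(4) \<open>k < J\<close> by linarith
          show "near_step H A m (x (s, k)) (x (\<sigma>, Suc k))" for m
            by (rule step[of s k "\<sigma> - s" True]) (use True \<sigma> s\<sigma> \<sigma>T \<open>k < J\<close> less.prems in auto)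
        qed (use \<sigma> \<sigma>T \<open>k < J\<close> in auto)
      next
        case False
        then show ?thesis
          using hybrid_intervalD(3)[OF E less.prems(1) \<sigma>(1), of "s + 1"] \<sigma>T by (intro flow1) auto
      qed
    qed
  qed
  from this[OF hybrid_intervalD(1)[OF E] hybrid_intervalD(2)[OF E end_in] le0 refl]
  show ?thesis using that by blast
qed

section \<open>First exit from an open set\<close>

lemma absolutely_continuous_imp_continuous_on:
  assumes "absolutely_continuous_on {a..b} f"
  shows "continuous_on {a..b} f"
  unfolding continuous_on_iff
proof (intro ballI allI impI)
  fix s e :: real assume s: "s \<in> {a..b}" and "e > 0"
  then obtain d where "d > 0" and d: "\<And>(n::nat) u v. (\<forall>i<n. u i \<le> v i \<and> {u i..v i} \<subseteq> {a..b}) \<and>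
        disjoint_family_on (\<lambda>i. {u i<..<v i}) {..<n} \<and> (\<Sum>i<n. v i - u i) < d \<Longrightarrow>
        (\<Sum>i<n. norm (f (v i) - f (u i))) < e"
    using assms unfolding absolutely_continuous_on_def by meson
  have one: "norm (f v - f u) < e" if "u \<in> {a..b}" "v \<in> {a..b}" "u \<le> v" "v - u < d" for u v
    using d[of 1 "\<lambda>_. u" "\<lambda>_. v"] that by (auto simp: disjoint_family_on_def)
  show "\<exists>d>0. \<forall>t\<in>{a..b}. dist t s < d \<longrightarrow> dist (f t) (f s) < e"
  proof (intro exI[of _ d] conjI ballI impI \<open>d > 0\<close>)
    fix t assume t: "t \<in> {a..b}" "dist t s < d"
    show "dist (f t) (f s) < e"
    proof (cases "s \<le> t")
      case True
      then show ?thesis using one[of s t] s t by (simp add: dist_norm)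
    next
      case False
      then show ?thesis using one[of t s] s t by (simp add: dist_norm norm_minus_commute)
    qed
  qed
qed

text \<open>Take the lowest level with a point outside \<open>U\<close>, and on it the earliest such
  time. The latter exists because the slice has a minimum \<open>a\<close> and, \<open>U\<close>
  being open, the times in [a, t1] outside \<open>U\<close> form a compact set.\<close>

lemma solution_first_exit:
  fixes x :: "real \<times> nat \<Rightarrow> 'a::euclidean_space"
  assumes sol: "solution H E x" and ex: "(t, j) \<in> E" "x (t, j) \<notin> U" and "open U"
  obtains T J where "(T, J) \<in> E" "x (T, J) \<notin> U"
    "\<And>s k. (s, k) \<in> E \<Longrightarrow> s \<le> T \<Longrightarrow> k \<le> J \<Longrightarrow> (s, k) \<noteq> (T, J) \<Longrightarrow> x (s, k) \<in> U"
proof -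
  have E: "hybrid_interval E" using sol by (rule solutionD(1))
  define J where "J = (LEAST j. \<exists>t. (t, j) \<in> E \<and> x (t, j) \<notin> U)"
  have "\<exists>t. (t, J) \<in> E \<and> x (t, J) \<notin> U"
    unfolding J_def by (rule LeastI_ex[of "\<lambda>j. \<exists>t. (t, j) \<in> E \<and> x (t, j) \<notin> U"]) (use ex in blast)
  then obtain t1 where t1: "(t1, J) \<in> E" "x (t1, J) \<notin> U" by blast
  have before: "x (s, k) \<in> U" if "(s, k) \<in> E" "k < J" for s k
    using not_less_Least[of k "\<lambda>j. \<exists>t. (t, j) \<in> E \<and> x (t, j) \<notin> U"] that by (auto simp: J_def)
  have "\<exists>a. (a, J) \<in> E \<and> (\<forall>s. (s, J) \<in> E \<longrightarrow> a \<le> s)"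
  proof (cases J)
    case 0
    then show ?thesis using hybrid_intervalD(1,2)[OF E] by blast
  next
    case (Suc i)
    then show ?thesis using hybrid_intervalD(4,5)[OF E] t1(1) by (metis lessI)
  qed
  then obtain a where a: "(a, J) \<in> E" "\<And>s. (s, J) \<in> E \<Longrightarrow> a \<le> s" by blast
  have int: "(s, J) \<in> E" if "s \<in> {a..t1}" for s
    using hybrid_intervalD(3)[OF E a(1) t1(1)] that by simp
  have cont: "continuous_on {a..t1} (\<lambda>s. x (s, J))"
    by (intro absolutely_continuous_imp_continuous_on solutionD(2)[OF sol]) (auto simp: time_slice_def int)
  define B where "B = {a..t1} \<inter> (\<lambda>s. x (s, J)) -` (- U)"
  have "closed B"
    unfolding B_def using cont \<open>open U\<close> by (intro continuous_closed_preimage) auto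
  moreover have "bounded B" unfolding B_def by (rule bounded_subset[of "{a..t1}"]) auto
  ultimately have "compact B" by (simp add: compact_eq_bounded_closed)
  moreover have "t1 \<in> B" using a(2)[OF t1(1)] t1 by (simp add: B_def)
  ultimately obtain T where T: "T \<in> B" "\<And>s. s \<in> B \<Longrightarrow> T \<le> s" using compact_attains_inf[of B] by auto
  show ?thesis
  proof (rule that)
    show "(T, J) \<in> E" "x (T, J) \<notin> U" using T(1) int by (auto simp: B_def)
    fix s k assume sk: "(s, k) \<in> E" "s \<le> T" "k \<le> J" "(s, k) \<noteq> (T, J)"
    show "x (s, k) \<in> U"
    proof (cases "k < J")
      case True
      with sk(1) show ?thesis by (rule before)
    next
      case False
      then have "k = J" "s < T" using sk by auto
      then have "s \<notin> B" using T(2)[of s] by auto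
      moreover have "s \<in> {a..t1}" using a(2)[of s] sk(1) \<open>k = J\<close> \<open>s < T\<close> T(1) by (auto simp: B_def)
      ultimately show ?thesis using \<open>k = J\<close> by (simp add: B_def)
    qed
  qed
qed

section \<open>The reduction theorem\<close>

lemma solution_append_step:
  assumes sol: "solution H E x" and last: "last_point E t j"
    and st: "step H m (x (t, j)) q"
  obtains E' x' t' j' where "solution H E' x'" "E \<subseteq> E'" "\<And>p. p \<in> E \<Longrightarrow> x' p = x p"
    "last_point E' t' j'" "x' (t', j') = q" "m \<Longrightarrow> t + real j + 1 \<le> t' + real j'"
proof -
  obtain b \<tau> w where w: "flow_arc H \<tau> w" "w 0 = x (t, j)"
    and b: "b \<Longrightarrow> w \<tau> \<in> jump_set H \<and> q \<in> jump_map H (w \<tau>)" and nb: "\<not> b \<Longrightarrow> q = w \<tau>"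
    and m: "m \<Longrightarrow> b \<or> \<tau> = 1"
    using st unfolding step_def near_step_def by blast
  have "0 \<le> \<tau>" using w(1) by (simp add: flow_arc_def)
  obtain E1 x1 where 1: "solution H E1 x1" "E \<subseteq> E1" "\<And>p. p \<in> E \<Longrightarrow> x1 p = x p"
    "last_point E1 (t + \<tau>) j" "x1 (t + \<tau>, j) = w \<tau>"
    using solution_append_flow[OF sol last w] by blast
  show ?thesis
  proof (cases b)
    case True
    then obtain E2 x2 where 2: "solution H E2 x2" "E1 \<subseteq> E2" "\<And>p. p \<in> E1 \<Longrightarrow> x2 p = x1 p"
      "last_point E2 (t + \<tau>) (Suc j)" "x2 (t + \<tau>, Suc j) = q"
      using solution_append_jump[OF 1(1,4), of q] b 1(5) by metis
    show ?thesis
      by (rule that[OF 2(1) _ _ 2(4,5)]) (use 1(2,3) 2(2,3) \<open>0 \<le> \<tau>\<close> in auto)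
  next
    case False
    show ?thesis
      by (rule that[OF 1(1,2,3,4)]) (use 1(5) False nb m in auto)
  qed
qed

lemma solution_of_finite_chain:
  assumes st: "\<And>n. n < N \<Longrightarrow> step H (m n) (z n) (z (Suc n))"
  obtains E x t j where "solution H E x" "last_point E t j" "x (0, 0) = z 0" "x (t, j) = z N"
proof -
  have "\<exists>E x t j. solution H E x \<and> last_point E t j \<and> x (0, 0) = z 0 \<and> x (t, j) = z n" if "n \<le> N" for n
    using that
  proof (induction n)
    case 0
    show ?case
      by (intro exI[of _ "{(0, 0)}"] exI[of _ "\<lambda>_. z 0"] exI[of _ 0])
        (simp add: solution_trivial last_point_def)
  next
    case (Suc n)
    then obtain E x t j where E: "solution H E x" "last_point E t j" "x (0, 0) = z 0" "x (t, j) = z n" by auto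
    then have "step H (m n) (x (t, j)) (z (Suc n))" using st[of n] Suc.prems by simp
    then obtain E' x' t' j' where E': "solution H E' x'" "E \<subseteq> E'" "\<And>p. p \<in> E \<Longrightarrow> x' p = x p"
      "last_point E' t' j'" "x' (t', j') = z (Suc n)"
      using solution_append_step[OF E(1,2)] by metis
    have "x' (0, 0) = z 0" using E'(3) hybrid_intervalD(1)[OF solutionD(1)[OF E(1)]] E(3) by simp
    with E' show ?case by blast
  qed
  from this[of N] show ?thesis using that by blast
qed

text \<open>The partial solutions must extend one another for their union to be a solution, so they
  come from dependent choice rather than one by one from the finite case. The lower bound on hybrid
  time later gives completeness.\<close>

lemma solution_of_infinite_chain:
  assumes st: "\<And>n. step H True (z n) (z (Suc n))"
  obtains E x t j where "solution H E x" "x (0, 0) = z 0"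
    "\<And>n. (t n, j n) \<in> E" "\<And>n::nat. x (t n, j n) = z n" "\<And>n. real n \<le> t n + real (j n)"
proof -
  define P where "P n s \<longleftrightarrow> (case s of (E, x, t, j) \<Rightarrow> solution H E x \<and> last_point E t j \<and>
     x (0, 0) = z 0 \<and> x (t, j) = z n \<and> real n \<le> t + real j)" for n s
  define Q where "Q s s' \<longleftrightarrow> (case s of (E, x, t, j) \<Rightarrow> case s' of (E', x', t', j') \<Rightarrow>
     E \<subseteq> E' \<and> (\<forall>p\<in>E. x' p = x p))" for s s' :: "(real \<times> nat) set \<times> (real \<times> nat \<Rightarrow> 'a) \<times> real \<times> nat"
  have "\<exists>f. \<forall>n. P n (f n) \<and> Q (f n) (f (Suc n))"
  proof (rule dependent_nat_choice)
    show "\<exists>s. P 0 s"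
      by (intro exI[of _ "({(0, 0)}, \<lambda>_. z 0, 0, 0)"]) (simp add: P_def solution_trivial last_point_def)
    fix s n assume "P n s"
    then obtain E x t j where s: "s = (E, x, t, j)" and E: "solution H E x" "last_point E t j"
      "x (0, 0) = z 0" "x (t, j) = z n" "real n \<le> t + real j" by (cases s) (auto simp: P_def)
    then have st': "step H True (x (t, j)) (z (Suc n))" using st[of n] by simp
    show "\<exists>s'. P (Suc n) s' \<and> Q s s'"
    proof (rule solution_append_step[OF E(1,2) st'])
      fix E' x' t' j'
      assume E': "solution H E' x'" "E \<subseteq> E'" "\<And>p. p \<in> E \<Longrightarrow> x' p = x p"
        "last_point E' t' j'" "x' (t', j') = z (Suc n)" "True \<Longrightarrow> t + real j + 1 \<le> t' + real j'"
      have "x' (0, 0) = z 0" using E'(3) hybrid_intervalD(1)[OF solutionD(1)[OF E(1)]] E(3) by simp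
      with E' E(5) show ?thesis
        unfolding s by (intro exI[of _ "(E', x', t', j')"]) (auto simp: P_def Q_def)
    qed
  qed
  then obtain f where f: "\<And>n. P n (f n)" "\<And>n. Q (f n) (f (Suc n))" by blast
  define E where "E n = fst (f n)" for n
  define x where "x n = fst (snd (f n))" for n
  define t where "t n = fst (snd (snd (f n)))" for n
  define j where "j n = snd (snd (snd (f n)))" for n
  have fn: "f n = (E n, x n, t n, j n)" for n by (simp add: E_def x_def t_def j_def)
  have sol: "solution H (E n) (x n)" and last: "last_point (E n) (t n) (j n)"
    and x0: "x n (0, 0) = z 0" and xn: "x n (t n, j n) = z n" and large: "real n \<le> t n + real (j n)" for n
    using f(1)[of n] by (auto simp: P_def fn)
  have Suc: "E n \<subseteq> E (Suc n)" "\<And>p. p \<in> E n \<Longrightarrow> x (Suc n) p = x n p" for n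
    using f(2)[of n] by (auto simp: Q_def fn)
  have sub: "E n \<subseteq> E n'" if "n \<le> n'" for n n' using Suc(1) that by (rule lift_Suc_mono_le)
  have eq: "x n' p = x n p" if "n \<le> n'" "p \<in> E n" for n n' p
    using that
  proof (induction rule: dec_induct)
    case (step k)
    have "p \<in> E k" using sub[OF step.hyps(1)] step.prems by blast
    then show ?case using Suc(2) step by simp
  qed simp
  \<comment> \<open>Any stage containing \<open>p\<close> gives the same value, because later stages
    agree with earlier ones on the earlier domain.\<close>
  define X where "X p = x (LEAST n. p \<in> E n) p" for p
  have X: "X p = x n p" if "p \<in> E n" for n p
    unfolding X_def using eq[OF Least_le[of "\<lambda>n. p \<in> E n", OF that] LeastI[of "\<lambda>n. p \<in> E n", OF that]] by simp
  have "solution H (\<Union>(range E)) X"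
  proof (rule solution_chain_Union)
    show "solution H A X" if "A \<in> range E" for A
    proof -
      from that obtain n where n: "A = E n" by blast
      show ?thesis unfolding n using sol[of n] by (rule solution_cong) (simp add: X)
    qed
    show "A \<subseteq> B \<or> B \<subseteq> A" if "A \<in> range E" "B \<in> range E" for A B
      using that sub by (metis imageE nat_le_linear)
  qed simp
  moreover have "(0, 0) \<in> E 0" by (rule hybrid_intervalD(1)[OF solutionD(1)[OF sol]])
  then have "X (0, 0) = z 0" by (simp add: X x0)
  moreover have tj: "(t n, j n) \<in> E n" for n using last by (rule last_pointD(1))
  moreover have "X (t n, j n) = z n" for n using X[OF tj[of n]] xn[of n] by simp
  ultimately show ?thesis using tj large by (intro that[of "\<Union>(range E)" X t j]) auto
qed

text \<open>Disposes of the degenerate case: \<open>infdist\<close> to the empty set is 0, so its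
  sublevel sets are the whole space and not compact.\<close>

lemma stable_set_empty: "stable_set H {}"
  unfolding stable_set_def set_ball_def by (auto simp: infdist_def intro: exI[of _ 1])

text \<open>Before its first exit from the \<epsilon>-ball the solution has its whole past in the
  r-ball, because \<epsilon> <= r; local stability therefore confines it to the \<eta>-neighbourhood
  of \<Gamma>2 until then.\<close>

lemma locally_stable_near_decomposition:
  fixes H :: "'a::euclidean_space hybrid_system"
  assumes loc: "\<And>t j. (t, j) \<in> E \<Longrightarrow> (\<forall>(s, k)\<in>E. s \<le> t \<and> k \<le> j \<longrightarrow> x (s, k) \<in> set_ball r \<Gamma>1) \<Longrightarrow>
        x (t, j) \<in> set_ball \<eta> \<Gamma>2"
    and sol: "solution H E x" and "\<epsilon> \<le> r"
    and exit: "(t, j) \<in> E" "x (t, j) \<notin> set_ball \<epsilon> \<Gamma>1"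
  obtains N u where "u 0 = x (0, 0)" "infdist (u N) \<Gamma>1 \<ge> \<epsilon>" "\<And>n. n < N \<Longrightarrow> infdist (u n) \<Gamma>1 \<le> \<epsilon>"
    "\<And>n. n < N \<Longrightarrow> near_step H ({y. infdist y \<Gamma>1 \<le> \<epsilon>} \<inter> {y. infdist y \<Gamma>2 \<le> \<eta>}) (Suc n < N) (u n) (u (Suc n))"
proof -
  have "open (set_ball \<epsilon> \<Gamma>1)"
    unfolding set_ball_def by (intro open_Collect_less continuous_intros)
  then obtain T J where TJ: "(T, J) \<in> E" "x (T, J) \<notin> set_ball \<epsilon> \<Gamma>1"
    "\<And>s k. (s, k) \<in> E \<Longrightarrow> s \<le> T \<Longrightarrow> k \<le> J \<Longrightarrow> (s, k) \<noteq> (T, J) \<Longrightarrow> x (s, k) \<in> set_ball \<epsilon> \<Gamma>1"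
    by (rule solution_first_exit[OF sol exit]) blast
  let ?A = "{y. infdist y \<Gamma>1 \<le> \<epsilon>} \<inter> {y. infdist y \<Gamma>2 \<le> \<eta>}"
  show ?thesis
  proof (rule solution_decomposition[OF sol TJ(1), of ?A])
    fix s k assume sk: "(s, k) \<in> E" "s \<le> T" "k \<le> J" "(s, k) \<noteq> (T, J)"
    have "x (s, k) \<in> set_ball \<eta> \<Gamma>2"
    proof (rule loc[OF sk(1)], clarify)
      fix s' k' assume "(s', k') \<in> E" "s' \<le> s" "k' \<le> k"
      then have "x (s', k') \<in> set_ball \<epsilon> \<Gamma>1" using sk by (intro TJ(3)) auto
      then show "x (s', k') \<in> set_ball r \<Gamma>1" using \<open>\<epsilon> \<le> r\<close> by (simp add: set_ball_def)
    qed
    then show "x (s, k) \<in> ?A" using TJ(3)[OF sk] by (simp add: set_ball_def)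
  next
    fix u N assume u: "u 0 = x (0, 0)" "u N = x (T, J)" "\<And>n. n < N \<Longrightarrow> u n \<in> ?A"
      "\<And>n. n < N \<Longrightarrow> near_step H ?A (Suc n < N) (u n) (u (Suc n))"
    show ?thesis
    proof (rule that[OF u(1) _ _ u(4)])
      show "\<epsilon> \<le> infdist (u N) \<Gamma>1" using TJ(2) u(2) by (simp add: set_ball_def)
      show "infdist (u n) \<Gamma>1 \<le> \<epsilon>" if "n < N" for n using u(3)[OF that] by simp
    qed
  qed
qed

lemma last_visit:
  fixes d :: "nat \<Rightarrow> real"
  assumes "d 0 \<le> \<delta>" "d N > \<delta>"
  obtains n where "n < N" "d n \<le> \<delta>" "\<And>k. n < k \<Longrightarrow> k \<le> N \<Longrightarrow> d k > \<delta>"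
proof -
  define n where "n = (GREATEST n. n \<le> N \<and> d n \<le> \<delta>)"
  have n: "n \<le> N \<and> d n \<le> \<delta>"
    unfolding n_def by (rule GreatestI_nat[of "\<lambda>n. n \<le> N \<and> d n \<le> \<delta>" 0 N]) (use assms in auto)
  moreover have "n \<noteq> N" using n assms by auto
  moreover have "d k > \<delta>" if "n < k" "k \<le> N" for k
  proof (rule ccontr)
    assume "\<not> d k > \<delta>"
    then have "k \<le> n"
      unfolding n_def by (intro Greatest_le_nat[of "\<lambda>n. n \<le> N \<and> d n \<le> \<delta>" k N]) (use that in auto)
    with that show False by simp
  qed
  ultimately show ?thesis by (intro that[of n]) auto
qed


text \<open>A maximal extension of the assembled solution still passes through \<open>z n\<close> at
  hybrid time at least n, so it is complete while its distance to \<Gamma> keeps returning to values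
  of at least \<delta>. The bound starts at \<open>Suc n\<close> because in the application
  \<open>z 0\<close> lies within distance \<delta>.\<close>

lemma not_attracted_infinite_chain:
  fixes H :: "'a::euclidean_space hybrid_system"
  assumes z0: "z 0 \<in> basin_of_attraction H \<Gamma>" and st: "\<And>n. step H True (z n) (z (Suc n))"
    and far: "\<And>n. \<delta> \<le> infdist (z (Suc n)) \<Gamma>" and "\<delta> > 0"
  shows False
proof -
  obtain E0 x0 t j where 0: "solution H E0 x0" "x0 (0, 0) = z 0"
    "\<And>n. (t n, j n) \<in> E0" "\<And>n::nat. x0 (t n, j n) = z n" and large: "\<And>n. real n \<le> t n + real (j n)"
    by (rule solution_of_infinite_chain[where H = H and z = z, OF st]) blast
  obtain E x where E: "maximal_solution H E x" "E0 \<subseteq> E" "\<And>p. p \<in> E0 \<Longrightarrow> x p = x0 p"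
    by (rule solution_extends_to_maximal[OF 0(1)]) blast
  have tj: "(t n, j n) \<in> E" "x (t n, j n) = z n" for n using E 0(3)[of n] 0(4)[of n] by auto
  have "x (0, 0) = z 0"
    using E(3) hybrid_intervalD(1)[OF solutionD(1)[OF 0(1)]] 0(2) by simp
  then have "(E, x) \<in> solutions_from H {z 0}" using E(1) by (simp add: solutions_from_def)
  with z0 have attr: "complete_domain E \<Longrightarrow> ((\<lambda>q. infdist (x q) \<Gamma>) \<longlongrightarrow> 0)
               (inf (filtercomap (\<lambda>(t, j). t + real j) at_top) (principal E))"
    unfolding basin_of_attraction_def by blast
  have "complete_domain E"
    unfolding complete_domain_def
  proof
    assume "bounded ((\<lambda>(t, j). (t, real j)) ` E)"
    then obtain B where B: "\<And>p. p \<in> E \<Longrightarrow> norm (case p of (t, j) \<Rightarrow> (t, real j)) \<le> B"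
      unfolding bounded_iff by blast
    \<comment> \<open>Both coordinates are bounded by \<open>B\<close>, so hybrid time t + j is at
      most 2 * B.\<close>
    obtain n :: nat where n: "2 * B < real n" using reals_Archimedean2 by blast
    have "norm (t n, real (j n)) \<le> B" using B[OF tj(1)[of n]] by simp
    then have "norm (t n) \<le> B" "norm (real (j n)) \<le> B"
      using norm_fst_le[of "t n" "real (j n)"] norm_snd_le[of "real (j n)" "t n"] by linarith+
    then show False using large[of n] n by simp
  qed
  from order_tendstoD(2)[OF attr[OF this] \<open>\<delta> > 0\<close>]
  obtain N where N: "\<And>p. N \<le> (case p of (t, j) \<Rightarrow> t + real j) \<Longrightarrow> p \<in> E \<Longrightarrow> infdist (x p) \<Gamma> < \<delta>"
    unfolding eventually_inf_principal eventually_filtercomap_at_top_linorder by blast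
  obtain n :: nat where n: "N < real n" using reals_Archimedean2 by blast
  have "infdist (x (t (Suc n), j (Suc n))) \<Gamma> < \<delta>"
    by (rule N) (use n large[of "Suc n"] tj in auto)
  then show False using far[of n] tj(2)[of "Suc n"] by simp
qed

text \<open>Stability quantifies over maximal solutions, so the assembled solution is first
  extended; the extension still passes through \<open>z N\<close>.\<close>

lemma stable_finite_chain:
  fixes H :: "'a::euclidean_space hybrid_system"
  assumes stab: "range_of_solutions H (set_ball \<delta> \<Gamma>) \<subseteq> set_ball \<epsilon> \<Gamma>"
    and z0: "infdist (z 0) \<Gamma> < \<delta>" and st: "\<And>n. n < N \<Longrightarrow> step H (m n) (z n) (z (Suc n))"
  shows "infdist (z N) \<Gamma> < \<epsilon>"
proof -
  obtain E0 x0 t j where 0: "solution H E0 x0" "last_point E0 t j" "x0 (0, 0) = z 0" "x0 (t, j) = z N"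
    by (rule solution_of_finite_chain[where H = H and z = z and m = m and N = N, OF st]) blast+
  obtain E x where E: "maximal_solution H E x" "E0 \<subseteq> E" "\<And>p. p \<in> E0 \<Longrightarrow> x p = x0 p"
    by (rule solution_extends_to_maximal[OF 0(1)]) blast
  have "x (0, 0) = z 0"
    using E(3) hybrid_intervalD(1)[OF solutionD(1)[OF 0(1)]] 0(3) by simp
  then have sf: "(E, x) \<in> solutions_from H (set_ball \<delta> \<Gamma>)"
    using E(1) z0 by (simp add: solutions_from_def set_ball_def)
  have "x (t, j) = z N" "(t, j) \<in> E" using E 0 last_pointD(1)[OF 0(2)] by auto
  then have "z N \<in> x ` E" by force
  then have "z N \<in> range_of_solutions H (set_ball \<delta> \<Gamma>)"
    unfolding range_of_solutions_def by (intro UN_I[OF sf]) simp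
  with stab show ?thesis by (auto simp: set_ball_def)
qed

section \<open>The contradiction argument\<close>

lemma stable_if_relatively_asymptotically_stable:
  fixes H :: "'a::euclidean_space hybrid_system"
  assumes H: "basic_assumptions H" and "\<Gamma>1 \<subseteq> \<Gamma>2" and "compact \<Gamma>1" and "closed \<Gamma>2"
    and as: "asymptotically_stable_relative_to H \<Gamma>1 \<Gamma>2" and ls: "locally_stable_near H \<Gamma>2 \<Gamma>1"
  shows "stable_set H \<Gamma>1"
proof (cases "\<Gamma>1 = {}")
  case True
  then show ?thesis using stable_set_empty by simp
next
  case False
  then have "\<Gamma>2 \<noteq> {}" using \<open>\<Gamma>1 \<subseteq> \<Gamma>2\<close> by blast
  let ?H = "restrict_system H \<Gamma>2"
  obtain r where "r > 0" and ls: "\<And>e. e > 0 \<Longrightarrow> \<exists>d>0. \<forall>(E, x)\<in>solutions_from H (set_ball d \<Gamma>1). \<forall>(t, j)\<in>E.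
        (\<forall>(s, k)\<in>E. s \<le> t \<and> k \<le> j \<longrightarrow> x (s, k) \<in> set_ball r \<Gamma>1) \<longrightarrow> x (t, j) \<in> set_ball e \<Gamma>2"
    using ls unfolding locally_stable_near_def by blast
  have stab: "stable_set ?H \<Gamma>1" and attr: "\<Gamma>1 \<subseteq> interior (basin_of_attraction ?H \<Gamma>1)"
    using as by (auto simp: asymptotically_stable_relative_to_def asymptotically_stable_def attractive_def)
  \<comment> \<open>Compactness of \<Gamma>1 yields a neighbourhood of uniform radius inside the
    basin.\<close>
  obtain \<delta>2 where "\<delta>2 > 0" and \<delta>2: "{x. infdist x \<Gamma>1 \<le> \<delta>2} \<subseteq> basin_of_attraction ?H \<Gamma>1"
    using compact_in_open_separated[OF False \<open>compact \<Gamma>1\<close> open_interior attr] interior_subset by (metis subset_trans)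
  show ?thesis
    unfolding stable_set_def
  proof (intro allI impI, rule ccontr)
    fix \<epsilon>0 :: real assume "\<epsilon>0 > 0" and unstable: "\<not> (\<exists>d>0. range_of_solutions H (set_ball d \<Gamma>1) \<subseteq> set_ball \<epsilon>0 \<Gamma>1)"
    \<comment> \<open>Leaving the \<epsilon>0-ball entails leaving the \<epsilon>-ball, and
      \<epsilon> <= r brings local stability to bear up to that exit.\<close>
    define \<epsilon> where "\<epsilon> = min \<epsilon>0 r"
    have "\<epsilon> > 0" "\<epsilon> \<le> r" "\<epsilon> \<le> \<epsilon>0" using \<open>\<epsilon>0 > 0\<close> \<open>r > 0\<close> by (auto simp: \<epsilon>_def)
    obtain \<delta>1 where "\<delta>1 > 0" and \<delta>1: "range_of_solutions ?H (set_ball \<delta>1 \<Gamma>1) \<subseteq> set_ball \<epsilon> \<Gamma>1"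
      using stab \<open>\<epsilon> > 0\<close> unfolding stable_set_def by blast
    \<comment> \<open>Halving gives strict inequalities: the limit start, only known to satisfy
      infdist <= \<delta>, lies in the open \<delta>1-ball, and \<delta> < \<epsilon> guarantees
      that a chain from distance at most \<delta> to distance at least \<epsilon> has a step. The
      bound \<delta>2 puts the limit start into the basin.\<close>
    define \<delta> where "\<delta> = min (min \<delta>1 \<delta>2) \<epsilon> / 2"
    have \<delta>: "\<delta> > 0" "\<delta> < \<delta>1" "\<delta> \<le> \<delta>2" "\<delta> < \<epsilon>"
      using \<open>\<delta>1 > 0\<close> \<open>\<delta>2 > 0\<close> \<open>\<epsilon> > 0\<close> unfolding \<delta>_def by linarith+
    define K where "K = {y. infdist y \<Gamma>1 \<le> \<epsilon>}"
    have "compact K" unfolding K_def using False \<open>compact \<Gamma>1\<close> \<open>\<epsilon> > 0\<close> by (rule compact_infdist_le)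
    obtain R1 where R1: "\<And>A m p q. A \<subseteq> K \<Longrightarrow> p \<in> K \<Longrightarrow> near_step H A m p q \<Longrightarrow> norm q \<le> R1"
      using near_step_bounded[OF H \<open>compact K\<close>] by blast
    obtain R2 where R2: "\<And>p. p \<in> K \<Longrightarrow> norm p \<le> R2"
      using compact_imp_bounded[OF \<open>compact K\<close>] by (auto simp: bounded_iff)
    define \<eta> where "\<eta> i = 1 / real (Suc i)" for i
    have \<eta>: "\<eta> \<longlonglongrightarrow> 0" unfolding \<eta>_def by (rule LIMSEQ_Suc[OF lim_1_over_n])
    let ?A = "\<lambda>i. K \<inter> {y. infdist y \<Gamma>2 \<le> \<eta> i}"
    \<comment> \<open>Beyond its length \<open>L\<close> each chain is continued by its end point,
      so that \<open>z m\<close> is defined and bounded for every m and one diagonal subsequence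
      serves all m; the lower bound \<delta> then also holds for all m > 0.\<close>
    have "\<exists>L z. 0 < L \<and> infdist (z 0) \<Gamma>1 \<le> \<delta> \<and> (\<forall>m>0. \<delta> \<le> infdist (z m) \<Gamma>1) \<and> \<epsilon> \<le> infdist (z L) \<Gamma>1 \<and>
        (\<forall>m<L. near_step H (?A i) (Suc m < L) (z m) (z (Suc m))) \<and> (\<forall>m. norm (z m) \<le> max R1 R2)"
      for i :: nat
    proof -
      have "\<eta> i > 0" by (simp add: \<eta>_def)
      from ls[OF this] obtain d where "d > 0" and d: "\<forall>(E, x)\<in>solutions_from H (set_ball d \<Gamma>1). \<forall>(t, j)\<in>E.
        (\<forall>(s, k)\<in>E. s \<le> t \<and> k \<le> j \<longrightarrow> x (s, k) \<in> set_ball r \<Gamma>1) \<longrightarrow> x (t, j) \<in> set_ball (\<eta> i) \<Gamma>2" by blast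
      \<comment> \<open>\<open>d\<close> activates local stability with tolerance \<eta> i, and
        \<delta> makes the start a visit to the \<delta>-ball, so that a last visit exists.\<close>
      have "min d \<delta> > 0" using \<open>d > 0\<close> \<delta>(1) by simp
      with unstable have "\<not> range_of_solutions H (set_ball (min d \<delta>) \<Gamma>1) \<subseteq> set_ball \<epsilon>0 \<Gamma>1" by blast
      then obtain E x p where Ex: "(E, x) \<in> solutions_from H (set_ball (min d \<delta>) \<Gamma>1)" "p \<in> E" "x p \<notin> set_ball \<epsilon>0 \<Gamma>1"
        unfolding range_of_solutions_def by auto
      obtain t j where p: "p = (t, j)" by (cases p)
      have sol: "solution H E x" and x0: "infdist (x (0, 0)) \<Gamma>1 < min d \<delta>"
        using Ex(1) by (auto simp: solutions_from_def maximal_solution_def set_ball_def)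
      have Exd: "(E, x) \<in> solutions_from H (set_ball d \<Gamma>1)"
        using Ex(1) by (auto simp: solutions_from_def set_ball_def)
      have loc: "x (t, j) \<in> set_ball (\<eta> i) \<Gamma>2"
        if "(t, j) \<in> E" "\<forall>(s, k)\<in>E. s \<le> t \<and> k \<le> j \<longrightarrow> x (s, k) \<in> set_ball r \<Gamma>1" for t j
        using bspec[OF bspec[OF d Exd, unfolded prod.case] that(1), unfolded prod.case] that(2) by blast
      have exit: "(t, j) \<in> E" "x (t, j) \<notin> set_ball \<epsilon> \<Gamma>1"
        using Ex(2,3) \<open>\<epsilon> \<le> \<epsilon>0\<close> by (auto simp: p set_ball_def)
      obtain N u where u: "u 0 = x (0, 0)" "infdist (u N) \<Gamma>1 \<ge> \<epsilon>" "\<And>n. n < N \<Longrightarrow> u n \<in> K"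
        "\<And>n. n < N \<Longrightarrow> near_step H (?A i) (Suc n < N) (u n) (u (Suc n))"
      proof (rule locally_stable_near_decomposition[OF loc sol \<open>\<epsilon> \<le> r\<close> exit])
        fix N u assume u: "u 0 = x (0, 0)" "\<epsilon> \<le> infdist (u N) \<Gamma>1" "\<And>n. n < N \<Longrightarrow> infdist (u n) \<Gamma>1 \<le> \<epsilon>"
          "\<And>n. n < N \<Longrightarrow> near_step H ({y. infdist y \<Gamma>1 \<le> \<epsilon>} \<inter> {y. infdist y \<Gamma>2 \<le> \<eta> i}) (Suc n < N) (u n) (u (Suc n))"
        show thesis by (rule that[OF u(1,2) _ u(4)[folded K_def]]) (simp add: K_def u(3))
      qed
      have "infdist (u 0) \<Gamma>1 \<le> \<delta>" "infdist (u N) \<Gamma>1 > \<delta>" using x0 u(1,2) \<delta>(4) by auto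
      then obtain n where n: "n < N" "infdist (u n) \<Gamma>1 \<le> \<delta>" "\<And>k. n < k \<Longrightarrow> k \<le> N \<Longrightarrow> infdist (u k) \<Gamma>1 > \<delta>"
        by (rule last_visit[of "\<lambda>n. infdist (u n) \<Gamma>1"]) blast
      \<comment> \<open>The final point may lie outside \<open>K\<close>, so it is bounded as the
        end of a step that starts in \<open>K\<close>.\<close>
      have bd: "norm (u k) \<le> max R1 R2" if kN: "k \<le> N" for k
      proof (cases "k < N")
        case True
        then show ?thesis using R2[OF u(3)] by fastforce
      next
        case False
        then obtain l where l: "k = Suc l" "l < N" using kN n(1) by (cases k) auto
        have "norm (u k) \<le> R1" unfolding l(1) by (rule R1[OF _ u(3) u(4)]) (use l in auto)
        then show ?thesis by simp
      qed
      show ?thesis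
      proof (intro exI[of _ "N - n"] exI[of _ "\<lambda>m. u (min (n + m) N)"] conjI allI impI)
        show "0 < N - n" "infdist (u (min (n + 0) N)) \<Gamma>1 \<le> \<delta>" "\<epsilon> \<le> infdist (u (min (n + (N - n)) N)) \<Gamma>1"
          using n u(2) by simp_all
        fix m
        show "norm (u (min (n + m) N)) \<le> max R1 R2" by (rule bd) simp
        show "\<delta> \<le> infdist (u (min (n + m) N)) \<Gamma>1" if "0 < m"
          using n(3)[of "min (n + m) N"] that n(1) by simp
        show "near_step H (?A i) (Suc m < N - n) (u (min (n + m) N)) (u (min (n + Suc m) N))" if "m < N - n"
        proof -
          have "min (n + m) N = n + m" "min (n + Suc m) N = Suc (n + m)" "Suc m < N - n \<longleftrightarrow> Suc (n + m) < N"
            using that by auto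
          then show ?thesis using u(4)[of "n + m"] that by simp
        qed
      qed
    qed
    then obtain L z where L: "\<And>i. 0 < L i" and z0: "\<And>i. infdist (z i 0) \<Gamma>1 \<le> \<delta>"
      and zm: "\<And>i m. m > 0 \<Longrightarrow> \<delta> \<le> infdist (z i m) \<Gamma>1" and zL: "\<And>i. \<epsilon> \<le> infdist (z i (L i)) \<Gamma>1"
      and zstep: "\<And>i m. m < L i \<Longrightarrow> near_step H (?A i) (Suc m < L i) (z i m) (z i (Suc m))"
      and zbd: "\<And>i m. norm (z i m) \<le> max R1 R2"
      by metis
    obtain \<sigma> where \<sigma>: "strict_mono (\<sigma> :: nat \<Rightarrow> nat)" "\<And>m. m \<in> UNIV \<Longrightarrow> \<exists>l. (\<lambda>i. z (\<sigma> i) m) \<longlonglongrightarrow> l"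
      by (rule function_convergent_subsequence[of UNIV z "max R1 R2"]) (use zbd in auto)
    then obtain Z where Z: "\<And>m. (\<lambda>i. z (\<sigma> i) m) \<longlonglongrightarrow> Z m" by (metis UNIV_I)
    have \<eta>\<sigma>: "(\<lambda>i. \<eta> (\<sigma> i)) \<longlonglongrightarrow> 0" using LIMSEQ_subseq_LIMSEQ[OF \<eta> \<sigma>(1)] by (simp add: comp_def)
    have Z0: "infdist (Z 0) \<Gamma>1 \<le> \<delta>"
      by (rule LIMSEQ_le_const2[OF tendsto_infdist[OF Z]]) (use z0 in auto)
    \<comment> \<open>The flag \<open>b\<close> tells whether step m is followed by another one; it
      must be the same for infinitely many chains.\<close>
    have Zstep: "step ?H b (Z m) (Z (Suc m))"
      if "infinite {i. m < L (\<sigma> i) \<and> (Suc m < L (\<sigma> i) \<longleftrightarrow> b)}" for m b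
      using H \<open>compact K\<close> \<open>closed \<Gamma>2\<close> \<open>\<Gamma>2 \<noteq> {}\<close> that
    proof (rule near_step_limit[OF _ _ _ _ _ _ \<eta>\<sigma> Z Z])
      fix i assume "i \<in> {i. m < L (\<sigma> i) \<and> (Suc m < L (\<sigma> i) \<longleftrightarrow> b)}"
      then show "near_step H (?A (\<sigma> i)) b (z (\<sigma> i) m) (z (\<sigma> i) (Suc m))"
        using zstep[of m "\<sigma> i"] by simp
    qed
    show False
    \<comment> \<open>Either some length occurs infinitely often, or each occurs only finitely often
      and the lengths tend to infinity.\<close>
    proof (cases "\<exists>l. infinite {i. L (\<sigma> i) = l}")
      case True
      then obtain l where l: "infinite {i. L (\<sigma> i) = l}" by blast
      have "infdist (Z l) \<Gamma>1 < \<epsilon>"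
      proof (rule stable_finite_chain[OF \<delta>1])
        show "infdist (Z 0) \<Gamma>1 < \<delta>1" using Z0 \<delta>(2) by simp
        fix n assume "n < l"
        then have "{i. L (\<sigma> i) = l} \<subseteq> {i. n < L (\<sigma> i) \<and> (Suc n < L (\<sigma> i) \<longleftrightarrow> Suc n < l)}" by auto
        then show "step ?H (Suc n < l) (Z n) (Z (Suc n))"
          using l by (intro Zstep) (rule infinite_super)
      qed
      \<comment> \<open>The end points have distance at least \<epsilon>, and so does their limit,
        against relative stability.\<close>
      moreover have "Z l \<in> {y. \<epsilon> \<le> infdist y \<Gamma>1}"
      proof (rule closed_limit_infinitely_often[OF l _ _ Z])
        show "closed {y. \<epsilon> \<le> infdist y \<Gamma>1}" by (intro closed_Collect_le continuous_intros)
        show "z (\<sigma> i) l \<in> {y. \<epsilon> \<le> infdist y \<Gamma>1}" if "i \<in> {i. L (\<sigma> i) = l}" for i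
          using that zL[of "\<sigma> i"] by auto
      qed
      ultimately show False by simp
    next
      case False
      have "step ?H True (Z n) (Z (Suc n))" for n
      proof (rule Zstep)
        \<comment> \<open>All but finitely many chains are longer than \<open>Suc n\<close>, so step
          n is not their last one and advances hybrid time by at least 1.\<close>
        have "finite (\<Union>l\<le>Suc n. {i. L (\<sigma> i) = l})" using False by blast
        moreover have "(UNIV :: nat set) = {i. n < L (\<sigma> i) \<and> (Suc n < L (\<sigma> i) \<longleftrightarrow> True)} \<union> (\<Union>l\<le>Suc n. {i. L (\<sigma> i) = l})"
          by auto
        ultimately show "infinite {i. n < L (\<sigma> i) \<and> (Suc n < L (\<sigma> i) \<longleftrightarrow> True)}"
          by (metis finite_UnI infinite_UNIV_nat)
      qed
      moreover have "Z 0 \<in> basin_of_attraction ?H \<Gamma>1" using Z0 \<delta>(3) \<delta>2 by auto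
      moreover have "\<delta> \<le> infdist (Z (Suc n)) \<Gamma>1" for n
        by (rule LIMSEQ_le_const[OF tendsto_infdist[OF Z]]) (use zm in auto)
      ultimately show False using \<delta>(1) by (intro not_attracted_infinite_chain[of Z ?H \<Gamma>1 \<delta>])
    qed
  qed
qed

theorem mainTheorem1:
  fixes H :: "(real ^ 'n) hybrid_system" and \<Gamma>1 \<Gamma>2 :: "(real ^ 'n) set"
  assumes "basic_assumptions H"
    and "\<Gamma>1 \<subseteq> \<Gamma>2" and "compact \<Gamma>1" and "closed \<Gamma>2"
    and "asymptotically_stable_relative_to H \<Gamma>1 \<Gamma>2"
    and "locally_stable_near H \<Gamma>2 \<Gamma>1"
  shows "stable_set H \<Gamma>1"
  using assms by (rule stable_if_relatively_asymptotically_stable)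

end
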